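(* Let $-1\le\alpha\le0\le\beta\le1$, let $\sigma$ be a finite nonnegative measure with infinite support on $E=[-1,\alpha]\cup[\beta,1]$, and let $$\mathfrak F(\lambda)=\int_E\frac{t\,d\sigma(t)}{t-\lambda}\in\mathbf D^-_{-\infty},\qquad F(\lambda)=\int_E\frac{d\sigma(t)}{t-\lambda}.$$ Let $\{\mathfrak n_j\}_{j\ge1}$ be the normal indices of the coefficient sequence $\mathfrak s_j=\int_Et^{j+1}d\sigma(t)$, $j\in\mathbb Z_+$, of $\mathfrak F$, and $\mathfrak n_0=0$. Then the following statements are equivalent: (i) for $\mathfrak s_{-1}:=\int_Ed\sigma(t)$, the operator $U=U(\mathfrak s_{-1})$ in the block $UL$-factorization $\mathfrak J=UL$ (with parameter $\mathfrak s_{-1}$) of the monic generalized Jacobi matrix $\mathfrak J$ associated with $\mathfrak F$ is bounded in $\ell^2_{[0,\infty)}$; (ii) the operator $U$ in the block $LU$-factorization $J=LU$ of the monic Jacobi matrix $J$ associated with $F$ is bounded in $\ell^2_{[0,\infty)}$; (iii) the sequence $\{\mathfrak F^{[\mathfrak n_j/\mathfrak n_j]}\}_{j=0}^\infty$ of diagonal Padé approximants converges to $\mathfrak F$ locally uniformly in $\widehat{\mathbb C}\setminus([-1-\varepsilon,\alpha]\cup[\beta,1+\varepsilon])$ for some $\varepsilon\ge0$.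
   Context: $\widehat{\mathbb C}=\mathbb C\cup\{\infty\}$ with the spherical metric. $\lambda\widehat\to\infty$ means that $\lambda\to\infty$ inside a sector $\varepsilon<\arg\lambda<\pi-\varepsilon$, $\varepsilon>0$; $\mathfrak F(\lambda)\sim-\sum_j\mathfrak s_j\lambda^{-j-1}$ denotes the asymptotic expansion to all orders as $\lambda\widehat\to\infty$. $\mathbf N_{-\infty}$ is the class of functions $\int_{\mathbb R}\frac{d\mu(t)}{t-\lambda}$ with $\mu$ a finite measure with all moments finite. $\mathbf D^-_{-\infty}$: functions $\mathfrak F$ meromorphic in $\mathbb C_+$ such that for some $\mathfrak s_{-1}\in\mathbb R\setminus\{0\}$ one has $-\frac{\mathfrak s_{-1}}{\lambda}+\frac{\mathfrak F(\lambda)}{\lambda}\in\mathbf N_{-\infty}$. Padé approximants: for a formal power series $\mathfrak F=-\sum_{j\ge0}\mathfrak s_j\lambda^{-j-1}$, the $[L/M]$ approximant is a ratio $A(1/\lambda)/B(1/\lambda)$ of polynomials of formal degrees $L$ and $M$ with $B(0)\neq0$ and $\sum_{j=0}^{L+M-1}\mathfrak s_j\lambda^{-j-1}+\mathfrak F^{[L/M]}(\lambda)=O(\lambda^{-L-M-1})$, $\lambda\to\infty$. Jacobi matrix: $s_j=\int t^jd\sigma$; the monic orthogonal polynomials $P_j$ of $\sigma/s_0$ satisfy $\lambda P_j=P_{j+1}+b_jP_j+c_{j-1}P_{j-1}$, $P_{-1}=0$, $P_0=1$; the monic Jacobi matrix associated with $F$ has $J_{j,j}=b_j$, $J_{j,j+1}=1$,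 $J_{j+1,j}=c_j$. Normal indices of $\{\mathfrak s_j\}_{j\ge0}$: integers $n\ge1$ with $\det(\mathfrak s_{i+k})_{i,k=0}^{n-1}\ne0$, listed increasingly $\mathfrak n_1<\mathfrak n_2<\dots$; $\mathfrak n_0=0$, $\mathfrak k_j=\mathfrak n_{j+1}-\mathfrak n_j\in\{1,2\}$. Generalized Jacobi matrix: $\mathfrak F$ (nonrational) is normalized if its first nonzero coefficient $\mathfrak s_{\mathfrak n_1-1}$ has modulus $1$. For normalized $\mathfrak F$ put $\mathfrak F_0=\mathfrak F$ and recursively $-1/\mathfrak F_j(\lambda)=\epsilon_j\mathfrak p_j(\lambda)+\mathfrak b_j^2\mathfrak F_{j+1}(\lambda)$, where $\epsilon_j=\pm1$ is the first nonzero asymptotic coefficient of $\mathfrak F_j$, $\mathfrak p_j$ is the monic polynomial (of degree $\mathfrak k_j$) with $-1/\mathfrak F_j-\epsilon_j\mathfrak p_j=o(1)$ as $\lambda\widehat\to\infty$, and $\mathfrak b_j>0$ makes $\mathfrak F_{j+1}$ normalized. Put $\mathfrak c_j=\epsilon_j\epsilon_{j+1}\mathfrak b_j^2$; $\mathfrak p_j(\lambda)=\lambda+\mathfrak p_0^{(j)}$ if $\mathfrak k_j=1$, $\mathfrak p_j(\lambda)=\lambda^2+\mathfrak p_1^{(j)}\lambda+\mathfrak p_0^{(j)}$ if $\mathfrak k_j=2$. The monic generalized Jacobi matrix associated with $\mathfrak F$ is the block tridiagonal matrix with diagonal blocks $-\mathfrak p_0^{(j)}$ ($\mathfrak k_j=1$)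 or $\begin{pmatrix}0&1\\-\mathfrak p_0^{(j)}&-\mathfrak p_1^{(j)}\end{pmatrix}$ ($\mathfrak k_j=2$), superdiagonal $\mathfrak k_j\times\mathfrak k_{j+1}$ blocks with lower-left entry $1$ and other entries $0$, and subdiagonal $\mathfrak k_{j+1}\times\mathfrak k_j$ blocks with lower-left entry $\mathfrak c_j$ and other entries $0$. For $\mathfrak F$ not normalized one uses $\mathfrak F/|\mathfrak s_{\mathfrak n_1-1}|$. Form of $L$ and $U$ in (i) and (ii): $L$ has identity diagonal blocks $I_{\mathfrak k_j}$, subdiagonal blocks $L_{j+1}$ ($\mathfrak k_{j+1}\times\mathfrak k_j$, upper-left entry $l_{j+1}$, other entries $0$) and zeros elsewhere; $U$ has diagonal blocks $U_j=u_0^{(j)}$ if $\mathfrak k_j=1$, $U_j=\begin{pmatrix}0&1\\ u_0^{(j)}&u_1^{(j)}\end{pmatrix}$ if $\mathfrak k_j=2$, superdiagonal blocks $D_j$ ($\mathfrak k_j\times\mathfrak k_{j+1}$, lower-left entry $1$, other entries $0$) and zeros elsewhere. The $LU$-factorization $J=LU$ of this form exists and is unique. The $UL$-factorization $\mathfrak J=UL$ with parameter $\mathfrak s_{-1}$ is the (unique) one of this form with $u_0^{(0)}=\mathfrak s_{\mathfrak n_1-1}/\mathfrak s_{-1}$. A matrix is bounded in $\ell^2_{[0,\infty)}$ if it defines a bounded operator there. *)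

theory Defs
  imports
    "HOL-Complex_Analysis.Complex_Analysis"
    "HOL-Library.Landau_Symbols"
    "HOL-Library.Infinite_Set"
    "Jordan_Normal_Form.Determinant"
begin

section \<open>The Riemann sphere with the spherical metric\<close>

datatype rsphere = Fin complex | Infty

fun stereo :: "rsphere \<Rightarrow> complex \<times> real" where
  "stereo (Fin z) =
     (2 * z / of_real (1 + (cmod z)\<^sup>2), ((cmod z)\<^sup>2 - 1) / ((cmod z)\<^sup>2 + 1))"
| "stereo Infty = (0, 1)"

lemma stereo_inj: "stereo p = stereo q \<Longrightarrow> p = q"
proof -
  assume h: "stereo p = stereo q"
  have pos: "1 + (cmod z)\<^sup>2 > 0" for z by (smt (verit) zero_le_power2)
  have snd1: "(a - 1) / (a + 1) \<noteq> 1" for a :: real by (simp add: divide_eq_eq)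
  show "p = q"
  proof (cases p; cases q)
    fix z w assume pq: "p = Fin z" "q = Fin w"
    let ?a = "(cmod z)\<^sup>2" and ?b = "(cmod w)\<^sup>2"
    have "(?a - 1) / (?a + 1) = (?b - 1) / (?b + 1)" using h pq by simp
    hence "?a = ?b" using pos[of z] pos[of w] by (simp add: field_simps)
    moreover have "2 * z / of_real (1 + ?a) = 2 * w / of_real (1 + ?b)" using h pq by simp
    moreover have "of_real (1 + ?b) \<noteq> (0::complex)"
      using pos[of w] of_real_eq_0_iff[of "1 + ?b", where 'a = complex] by linarith
    ultimately have "2 * z = 2 * w" by (metis divide_cancel_right)
    thus "p = q" using pq by simp
  next
    fix z assume "p = Fin z" "q = Infty" thus "p = q" using h snd1[of "(cmod z)\<^sup>2"] by auto
  next
    fix z assume "p = Infty" "q = Fin z" thus "p = q" using h snd1[of "(cmod z)\<^sup>2"] by auto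
  qed auto
qed

text \<open>The chordal metric: \<open>dist (Fin z) (Fin w) = 2 \<bar>z - w\<bar> / (sqrt (1 + \<bar>z\<bar>\<^sup>2) sqrt (1 + \<bar>w\<bar>\<^sup>2))\<close>.
  It is uniformly equivalent to the geodesic metric of the sphere.\<close>

instantiation rsphere :: metric_space
begin

definition dist_rsphere :: "rsphere \<Rightarrow> rsphere \<Rightarrow> real" where
  "dist_rsphere p q = dist (stereo p) (stereo q)"

definition uniformity_rsphere :: "(rsphere \<times> rsphere) filter" where
  "uniformity_rsphere = (INF e\<in>{0 <..}. principal {(p, q). dist p q < e})"

definition open_rsphere :: "rsphere set \<Rightarrow> bool" where
  "open_rsphere U \<longleftrightarrow> (\<forall>p\<in>U. eventually (\<lambda>(p', q). p' = p \<longrightarrow> q \<in> U) uniformity)"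

instance
proof
  fix p q r :: rsphere
  show "dist p q = 0 \<longleftrightarrow> p = q" by (auto simp: dist_rsphere_def stereo_inj)
  show "dist p q \<le> dist p r + dist q r"
    unfolding dist_rsphere_def by (rule dist_triangle2)
qed (simp_all only: uniformity_rsphere_def open_rsphere_def)

end

text \<open>The extension by limits of a function on the plane to the sphere.  For a rational function
  \<open>f\<close> this gives its values at poles, removable singularities and \<open>\<infinity>\<close>, where the
  value of the HOL term \<open>f w\<close> carries no information because of \<open>x / 0 = 0\<close>.\<close>

definition sphere_ext :: "(complex \<Rightarrow> complex) \<Rightarrow> rsphere \<Rightarrow> rsphere" where
  "sphere_ext f p = Lim (at p) (\<lambda>q. case q of Fin w \<Rightarrow> Fin (f w) | Infty \<Rightarrow> Infty)"

definition locally_uniform_limit ::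
    "'a::topological_space set \<Rightarrow> (nat \<Rightarrow> 'a \<Rightarrow> 'b::metric_space) \<Rightarrow> ('a \<Rightarrow> 'b) \<Rightarrow> bool" where
  "locally_uniform_limit D f g \<longleftrightarrow>
     (\<forall>p\<in>D. \<exists>V. open V \<and> p \<in> V \<and> uniform_limit (V \<inter> D) f g sequentially)"


section \<open>Measures, Cauchy transforms and function classes\<close>

definition measure_support :: "real measure \<Rightarrow> real set" where
  "measure_support \<mu> = {x. \<forall>V. open V \<and> x \<in> V \<longrightarrow> emeasure \<mu> V > 0}"

definition cauchy_transform :: "real measure \<Rightarrow> complex \<Rightarrow> complex" where
  "cauchy_transform \<mu> z = (LINT t|\<mu>. 1 / (complex_of_real t - z))"

definition class_N :: "(complex \<Rightarrow> complex) \<Rightarrow> bool" where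
  "class_N f \<longleftrightarrow> (\<exists>\<mu>. finite_measure \<mu> \<and> sets \<mu> = sets borel \<and>
     (\<forall>n::nat. integrable \<mu> (\<lambda>t. t ^ n)) \<and>
     (\<forall>z. Im z > 0 \<longrightarrow> f z = cauchy_transform \<mu> z))"

definition class_D_minus :: "(complex \<Rightarrow> complex) \<Rightarrow> bool" where
  "class_D_minus f \<longleftrightarrow> f meromorphic_on {z. Im z > 0} \<and>
     (\<exists>c::real. c \<noteq> 0 \<and> class_N (\<lambda>z. - of_real c / z + f z / z))"


section \<open>Asymptotic expansions at infinity\<close>

definition sector_at_infinity :: "real \<Rightarrow> complex filter" where
  "sector_at_infinity \<epsilon> = inf at_infinity (principal {z. \<epsilon> < Arg z \<and> Arg z < pi - \<epsilon>})"

definition has_asymp_expansion :: "(complex \<Rightarrow> complex) \<Rightarrow> (nat \<Rightarrow> real) \<Rightarrow> bool" where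
  "has_asymp_expansion f s \<longleftrightarrow> (\<forall>\<epsilon>>0. \<forall>n.
     (\<lambda>z. f z + (\<Sum>j\<le>n. of_real (s j) / z ^ (j + 1))) \<in> o[sector_at_infinity \<epsilon>](\<lambda>z. 1 / z ^ (n + 1)))"

definition asymp_coeffs :: "(complex \<Rightarrow> complex) \<Rightarrow> nat \<Rightarrow> real" where
  "asymp_coeffs f = (THE s. has_asymp_expansion f s)"

definition first_coeff :: "(complex \<Rightarrow> complex) \<Rightarrow> real" where
  "first_coeff f = asymp_coeffs f (LEAST j. asymp_coeffs f j \<noteq> 0)"

definition normalized :: "(complex \<Rightarrow> complex) \<Rightarrow> bool" where
  "normalized f \<longleftrightarrow> \<bar>first_coeff f\<bar> = 1"


section \<open>Normal indices\<close>

definition hankel_det :: "(nat \<Rightarrow> real) \<Rightarrow> nat \<Rightarrow> real" where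
  "hankel_det s n = Determinant.det (Matrix.mat n n (\<lambda>(i, k). s (i + k)))"

definition normal_index :: "(nat \<Rightarrow> real) \<Rightarrow> nat \<Rightarrow> nat" where
  "normal_index s j =
     (if j = 0 then 0 else enumerate {n. n \<ge> 1 \<and> hankel_det s n \<noteq> 0} (j - 1))"


section \<open>Infinite matrices\<close>

definition matrix_prod :: "(nat \<Rightarrow> nat \<Rightarrow> real) \<Rightarrow> (nat \<Rightarrow> nat \<Rightarrow> real) \<Rightarrow> nat \<Rightarrow> nat \<Rightarrow> real" where
  "matrix_prod A B i k = (\<Sum>m. A i m * B m k)"

definition ell2 :: "(nat \<Rightarrow> complex) set" where
  "ell2 = {x. summable (\<lambda>i. (cmod (x i))\<^sup>2)}"

definition ell2_norm :: "(nat \<Rightarrow> complex) \<Rightarrow> real" where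
  "ell2_norm x = sqrt (\<Sum>i. (cmod (x i))\<^sup>2)"

definition matrix_app :: "(nat \<Rightarrow> nat \<Rightarrow> real) \<Rightarrow> (nat \<Rightarrow> complex) \<Rightarrow> nat \<Rightarrow> complex" where
  "matrix_app A x i = (\<Sum>k. of_real (A i k) * x k)"

definition ell2_bounded :: "(nat \<Rightarrow> nat \<Rightarrow> real) \<Rightarrow> bool" where
  "ell2_bounded A \<longleftrightarrow> (\<exists>C. \<forall>x\<in>ell2.
     (\<forall>i. summable (\<lambda>k. of_real (A i k) * x k)) \<and>
     matrix_app A x \<in> ell2 \<and> ell2_norm (matrix_app A x) \<le> C * ell2_norm x)"

text \<open>A block structure is given by the positions \<open>0 = n 0 < n 1 < \<dots>\<close> at which the blocks start;
  \<open>B I K r c\<close> is entry \<open>(r, c)\<close>, counted from \<open>0\<close>, of block \<open>(I, K)\<close>.\<close>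

definition block_of :: "(nat \<Rightarrow> nat) \<Rightarrow> nat \<Rightarrow> nat" where
  "block_of n i = (THE j. n j \<le> i \<and> i < n (Suc j))"

definition block_size :: "(nat \<Rightarrow> nat) \<Rightarrow> nat \<Rightarrow> nat" where
  "block_size n j = n (Suc j) - n j"

definition block_matrix ::
    "(nat \<Rightarrow> nat) \<Rightarrow> (nat \<Rightarrow> nat \<Rightarrow> nat \<Rightarrow> nat \<Rightarrow> real) \<Rightarrow> nat \<Rightarrow> nat \<Rightarrow> real" where
  "block_matrix n B i k =
     B (block_of n i) (block_of n k) (i - n (block_of n i)) (k - n (block_of n k))"

text \<open>The \<open>k \<times> k\<close> block \<open>(x)\<close> if \<open>k = 1\<close>, and the block with rows \<open>(0, 1)\<close>, \<open>(x, y)\<close> if \<open>k = 2\<close>;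
  no other block sizes occur.\<close>

definition diag_block :: "nat \<Rightarrow> real \<Rightarrow> real \<Rightarrow> nat \<Rightarrow> nat \<Rightarrow> real" where
  "diag_block k x y r c =
     (if k = 1 then x
      else if r = 0 then (if c = 0 then 0 else 1)
      else (if c = 0 then x else y))"

text \<open>A block with \<open>k\<close> rows whose lower-left entry is \<open>x\<close> and whose other entries vanish.\<close>

definition corner_block :: "nat \<Rightarrow> real \<Rightarrow> nat \<Rightarrow> nat \<Rightarrow> real" where
  "corner_block k x r c = (if r = k - 1 \<and> c = 0 then x else 0)"

definition block_lower :: "(nat \<Rightarrow> nat) \<Rightarrow> (nat \<Rightarrow> real) \<Rightarrow> nat \<Rightarrow> nat \<Rightarrow> real" where
  "block_lower n l = block_matrix n (\<lambda>I K r c.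
     if I = K then (if r = c then 1 else 0)
     else if I = Suc K then (if r = 0 \<and> c = 0 then l I else 0)
     else 0)"

definition block_upper ::
    "(nat \<Rightarrow> nat) \<Rightarrow> (nat \<Rightarrow> real) \<Rightarrow> (nat \<Rightarrow> real) \<Rightarrow> nat \<Rightarrow> nat \<Rightarrow> real" where
  "block_upper n u0 u1 = block_matrix n (\<lambda>I K.
     if I = K then diag_block (block_size n I) (u0 I) (u1 I)
     else if K = Suc I then corner_block (block_size n I) 1
     else (\<lambda>r c. 0))"

definition block_LU_factorization ::
    "(nat \<Rightarrow> real) \<Rightarrow> (nat \<Rightarrow> nat \<Rightarrow> real) \<Rightarrow> (nat \<Rightarrow> nat \<Rightarrow> real) \<Rightarrow> (nat \<Rightarrow> nat \<Rightarrow> real) \<Rightarrow> bool" where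
  "block_LU_factorization s J L U \<longleftrightarrow>
     (\<exists>l u0 u1. L = block_lower (normal_index s) l \<and> U = block_upper (normal_index s) u0 u1 \<and>
        J = matrix_prod L U)"

text \<open>Here \<open>c\<close> is the parameter of the factorization, that is, the moment of index \<open>-1\<close>.\<close>

definition block_UL_factorization ::
    "(nat \<Rightarrow> real) \<Rightarrow> real \<Rightarrow> (nat \<Rightarrow> nat \<Rightarrow> real) \<Rightarrow> (nat \<Rightarrow> nat \<Rightarrow> real) \<Rightarrow> (nat \<Rightarrow> nat \<Rightarrow> real) \<Rightarrow> bool" where
  "block_UL_factorization s c J L U \<longleftrightarrow>
     (\<exists>l u0 u1. L = block_lower (normal_index s) l \<and> U = block_upper (normal_index s) u0 u1 \<and>
        J = matrix_prod U L \<and> u0 0 = s (normal_index s 1 - 1) / c)"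


section \<open>The monic Jacobi matrix of a measure\<close>

text \<open>This is the matrix associated with the function \<open>F = cauchy_transform \<mu>\<close>.
  Monic orthogonal polynomials, and hence the recurrence coefficients, do not change if \<open>\<mu>\<close> is
  divided by its total mass.\<close>

definition monic_op :: "real measure \<Rightarrow> nat \<Rightarrow> real poly" where
  "monic_op \<mu> j = (THE p. lead_coeff p = 1 \<and> Polynomial.degree p = j \<and>
     (\<forall>q. Polynomial.degree q < j \<longrightarrow> (LINT t|\<mu>. poly p t * poly q t) = 0))"

definition three_term :: "real measure \<Rightarrow> nat \<Rightarrow> real \<Rightarrow> real \<Rightarrow> bool" where
  "three_term \<mu> j b c \<longleftrightarrow> [:0, 1:] * monic_op \<mu> j =
     monic_op \<mu> (Suc j) + Polynomial.smult b (monic_op \<mu> j) +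
       (if j = 0 then 0 else Polynomial.smult c (monic_op \<mu> (j - 1)))"

definition jacobi_b :: "real measure \<Rightarrow> nat \<Rightarrow> real" where
  "jacobi_b \<mu> j = (THE b. \<exists>c. three_term \<mu> j b c)"

definition jacobi_c :: "real measure \<Rightarrow> nat \<Rightarrow> real" where
  "jacobi_c \<mu> j = (THE c. \<exists>b. three_term \<mu> (Suc j) b c)"

definition monic_jacobi_matrix :: "real measure \<Rightarrow> nat \<Rightarrow> nat \<Rightarrow> real" where
  "monic_jacobi_matrix \<mu> i k =
     (if k = i then jacobi_b \<mu> i
      else if k = Suc i then 1
      else if i = Suc k then jacobi_c \<mu> k
      else 0)"


section \<open>The monic generalized Jacobi matrix of a function\<close>

definition poly_part :: "(complex \<Rightarrow> complex) \<Rightarrow> real poly" where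
  "poly_part f = (THE p. lead_coeff p = 1 \<and> (\<forall>\<epsilon>>0.
     (\<lambda>z. - 1 / f z - of_real (first_coeff f) * poly (map_poly of_real p) z)
       \<in> o[sector_at_infinity \<epsilon>](\<lambda>z. 1)))"

definition schur_remainder :: "(complex \<Rightarrow> complex) \<Rightarrow> complex \<Rightarrow> complex" where
  "schur_remainder f z = - 1 / f z - of_real (first_coeff f) * poly (map_poly of_real (poly_part f)) z"

definition schur_scale :: "(complex \<Rightarrow> complex) \<Rightarrow> real" where
  "schur_scale f = (THE b. b > 0 \<and> normalized (\<lambda>z. schur_remainder f z / of_real (b\<^sup>2)))"

text \<open>One step \<open>-1/f = \<epsilon> p + b\<^sup>2 g\<close>, with \<open>g\<close> the result.\<close>

definition schur_step :: "(complex \<Rightarrow> complex) \<Rightarrow> complex \<Rightarrow> complex" where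
  "schur_step f z = schur_remainder f z / of_real ((schur_scale f)\<^sup>2)"

definition schur_iter :: "(complex \<Rightarrow> complex) \<Rightarrow> nat \<Rightarrow> complex \<Rightarrow> complex" where
  "schur_iter f j = (schur_step ^^ j) (\<lambda>z. f z / of_real \<bar>first_coeff f\<bar>)"

definition gen_jacobi_c :: "(complex \<Rightarrow> complex) \<Rightarrow> nat \<Rightarrow> real" where
  "gen_jacobi_c f j = first_coeff (schur_iter f j) * first_coeff (schur_iter f (Suc j)) *
     (schur_scale (schur_iter f j))\<^sup>2"

definition gen_jacobi_matrix :: "(complex \<Rightarrow> complex) \<Rightarrow> nat \<Rightarrow> nat \<Rightarrow> real" where
  "gen_jacobi_matrix f =
     (let n = normal_index (asymp_coeffs f); p = (\<lambda>j. poly_part (schur_iter f j)) in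
      block_matrix n (\<lambda>I K.
        if I = K then diag_block (block_size n I) (- Polynomial.coeff (p I) 0) (- Polynomial.coeff (p I) 1)
        else if K = Suc I then corner_block (block_size n I) 1
        else if I = Suc K then corner_block (block_size n I) (gen_jacobi_c f K)
        else (\<lambda>r c. 0)))"


section \<open>Pade approximants\<close>

text \<open>The approximant as a rational map of the sphere; it does not depend on the choice of
  \<open>A\<close> and \<open>B\<close>.\<close>

definition pade_approximant :: "(nat \<Rightarrow> real) \<Rightarrow> nat \<Rightarrow> nat \<Rightarrow> rsphere \<Rightarrow> rsphere" where
  "pade_approximant s L M = (THE R. \<exists>A B :: complex poly.
     Polynomial.degree A \<le> L \<and> Polynomial.degree B \<le> M \<and> poly B 0 \<noteq> 0 \<and>
     (\<lambda>z. (\<Sum>j<L + M. of_real (s j) / z ^ (j + 1)) + poly A (1 / z) / poly B (1 / z))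
       \<in> O[at_infinity](\<lambda>z. 1 / z ^ (L + M + 1)) \<and>
     R = sphere_ext (\<lambda>z. poly A (1 / z) / poly B (1 / z)))"

end

theory Submission
  imports Defs "HOL-Computational_Algebra.Fundamental_Theorem_Algebra"
begin

text \<open>
  Let \<open>P n\<close> be the monic orthogonal polynomials of \<open>\<sigma>\<close>.  The Hankel determinant of order \<open>n\<close> of the
  shifted moments vanishes iff \<open>P n\<close> vanishes at \<open>0\<close>, and consecutive orthogonal polynomials have no
  common zero; so the normal indices \<open>N j\<close> have gaps \<open>1\<close> or \<open>2\<close>.  All three statements are equivalent
  to the boundedness of \<open>\<tau> (N j)\<close>, where \<open>\<tau> n = poly (P (Suc n)) 0 / poly (P n) 0\<close>.

  For the \<open>LU\<close>-factorization this holds because \<open>J\<close> maps the vector of the values \<open>poly (P n) 0\<close> to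
  \<open>0\<close>, hence so does \<open>U\<close>: the diagonal entries of \<open>U\<close> are the numbers \<open>- \<tau> (N j)\<close>, up to recurrence
  coefficients of \<open>\<sigma>\<close>, which are bounded by \<open>1\<close>.  The generalized Jacobi matrix is \<open>U L\<close> with the same
  factors, since \<open>U\<close> applied to the functions of the second kind of \<open>\<sigma>\<close> produces the functions whose
  successive quotients are the iterates of the Schur algorithm.

  The Pade approximant of order \<open>N j\<close> is \<open>\<Sum>x. W x * x / (x - z)\<close>, where the nodes \<open>x\<close> are the zeros of the
  quasi-orthogonal polynomial \<open>P (Suc n) - \<tau> n P n\<close>, \<open>n = N j\<close>, and \<open>W\<close> are the positive weights of
  the Gauss type quadrature of degree \<open>2 n\<close> at these nodes.  The nodes other than \<open>0\<close> avoid the gap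
  between the intervals, and they are bounded iff \<open>\<tau> (N j)\<close> is.  Bounded nodes give convergence by
  the theorem of Weierstrass; conversely, convergence near infinity keeps the poles bounded.
\<close>

section \<open>Orthogonal polynomials and normal indices\<close>

text \<open>The kernel \<open>t / (t - z)\<close> vanishes at \<open>t = 0\<close>. A quadrature
  rule with \<open>n + 1\<close> nodes, one of them \<open>0\<close>, therefore yields a rational
  function with only \<open>n\<close> poles, and exactness up to degree \<open>2 n\<close> matches
  the \<open>2 n\<close> shifted moments that a diagonal approximant of order \<open>n\<close> has
  to match. The requirement that \<open>0\<close> be a node is what fixes \<open>\<tau> n\<close>.
  Divided by \<open>x\<close>, the quasi-orthogonal polynomial is the orthogonal polynomial of
  degree \<open>n\<close> of the signed measure \<open>t d\<sigma>\<close>; the passage from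
  \<open>\<sigma>\<close> to \<open>t d\<sigma>\<close> is a Christoffel transformation, which on
  matrices exchanges the factors \<open>L\<close> and \<open>U\<close>. The obstacle is that
  \<open>t d\<sigma>\<close> is not positive: hence the blocks of size 2, and hence poles that can
  leave \<open>[-1, 1]\<close>. Working with \<open>\<sigma>\<close> and the additional node
  \<open>0\<close> keeps the weights positive.\<close>

locale two_interval_measure =
  fixes \<alpha> \<beta> :: real and \<sigma> :: "real measure"
  assumes bounds: "-1 \<le> \<alpha>" "\<alpha> \<le> 0" "0 \<le> \<beta>" "\<beta> \<le> 1"
    and finite_meas: "finite_measure \<sigma>"
    and sets_borel [measurable_cong, simp]: "sets \<sigma> = sets borel"
    and null_compl: "emeasure \<sigma> (UNIV - ({-1..\<alpha>} \<union> {\<beta>..1})) = 0"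
    and infinite_support: "infinite (measure_support \<sigma>)"
begin

definition E where "E = {-1..\<alpha>} \<union> {\<beta>..1}"

sublocale finite_measure \<sigma> by (rule finite_meas)

lemma space_UNIV [simp]: "space \<sigma> = UNIV"
  using sets_borel sets_eq_imp_space_eq space_borel by blast

lemma E_bounded: "t \<in> E \<Longrightarrow> \<bar>t\<bar> \<le> 1"
  using bounds by (auto simp: E_def)

lemma compact_E: "compact E" by (simp add: E_def compact_Un)

lemma AE_E: "AE t in \<sigma>. t \<in> E"
  by (rule AE_I[where N = "UNIV - E"]) (use null_compl in \<open>auto simp: E_def\<close>)

lemma integrable_bounded:
  fixes f :: "real \<Rightarrow> 'b::{banach, second_countable_topology}"
  assumes "f \<in> borel_measurable borel" "\<And>t. t \<in> E \<Longrightarrow> norm (f t) \<le> B"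
  shows "integrable \<sigma> f"
proof (rule integrable_const_bound[where B = B])
  show "AE t in \<sigma>. norm (f t) \<le> B" using AE_E assms(2) by auto
  show "f \<in> borel_measurable \<sigma>" using assms(1) by simp
qed

lemma integrable_continuous:
  fixes f :: "real \<Rightarrow> 'b::{banach, second_countable_topology}"
  assumes "f \<in> borel_measurable borel" "continuous_on E f"
  shows "integrable \<sigma> f"
proof -
  have "bounded (f ` E)" by (rule compact_imp_bounded[OF compact_continuous_image[OF assms(2) compact_E]])
  then obtain B where "\<And>t. t \<in> E \<Longrightarrow> norm (f t) \<le> B" by (auto simp: bounded_iff)
  then show ?thesis by (rule integrable_bounded[OF assms(1)])
qed

lemma integral_norm_bound:
  fixes f :: "real \<Rightarrow> 'b::{banach, second_countable_topology}"
  assumes "f \<in> borel_measurable borel" "\<And>t. t \<in> E \<Longrightarrow> norm (f t) \<le> B"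
  shows "norm (LINT t|\<sigma>. f t) \<le> B * measure \<sigma> UNIV"
proof -
  have int: "integrable \<sigma> f" by (rule integrable_bounded[OF assms])
  have "norm (LINT t|\<sigma>. f t) \<le> (LINT t|\<sigma>. norm (f t))" by (rule integral_norm_bound)
  also have "\<dots> \<le> (LINT t|\<sigma>. B)"
    by (rule integral_mono_AE) (use int AE_E assms(2) in auto)
  finally show ?thesis by (simp add: mult.commute)
qed

section \<open>The moment functional and its positivity\<close>

definition I :: "real poly \<Rightarrow> real" where "I p = (LINT t|\<sigma>. poly p t)"

lemma integrable_poly [simp]: "integrable \<sigma> (poly p :: real \<Rightarrow> real)"
  by (rule integrable_continuous) (auto intro!: borel_measurable_continuous_onI continuous_intros)

lemma I_add: "I (p + q) = I p + I q" and I_diff: "I (p - q) = I p - I q"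
  and I_smult: "I (Polynomial.smult a p) = a * I p" and I_0: "I 0 = 0"
  and I_minus: "I (- p) = - I p"
  by (simp_all add: I_def)

lemma I_sum: "I (sum f A) = (\<Sum>x\<in>A. I (f x))"
  by (induction A rule: infinite_finite_induct) (auto simp: I_add I_0)

lemma I_nonneg: "(\<And>t. t \<in> E \<Longrightarrow> poly p t \<ge> 0) \<Longrightarrow> I p \<ge> 0"
  unfolding I_def by (rule integral_nonneg_AE) (use AE_E in auto)

lemma I_mono: "(\<And>t. t \<in> E \<Longrightarrow> poly p t \<le> poly q t) \<Longrightarrow> I p \<le> I q"
  using I_nonneg[of "q - p"] by (simp add: I_diff)

text \<open>If the integral vanished, the open set where \<open>p\<close> does not vanish would be
  null, and the support would consist of zeros of \<open>p\<close>, finitely many.\<close>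

lemma I_pos:
  assumes "p \<noteq> 0" "\<And>t. t \<in> E \<Longrightarrow> poly p t \<ge> 0"
  shows "I p > 0"
proof (rule ccontr)
  assume "\<not> I p > 0"
  with I_nonneg[of p] assms(2) have 0: "I p = 0" by fastforce
  have ae: "AE t in \<sigma>. 0 \<le> poly p t" using AE_E assms(2) by auto
  have "AE t in \<sigma>. poly p t = 0"
    using 0 integral_nonneg_eq_0_iff_AE[OF integrable_poly ae] by (simp add: I_def)
  then obtain N where N: "N \<in> null_sets \<sigma>" "{t \<in> space \<sigma>. poly p t \<noteq> 0} \<subseteq> N"
    by (auto simp: eventually_ae_filter)
  have "closed {t. poly p t = 0}" using assms(1) poly_roots_finite finite_imp_closed by blast
  then have op: "open {t. poly p t \<noteq> 0}" by (simp add: Collect_neg_eq open_closed)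
  have "measure_support \<sigma> \<subseteq> {t. poly p t = 0}"
  proof
    fix x assume x: "x \<in> measure_support \<sigma>"
    show "x \<in> {t. poly p t = 0}"
    proof (rule ccontr)
      assume "x \<notin> {t. poly p t = 0}"
      then have "emeasure \<sigma> {t. poly p t \<noteq> 0} > 0" using x op by (auto simp: measure_support_def)
      moreover have "emeasure \<sigma> {t. poly p t \<noteq> 0} \<le> emeasure \<sigma> N"
        by (rule emeasure_mono) (use N in auto)
      ultimately show False using N(1) by auto
    qed
  qed
  then show False using infinite_support poly_roots_finite[OF assms(1)] finite_subset by blast
qed

lemma I_sq_pos: "p \<noteq> 0 \<Longrightarrow> I (p * p) > 0"
  by (rule I_pos) auto

text \<open>The Stieltjes procedure: each step reads its two coefficients off the polynomials
  already built. The recurrence holds by definition, and orthogonality has to be proved, in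
  \<open>P_ortho\<close>.\<close>

fun P :: "nat \<Rightarrow> real poly" where
  "P 0 = 1"
| "P (Suc 0) = [:- (I [:0, 1:] / I 1), 1:]"
| "P (Suc (Suc n)) = pCons 0 (P (Suc n)) -
     Polynomial.smult (I (pCons 0 (P (Suc n) * P (Suc n))) / I (P (Suc n) * P (Suc n))) (P (Suc n)) -
     Polynomial.smult (I (P (Suc n) * P (Suc n)) / I (P n * P n)) (P n)"

definition h where "h n = I (P n * P n)"
definition b where "b n = I (pCons 0 (P n * P n)) / h n"
definition c where "c n = h (Suc n) / h n"

declare P.simps(2,3) [simp del]

lemma P_1: "P (Suc 0) = pCons 0 (P 0) - Polynomial.smult (b 0) (P 0)"
  by (simp add: P.simps b_def h_def one_pCons)

lemma P_rec: "P (Suc (Suc n)) =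
    pCons 0 (P (Suc n)) - Polynomial.smult (b (Suc n)) (P (Suc n)) - Polynomial.smult (c n) (P n)"
  by (simp add: P.simps b_def c_def h_def)

lemma P_coeffs: "coeff (P n) n = 1 \<and> (\<forall>i>n. coeff (P n) i = 0)"
proof (induction n rule: P.induct)
  case 2
  show ?case by (auto simp: P.simps coeff_pCons split: nat.split)
next
  case (3 n)
  then show ?case by (auto simp: P_rec coeff_pCons split: nat.split)
qed auto

lemma degree_P [simp]: "degree (P n) = n"
  using P_coeffs[of n] by (metis degree_le le_degree order_antisym zero_neq_one)

lemma P_nonzero [simp]: "P n \<noteq> 0"
  using P_coeffs[of n] by auto

lemma lead_P: "lead_coeff (P n) = 1"
  using P_coeffs[of n] by simp

lemma h_pos: "h n > 0"
  unfolding h_def by (rule I_sq_pos) simp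

lemma coeff_pCons_0_P: "\<forall>i\<ge>Suc n. coeff (pCons 0 (P n) - P (Suc n)) i = 0"
proof (intro allI impI)
  fix i assume "i \<ge> Suc n"
  then show "coeff (pCons 0 (P n) - P (Suc n)) i = 0"
    using P_coeffs[of n] P_coeffs[of "Suc n"] by (cases i; cases "i = Suc n") auto
qed

text \<open>The condition on coefficients means degree below \<open>n\<close>, and for
  \<open>n = 0\<close> it forces \<open>q = 0\<close>. In the inductive step \<open>q\<close> is a
  combination of \<open>P m\<close> and \<open>P k\<close>, the two predecessors of
  \<open>P n\<close>, and a rest \<open>r'\<close> of lower degree. The choice of \<open>b\<close>
  and \<open>c\<close> makes the first two pairings vanish; for the rest, the factor
  \<open>x\<close> is moved from \<open>P m\<close> to \<open>r'\<close>.\<close>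

lemma P_ortho: "(\<forall>i\<ge>n. coeff q i = 0) \<Longrightarrow> I (P n * q) = 0"
proof (induction n arbitrary: q rule: less_induct)
  case (less n)
  show ?case
  proof (cases n)
    case 0
    then have "q = 0" using less.prems by (simp add: poly_eq_iff)
    then show ?thesis by (simp add: I_0)
  next
    case (Suc m)
    note n = Suc
    define a where "a = coeff q m"
    define r where "r = q - Polynomial.smult a (P m)"
    have r: "\<forall>i\<ge>m. coeff r i = 0"
      proof (intro allI impI)
        fix i assume "i \<ge> m"
        then show "coeff r i = 0"
          using less.prems P_coeffs[of m] n by (cases "i = m") (auto simp: r_def a_def)
      qed
    have q: "q = Polynomial.smult a (P m) + r" by (simp add: r_def)
    have Pr: "I (P m * r) = 0" using less.IH[of m r] n r by simp
    have PP: "I (P n * P m) = 0 \<and> I (P n * r) = 0"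
    proof (cases m)
      case 0
      then have "r = 0" using r by (simp add: poly_eq_iff)
      moreover have "h 0 = I 1" by (simp add: h_def)
      moreover have "P n * P m = pCons 0 1 - Polynomial.smult (b 0) 1"
        unfolding n 0 P_1 P.simps(1) mult_1_right ..
      moreover have "b 0 = I (pCons 0 1) / I 1" by (simp only: b_def h_def P.simps mult_1_right)
      ultimately show ?thesis using h_pos[of 0]
        by (simp only: I_diff I_smult mult_zero_right I_0) simp
    next
      case (Suc k)
      have X: "pCons 0 (P m) * p = pCons 0 (P m * p)" for p by simp
      have o1: "I (P m * P k) = 0" using less.IH[of m "P k"] n Suc P_coeffs[of k] by auto
      have o1': "I (P k * P m) = 0" using o1 by (simp add: mult.commute)
      have 1: "I (P n * P m) = 0"
        using h_pos[of m] unfolding n Suc P_rec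
        by (simp add: left_diff_distrib I_diff I_smult o1'[unfolded Suc] o1[unfolded Suc])
           (simp add: b_def h_def)
      define e where "e = coeff r k"
      define r' where "r' = r - Polynomial.smult e (P k)"
      have r': "\<forall>i\<ge>k. coeff r' i = 0"
        proof (intro allI impI)
        fix i assume "i \<ge> k"
        then show "coeff r' i = 0"
          using r P_coeffs[of k] Suc by (cases "i = k") (auto simp: r'_def e_def)
      qed
      have o2: "I (P m * pCons 0 r') = 0"
        using less.IH[of m "pCons 0 r'"] n Suc r' by (auto simp: coeff_pCons split: nat.split)
      have o3: "I (P m * r') = 0" using less.IH[of m r'] n Suc r' by auto
      have o4: "I (P k * r') = 0" using less.IH[of k r'] n Suc r' by auto
      \<comment> \<open>\<open>x P k\<close> and \<open>P m\<close> have the same leading term, so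
        pairing with \<open>P m\<close> does not distinguish them. The resulting value
        \<open>h m\<close> cancels \<open>c k * h k\<close>.\<close>
      have "I (P m * (pCons 0 (P k) - P m)) = 0"
        using less.IH[of m "pCons 0 (P k) - P m"] n Suc coeff_pCons_0_P[of k] by auto
      then have o5: "I (P m * pCons 0 (P k)) = h m" by (simp add: h_def right_diff_distrib I_diff)
      have 2: "I (P n * r') = 0"
        using o2 o3 o4 unfolding n Suc P_rec by (simp add: left_diff_distrib I_diff I_smult)
      have 3: "I (P n * P k) = 0"
        using o5 o1 h_pos[of k] unfolding n Suc P_rec
        by (simp add: left_diff_distrib I_diff I_smult c_def h_def)
      have "r = Polynomial.smult e (P k) + r'" by (simp add: r'_def)
      then show ?thesis using 1 2 3 by (simp add: distrib_left I_add I_smult)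
    qed
    then show ?thesis unfolding q by (simp add: distrib_left I_add I_smult)
  qed
qed

lemma P_ortho_degree: "degree q < n \<Longrightarrow> I (P n * q) = 0"
  by (rule P_ortho) (auto intro: coeff_eq_0)

lemma I_mult: "I (p * q) = (LINT t|\<sigma>. poly p t * poly q t)"
  by (simp add: I_def)

text \<open>The difference of two candidates has degree below \<open>n\<close>, so both are
  orthogonal to it, and it is orthogonal to itself.\<close>

lemma monic_op_eq [simp]: "monic_op \<sigma> n = P n"
  unfolding monic_op_def
proof (rule the_equality)
  show "lead_coeff (P n) = 1 \<and> degree (P n) = n \<and>
    (\<forall>q. degree q < n \<longrightarrow> (LINT t|\<sigma>. poly (P n) t * poly q t) = 0)"
    using lead_P P_ortho_degree by (auto simp flip: I_mult)
next
  fix p assume p: "lead_coeff p = 1 \<and> degree p = n \<and>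
    (\<forall>q. degree q < n \<longrightarrow> (LINT t|\<sigma>. poly p t * poly q t) = 0)"
  show "p = P n"
  proof (rule ccontr)
    assume ne: "p \<noteq> P n"
    define d where "d = p - P n"
    have dz: "\<forall>i\<ge>n. coeff d i = 0"
    proof (intro allI impI)
      fix i assume "i \<ge> n"
      then show "coeff d i = 0"
        using p P_coeffs[of n] by (cases "i = n") (auto simp: d_def coeff_eq_0)
    qed
    have "d \<noteq> 0" using ne by (simp add: d_def)
    then have "degree d < n" using dz by (metis leading_coeff_0_iff not_le)
    then have "I (p * d) = 0" "I (P n * d) = 0" using p P_ortho_degree by (auto simp flip: I_mult)
    then have "I (d * d) = 0" by (simp add: d_def left_diff_distrib I_diff)
    then show False using I_sq_pos[OF \<open>d \<noteq> 0\<close>] by simp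
  qed
qed

lemma three_term_rec: "three_term \<sigma> j (b j) (c (j - 1))"
  by (cases j) (auto simp: three_term_def P_1 P_rec)

lemma I_P_P: "i \<noteq> j \<Longrightarrow> I (P i * P j) = 0"
  using P_ortho_degree[of "P i" j] P_ortho_degree[of "P j" i]
  by (cases "i < j") (auto simp: mult.commute)

lemma three_term_unique:
  assumes "three_term \<sigma> j b' c'"
  shows "b' = b j" "j > 0 \<Longrightarrow> c' = c (j - 1)"
proof -
  have eq: "Polynomial.smult (b' - b j) (P j) + (if j = 0 then 0 else Polynomial.smult (c' - c (j - 1)) (P (j - 1))) = 0"
    using assms three_term_rec[of j] by (auto simp: three_term_def Polynomial.smult_diff_left split: if_splits)
  have "I (P j * (Polynomial.smult (b' - b j) (P j) + (if j = 0 then 0 else Polynomial.smult (c' - c (j - 1)) (P (j - 1))))) = (b' - b j) * h j"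
    by (auto simp: distrib_left I_add I_smult I_P_P h_def I_0)
  then show 1: "b' = b j" using h_pos[of j] by (simp add: eq I_0)
  assume "j > 0"
  then show "c' = c (j - 1)" using eq 1 by simp
qed

lemma jacobi_b_eq [simp]: "jacobi_b \<sigma> j = b j"
  unfolding jacobi_b_def by (rule the_equality) (use three_term_rec three_term_unique in blast)+

lemma jacobi_c_eq [simp]: "jacobi_c \<sigma> j = c j"
  unfolding jacobi_c_def
proof (rule the_equality)
  have "three_term \<sigma> (Suc j) (b (Suc j)) (c j)" using three_term_rec[of "Suc j"] by simp
  then show "\<exists>b. three_term \<sigma> (Suc j) b (c j)" by blast
next
  fix c' assume "\<exists>b. three_term \<sigma> (Suc j) b c'"
  then obtain b' where "three_term \<sigma> (Suc j) b' c'" by blast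
  from three_term_unique(2)[OF this] show "c' = c j" by simp
qed

lemma c_pos: "c n > 0" by (simp add: c_def h_pos)

lemma h_Suc_eq: "I (pCons 0 (P n) * P (Suc n)) = h (Suc n)"
proof -
  have "I (P (Suc n) * (pCons 0 (P n) - P (Suc n))) = 0"
    by (rule P_ortho) (rule coeff_pCons_0_P)
  then have "I (P (Suc n) * pCons 0 (P n)) = h (Suc n)"
    by (simp only: right_diff_distrib I_diff h_def)
  then show ?thesis by (simp only: mult.commute)
qed

text \<open>By \<open>h_Suc_eq\<close> the squared norm of \<open>x P n - P (Suc n)\<close> is that
  of \<open>x P n\<close> minus \<open>h (Suc n)\<close>, and multiplication by \<open>t\<close>
  does not increase norms on \<open>E\<close>.\<close>

lemma c_le_1: "c n \<le> 1"
proof -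
  let ?d = "pCons 0 (P n) - P (Suc n)"
  have "0 \<le> I (?d * ?d)" by (rule I_nonneg) simp
  also have "?d * ?d = pCons 0 (P n) * pCons 0 (P n) - Polynomial.smult 2 (pCons 0 (P n) * P (Suc n)) + P (Suc n) * P (Suc n)"
    by (rule poly_ext) (simp add: algebra_simps)
  also have "I \<dots> = I (pCons 0 (P n) * pCons 0 (P n)) - h (Suc n)"
    by (simp only: I_add I_diff I_smult h_Suc_eq h_def)
  also have "I (pCons 0 (P n) * pCons 0 (P n)) \<le> h n"
    unfolding h_def
  proof (rule I_mono)
    fix t assume "t \<in> E"
    then have "t * t \<le> 1" using E_bounded[of t] by (metis abs_le_square_iff abs_one one_power2 power2_eq_square)
    then have "(t * t) * (poly (P n) t * poly (P n) t) \<le> 1 * (poly (P n) t * poly (P n) t)"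
      by (rule mult_right_mono) simp
    then show "poly (pCons 0 (P n) * pCons 0 (P n)) t \<le> poly (P n * P n) t" by (simp add: mult_ac)
  qed
  finally show ?thesis using h_pos[of n] by (simp add: c_def)
qed

text \<open>\<open>b n\<close> is the mean of \<open>t\<close> for the probability density
  \<open>P n ^ 2 / h n\<close>, and \<open>|t| <= 1\<close> on \<open>E\<close>.\<close>

lemma b_bound: "\<bar>b n\<bar> \<le> 1"
proof -
  have *: "\<bar>t * (p * p)\<bar> \<le> p * p" if "t \<in> E" for t p :: real
    using E_bounded[OF that] mult_right_mono[of "\<bar>t\<bar>" 1 "p * p"] by (simp add: abs_mult)
  have "I (pCons 0 (P n * P n)) \<le> h n" unfolding h_def
    by (rule I_mono) (use * in \<open>auto simp: abs_le_iff\<close>)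
  moreover have "- I (pCons 0 (P n * P n)) \<le> h n" unfolding h_def I_minus[symmetric]
    by (rule I_mono) (use * in \<open>fastforce simp: abs_le_iff\<close>)
  ultimately show ?thesis using h_pos[of n] by (auto simp: b_def abs_le_iff field_simps)
qed

section \<open>Values at zero and Hankel determinants\<close>

definition p0 where "p0 n = poly (P n) 0"

lemma p0_rec: "p0 0 = 1" "p0 (Suc 0) = - b 0" "p0 (Suc (Suc n)) = - b (Suc n) * p0 (Suc n) - c n * p0 n"
  by (simp_all add: p0_def P_1 P_rec)

text \<open>Two consecutive zeros would propagate down the recurrence, as \<open>c n > 0\<close>, to
  \<open>p0 0 = 1\<close>.\<close>

lemma p0_Suc_nonzero: "p0 n = 0 \<Longrightarrow> p0 (Suc n) \<noteq> 0"
proof (induction n)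
  case 0
  then show ?case by (simp add: p0_rec)
next
  case (Suc n)
  then show ?case using c_pos[of n] by (auto simp: p0_rec(3))
qed

definition s where "s k = (LINT t|\<sigma>. t ^ (k + 1))"

lemma s_eq: "s k = I (monom 1 (Suc k))"
  by (simp add: s_def I_def poly_monom)

text \<open>A vector is read as the polynomial with these coefficients; the Hankel matrix of the
  shifted moments is then the matrix of the bilinear form \<open>I (x p q)\<close>.\<close>

lemma sum_s_eq:
  "(\<Sum>k<n. s (i + k) * v k) = I (pCons 0 (\<Sum>k<n. monom (v k) k) * monom 1 i)"
proof -
  have 1: "s (i + k) * v k = I (pCons 0 (monom (v k) k) * monom 1 i)" for k
  proof -
    have "poly (pCons 0 (monom (v k) k) * monom 1 i) = (\<lambda>t. t ^ (i + k + 1) * v k)"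
      by (simp add: poly_monom power_add fun_eq_iff)
    then show ?thesis unfolding s_def I_def by (simp only: Bochner_Integration.integral_mult_left_zero)
  qed
  have 2: "pCons 0 (\<Sum>k<n. monom (v k) k) = (\<Sum>k<n. pCons 0 (monom (v k) k))"
  proof (induction n)
    case (Suc n)
    have "pCons 0 (p + q) = pCons 0 p + pCons 0 q" for p q :: "real poly" by simp
    then show ?case using Suc by (simp only: sum.lessThan_Suc)
  qed simp
  have "(\<Sum>k<n. s (i + k) * v k) = (\<Sum>k<n. I (pCons 0 (monom (v k) k) * monom 1 i))"
    by (rule sum.cong[OF refl]) (rule 1)
  also have "\<dots> = I (\<Sum>k<n. pCons 0 (monom (v k) k) * monom 1 i)"
    by (simp only: I_sum)
  also have "\<dots> = I (pCons 0 (\<Sum>k<n. monom (v k) k) * monom 1 i)"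
    unfolding 2 by (simp only: sum_distrib_right)
  finally show ?thesis .
qed

text \<open>A kernel vector is a polynomial \<open>q\<close> such that \<open>x q\<close>, of degree
  at most \<open>n\<close>, is orthogonal to all degrees below \<open>n\<close>. So
  \<open>x q\<close> is a multiple of \<open>P n\<close>, which then vanishes at \<open>0\<close>;
  the converse reads this backwards.\<close>

lemma hankel_zero_iff: "hankel_det s n = 0 \<longleftrightarrow> p0 n = 0"
proof -
  let ?A = "Matrix.mat n n (\<lambda>(i, k). s (i + k))"
  have A: "?A \<in> carrier_mat n n" by simp
  have mv: "vec_index (?A *\<^sub>v v) i = I (pCons 0 (\<Sum>k<n. monom (vec_index v k) k) * monom 1 i)"
    if "v \<in> carrier_vec n" "i < n" for v i
    using that unfolding sum_s_eq[symmetric] by (simp add: scalar_prod_def atLeast0LessThan)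
  show ?thesis unfolding hankel_det_def det_0_iff_vec_prod_zero[OF A]
  proof
    assume "\<exists>v. v \<in> carrier_vec n \<and> v \<noteq> 0\<^sub>v n \<and> ?A *\<^sub>v v = 0\<^sub>v n"
    then obtain v where v: "v \<in> carrier_vec n" "v \<noteq> 0\<^sub>v n" "?A *\<^sub>v v = 0\<^sub>v n" by blast
    define q where "q = (\<Sum>k<n. monom (vec_index v k) k)"
    have t_kernel: "coeff q k = (if k < n then vec_index v k else 0)" for k
      by (simp add: q_def coeff_sum sum.delta')
    have "q \<noteq> 0"
    proof
      assume "q = 0"
      then have "vec_index v k = 0" if "k < n" for k using t_kernel[of k] that by simp
      then have "v = 0\<^sub>v n" using v(1) by (intro eq_vecI) auto
      then show False using v(2) by simp
    qed
    have zero: "I (pCons 0 q * monom 1 i) = 0" if "i < n" for i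
      using mv[OF v(1) that] v(3) that by (simp add: q_def)
    have orth: "I (pCons 0 q * r) = 0" if "\<forall>i\<ge>n. coeff r i = 0" for r
    proof -
      have "r = (\<Sum>i<n. Polynomial.smult (coeff r i) (monom 1 i))"
        by (rule poly_eqI) (use that in \<open>auto simp: coeff_sum not_less if_distrib[of "(*) _"] cong: if_cong\<close>)
      then have "pCons 0 q * r = (\<Sum>i<n. Polynomial.smult (coeff r i) (pCons 0 q * monom 1 i))"
        by (metis (no_types, lifting) mult_smult_right sum.cong sum_distrib_left)
      then have "I (pCons 0 q * r) = (\<Sum>i<n. coeff r i * I (pCons 0 q * monom 1 i))"
        by (simp only: I_sum I_smult)
      also have "\<dots> = 0" by (intro sum.neutral ballI) (simp only: lessThan_iff zero mult_zero_right)
      finally show ?thesis .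
    qed
    define a where "a = coeff (pCons 0 q) n"
    define d where "d = pCons 0 q - Polynomial.smult a (P n)"
    have dz: "\<forall>i\<ge>n. coeff d i = 0"
    proof (intro allI impI)
      fix i assume "i \<ge> n"
      then show "coeff d i = 0"
        using P_coeffs[of n] t_kernel by (cases "i = n") (auto simp: d_def a_def coeff_pCons split: nat.split)
    qed
    have "I (d * d) = I (pCons 0 q * d) - a * I (P n * d)" unfolding d_def
      by (simp only: left_diff_distrib I_diff mult_smult_left I_smult)
    also have "\<dots> = 0" using orth[OF dz] P_ortho[OF dz] by simp
    finally have "d = 0" using I_sq_pos[of d] by fastforce
    then have e: "pCons 0 q = Polynomial.smult a (P n)" by (simp add: d_def)
    have "a \<noteq> 0" using e \<open>q \<noteq> 0\<close> by auto
    moreover have "a * p0 n = 0" using arg_cong[OF e, of "\<lambda>p. poly p 0"] by (simp add: p0_def)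
    ultimately show "p0 n = 0" by simp
  next
    assume 0: "p0 n = 0"
    then obtain q where "P n = [:- 0, 1:] * q" unfolding p0_def poly_eq_0_iff_dvd by (elim dvdE)
    then have q: "P n = pCons 0 q" by simp
    define v where "v = Matrix.vec n (\<lambda>k. coeff q k)"
    have t_kernel: "coeff q k = (if k < n then vec_index v k else 0)" for k
    proof (cases "k < n")
      case False
      then have "coeff (P n) (Suc k) = 0" using P_coeffs[of n] by simp
      then show ?thesis using False by (simp add: q)
    qed (simp add: v_def)
    have vc: "v \<in> carrier_vec n" by (simp add: v_def)
    have qs: "(\<Sum>k<n. monom (vec_index v k) k) = q"
      by (rule poly_eqI) (use t_kernel in \<open>simp add: coeff_sum sum.delta'\<close>)
    have "v \<noteq> 0\<^sub>v n"
    proof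
      assume "v = 0\<^sub>v n"
      then have "q = 0" using t_kernel by (intro poly_eqI) auto
      then show False using q P_nonzero[of n] by simp
    qed
    moreover have "?A *\<^sub>v v = 0\<^sub>v n"
    proof (rule eq_vecI)
      fix i assume "i < dim_vec (0\<^sub>v n)"
      then have i: "i < n" by simp
      have "vec_index (?A *\<^sub>v v) i = I (P n * monom 1 i)" using mv[OF vc i] qs q by simp
      also have "\<dots> = 0" by (rule P_ortho_degree) (use i in \<open>simp add: degree_monom_eq\<close>)
      finally show "vec_index (?A *\<^sub>v v) i = vec_index (0\<^sub>v n) i" using i by simp
    qed simp
    ultimately show "\<exists>v. v \<in> carrier_vec n \<and> v \<noteq> 0\<^sub>v n \<and> ?A *\<^sub>v v = 0\<^sub>v n" using vc by blast
  qed
qed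

section \<open>Normal indices and their gaps\<close>

definition N where "N = normal_index s"

lemma N_0 [simp]: "N 0 = 0" by (simp add: N_def normal_index_def)

lemma infinite_normal: "infinite {n. n \<ge> 1 \<and> hankel_det s n \<noteq> 0}"
  unfolding infinite_nat_iff_unbounded
proof
  fix m
  show "\<exists>n>m. n \<in> {n. n \<ge> 1 \<and> hankel_det s n \<noteq> 0}"
  proof (cases "p0 (Suc m) = 0")
    case True
    then have "p0 (Suc (Suc m)) \<noteq> 0" by (rule p0_Suc_nonzero)
    then show ?thesis by (intro exI[of _ "Suc (Suc m)"]) (simp add: hankel_zero_iff)
  next
    case False
    then show ?thesis by (intro exI[of _ "Suc m"]) (simp add: hankel_zero_iff)
  qed
qed

text \<open>The convention \<open>N 0 = 0\<close> makes one formula serve every \<open>j\<close>: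
  the enumerated set starts at \<open>1\<close>, which excludes exactly the index
  \<open>0\<close>.\<close>

lemma N_Suc_Least: "N (Suc j) = (LEAST n. N j < n \<and> p0 n \<noteq> 0)"
proof (cases j)
  case 0
  then show ?thesis
    by (simp add: N_def normal_index_def enumerate_0 hankel_zero_iff Suc_le_eq)
next
  case (Suc i)
  have "N (Suc j) = (LEAST n. n \<in> {n. n \<ge> 1 \<and> hankel_det s n \<noteq> 0} \<and> N j < n)"
    unfolding N_def normal_index_def Suc
    using enumerate_Suc''[OF infinite_normal, of i] by simp
  also have "\<dots> = (LEAST n. N j < n \<and> p0 n \<noteq> 0)"
    by (rule arg_cong[where f = Least]) (auto simp: hankel_zero_iff fun_eq_iff)
  finally show ?thesis .
qed

lemma N_Suc: "N (Suc j) = (if p0 (Suc (N j)) = 0 then Suc (Suc (N j)) else Suc (N j))"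
proof -
  have "N (Suc j) = Suc (N j)" if "p0 (Suc (N j)) \<noteq> 0"
    unfolding N_Suc_Least by (rule Least_equality) (use that in auto)
  moreover have "N (Suc j) = Suc (Suc (N j))" if "p0 (Suc (N j)) = 0"
    unfolding N_Suc_Least
  proof (rule Least_equality)
    fix n assume "N j < n \<and> p0 n \<noteq> 0"
    then have "N j < n" "n \<noteq> Suc (N j)" using that by auto
    then show "Suc (Suc (N j)) \<le> n" by simp
  qed (use p0_Suc_nonzero[OF that] in simp)
  ultimately show ?thesis by simp
qed

lemma p0_N: "p0 (N j) \<noteq> 0"
proof (cases j)
  case 0
  then show ?thesis by (simp add: p0_rec)
next
  case (Suc i)
  then show ?thesis using p0_Suc_nonzero[of "Suc (N i)"] by (simp add: N_Suc)
qed

end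


section \<open>Quasi-orthogonal polynomials and quadrature\<close>

lemma prod_linear_dvd:
  fixes p :: "'a::idom poly"
  assumes "finite A" "\<And>x. x \<in> A \<Longrightarrow> poly p x = 0"
  shows "(\<Prod>x\<in>A. [:- x, 1:]) dvd p"
  using assms
proof (induction A rule: finite_induct)
  case (insert a A)
  then obtain q where q: "p = (\<Prod>x\<in>A. [:- x, 1:]) * q" by (auto elim: dvdE)
  have "poly (\<Prod>x\<in>A. [:- x, 1:]) a \<noteq> 0" using insert.hyps by (auto simp: poly_prod)
  then have "poly q a = 0" using insert.prems[of a] q by simp
  then obtain q' where "q = [:- a, 1:] * q'" by (auto simp: poly_eq_0_iff_dvd)
  then show ?case using q insert.hyps by (simp add: mult_ac del: mult_pCons_left mult_pCons_right)
qed simp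

lemma map_poly_of_real_add:
  "map_poly of_real (p + q) = map_poly of_real p + (map_poly of_real q :: complex poly)"
  by (rule poly_eqI) (simp add: coeff_map_poly)

lemma map_poly_of_real_mult:
  "map_poly of_real (p * q) = map_poly of_real p * (map_poly of_real q :: complex poly)"
  by (rule poly_eqI) (simp add: coeff_map_poly coeff_mult)

lemma poly_map_poly_of_real: "poly (map_poly of_real p) (of_real x) = (of_real (poly p x) :: complex)"
  by (induction p) (simp_all add: map_poly_pCons)

text \<open>The quadratic is the product of the linear factors of \<open>z\<close> and its
  conjugate. The remainder of the division is real, of degree at most 1, and vanishes at a nonreal
  point, so it is zero.\<close>

lemma real_poly_nonreal_root:
  fixes p :: "real poly"
  assumes "poly (map_poly of_real p) z = 0" "Im z \<noteq> 0"
  shows "[:(cmod z)\<^sup>2, - 2 * Re z, 1:] dvd p"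
proof -
  define d where "d = [:(cmod z)\<^sup>2, - 2 * Re z, 1:]"
  define r where "r = p mod d"
  have "poly (map_poly complex_of_real d) z = 0"
    unfolding d_def cmod_power2
    by (simp add: map_poly_pCons complex_eq_iff power2_eq_square algebra_simps)
  then have rz: "poly (map_poly complex_of_real r) z = 0"
    using assms(1) map_poly_of_real_add[of "p div d * d" r]
    by (simp add: r_def map_poly_of_real_mult)
  have "degree r < 2" unfolding r_def
    using degree_mod_less[of d p] by (auto simp: d_def)
  then obtain u v where r: "r = [:u, v:]"
  proof (cases r rule: pCons_cases)
    case (pCons u r1)
    moreover have "degree r1 = 0"
      using \<open>degree r < 2\<close> pCons by (cases "r1 = 0") auto
    ultimately show ?thesis using that by (auto elim: degree_eq_zeroE)
  qed
  have "v = 0" using rz assms(2) by (auto simp: r map_poly_pCons complex_eq_iff)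
  then have "r = 0" using rz by (auto simp: r map_poly_pCons complex_eq_iff)
  then show ?thesis by (simp add: r_def d_def mod_eq_0_iff_dvd)
qed

context two_interval_measure begin

definition \<tau> where "\<tau> n = p0 (Suc n) / p0 n"
text \<open>Vanishes at \<open>0\<close> whenever \<open>p0 n\<close> does not. For
  \<open>p0 n = 0\<close>, division by zero gives \<open>\<tau> n = 0\<close>, and
  \<open>Q n = P (Suc n)\<close> is still orthogonal to all degrees below \<open>n\<close>; so the
  count of zeros and the quadrature hold for every \<open>n\<close>.\<close>

definition Q where "Q n = P (Suc n) - Polynomial.smult (\<tau> n) (P n)"
definition S where "S n = {x. poly (Q n) x = 0}"

lemma Q_coeff: "coeff (Q n) (Suc n) = 1"
  using P_coeffs[of n] P_coeffs[of "Suc n"] by (simp add: Q_def)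

lemma degree_Q [simp]: "degree (Q n) = Suc n"
proof (rule order_antisym)
  show "degree (Q n) \<le> Suc n"
    by (rule degree_le) (use P_coeffs[of n] P_coeffs[of "Suc n"] in \<open>auto simp: Q_def\<close>)
  show "Suc n \<le> degree (Q n)" by (rule le_degree) (simp add: Q_coeff)
qed

lemma Q_nonzero [simp]: "Q n \<noteq> 0" using degree_Q[of n] by (metis degree_0 nat.distinct(1))

lemma I_Q_ortho: "\<forall>i\<ge>n. coeff q i = 0 \<Longrightarrow> I (Q n * q) = 0"
  using P_ortho[of n q] P_ortho[of "Suc n" q] by (simp add: Q_def left_diff_distrib I_diff I_smult)

text \<open>Serves for double zeros, conjugate pairs and zeros in the gap alike. The cofactor
  \<open>q\<close> has degree \<open>n - 1\<close>, hence is orthogonal to \<open>Q n\<close>,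
  whereas \<open>Q n * q = d * q ^ 2\<close> would have a positive integral.\<close>

lemma Q_no_nonneg_quadratic:
  assumes "d dvd Q n" "degree d = 2" "\<And>t. t \<in> E \<Longrightarrow> poly d t \<ge> 0"
  shows False
proof -
  obtain q where q: "Q n = d * q" using assms(1) by (auto elim: dvdE)
  then have nz: "d \<noteq> 0" "q \<noteq> 0" using Q_nonzero[of n] by auto
  have "Suc n = 2 + degree q" using degree_mult_eq[OF nz] q assms(2) degree_Q[of n] by simp
  then have "I (Q n * q) = 0" by (intro I_Q_ortho) (auto intro: coeff_eq_0)
  moreover have "I (d * (q * q)) > 0" by (rule I_pos) (use nz assms(3) in auto)
  ultimately show False using q by (simp add: mult.assoc)
qed

lemma finite_S: "finite (S n)" unfolding S_def by (rule poly_roots_finite) simp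

text \<open>Split off the linear factors of the distinct real zeros. If the complementary factor had
  a root, \<open>Q n\<close> would contain a squared linear factor or a real quadratic with two
  conjugate roots, both nonnegative on the whole line.\<close>

lemma card_S: "card (S n) = Suc n"
proof (rule ccontr)
  assume ne: "card (S n) \<noteq> Suc n"
  define r where "r = (\<Prod>x\<in>S n. [:- x, 1:])"
  have degr: "degree r = card (S n)"
    unfolding r_def by (subst degree_prod_eq_sum_degree) auto
  have "r dvd Q n" unfolding r_def by (rule prod_linear_dvd) (auto simp: finite_S, simp add: S_def)
  then obtain r' where r': "Q n = r * r'" by (auto elim: dvdE)
  then have nz: "r \<noteq> 0" "r' \<noteq> 0" using Q_nonzero[of n] by auto
  have deg: "Suc n = card (S n) + degree r'"
    using degree_mult_eq[OF nz] r' degr degree_Q[of n] by simp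
  let ?c = "map_poly complex_of_real r'"
  have "degree ?c = degree r'" by (rule degree_map_poly) simp
  then have "degree ?c > 0" using deg ne by linarith
  from alg_closed_imp_poly_has_root[OF this] obtain z where z: "poly ?c z = 0" by blast
  show False
  proof (cases "Im z = 0")
    case True
    then have zr: "z = of_real (Re z)" by (simp add: complex_eq_iff)
    have "poly r' (Re z) = 0" using z by (subst (asm) zr) (simp add: poly_map_poly_of_real)
    then have d1: "[:- Re z, 1:] dvd r'" by (simp only: poly_eq_0_iff_dvd)
    have "Re z \<in> S n" using \<open>poly r' (Re z) = 0\<close> by (simp add: S_def r')
    then have "[:- Re z, 1:] dvd r" unfolding r_def by (rule dvd_prodI[OF finite_S])
    then have "[:- Re z, 1:] * [:- Re z, 1:] dvd Q n" unfolding r' using d1 by (rule mult_dvd_mono)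
    then show False 
    proof (rule Q_no_nonneg_quadratic)
      fix t
      have "0 \<le> (t - Re z) * (t - Re z)" by simp
      then show "0 \<le> poly ([:- Re z, 1:] * [:- Re z, 1:]) t" by (simp add: algebra_simps)
    qed simp
  next
    case False
    have "[:(cmod z)\<^sup>2, - 2 * Re z, 1:] dvd Q n"
      unfolding r' by (rule dvd_mult[OF real_poly_nonreal_root[OF z False]])
    then show False
    proof (rule Q_no_nonneg_quadratic)
      fix t
      have "0 \<le> (t - Re z)\<^sup>2 + (Im z)\<^sup>2" by simp
      then show "0 \<le> poly [:(cmod z)\<^sup>2, - 2 * Re z, 1:] t"
        unfolding cmod_power2 by (simp add: power2_eq_square algebra_simps)
    qed simp
  qed
qed

lemma zero_in_S: "p0 n \<noteq> 0 \<Longrightarrow> 0 \<in> S n"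
  by (simp add: S_def Q_def \<tau>_def flip: p0_def)

text \<open>\<open>0\<close> is a zero as well, and \<open>E\<close> has no point strictly between
  \<open>0\<close> and a point \<open>x\<close> of the gap, so \<open>t * (t - x)\<close> is
  nonnegative on \<open>E\<close>.\<close>

lemma S_gap:
  assumes "p0 n \<noteq> 0" "x \<in> S n" "x \<noteq> 0"
  shows "x \<le> \<alpha> \<or> \<beta> \<le> x"
proof (rule ccontr)
  assume "\<not> (x \<le> \<alpha> \<or> \<beta> \<le> x)"
  then have x: "\<alpha> < x" "x < \<beta>" by auto
  have "(\<Prod>y\<in>{0, x}. [:- y, 1:]) dvd Q n"
    by (rule prod_linear_dvd) (use assms zero_in_S in \<open>auto simp: S_def\<close>)
  then have "[:0, 1:] * [:- x, 1:] dvd Q n" using assms(3) by simp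
  then show False
  proof (rule Q_no_nonneg_quadratic)
    fix t assume "t \<in> E"
    then have "(t \<le> 0 \<and> t \<le> x) \<or> (t \<ge> 0 \<and> t \<ge> x)" using x bounds by (auto simp: E_def)
    then have "0 \<le> t * (t - x)" by (auto simp: zero_le_mult_iff)
    then show "0 \<le> poly ([:0, 1:] * [:- x, 1:]) t" by (simp add: algebra_simps)
  qed simp
qed

section \<open>Quadrature at the zeros\<close>

definition lagrange where "lagrange n x = Polynomial.smult (1 / (\<Prod>y\<in>S n - {x}. (x - y))) (\<Prod>y\<in>S n - {x}. [:- y, 1:])"
definition W where "W n x = I (lagrange n x)"

lemma poly_lagrange: "x \<in> S n \<Longrightarrow> y \<in> S n \<Longrightarrow> poly (lagrange n x) y = (if x = y then 1 else 0)"
  using finite_S[of n] by (auto simp: lagrange_def poly_prod)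

lemma degree_lagrange: "x \<in> S n \<Longrightarrow> degree (lagrange n x) \<le> n"
proof -
  assume "x \<in> S n"
  then have "degree (\<Prod>y\<in>S n - {x}. [:- y, 1:]) = n"
    by (subst degree_prod_eq_sum_degree) (auto simp: card_S finite_S)
  then show ?thesis unfolding lagrange_def by (metis degree_smult_le)
qed

lemma quadrature_interpolation:
  assumes "degree p \<le> n"
  shows "I p = (\<Sum>x\<in>S n. W n x * poly p x)"
proof -
  have "p = (\<Sum>x\<in>S n. Polynomial.smult (poly p x) (lagrange n x))"
  proof (rule poly_eqI_degree[where A = "S n"])
    fix x assume "x \<in> S n"
    then show "poly p x = poly (\<Sum>x\<in>S n. Polynomial.smult (poly p x) (lagrange n x)) x"
      using finite_S by (simp add: poly_sum poly_lagrange if_distrib[of "(*) _"] cong: if_cong)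
  next
    show "card (S n) > degree (\<Sum>x\<in>S n. Polynomial.smult (poly p x) (lagrange n x))"
      unfolding card_S less_Suc_eq_le
      by (rule degree_sum_le[OF finite_S]) (use degree_lagrange degree_smult_le le_trans in blast)
  qed (use assms card_S in auto)
  from arg_cong[OF this, of I] show ?thesis by (simp add: I_sum I_smult W_def mult.commute)
qed

text \<open>As for Gauss quadrature, the quotient of the division by \<open>Q n\<close> is
  annihilated by orthogonality. With \<open>n + 1\<close> nodes Gauss reaches degree
  \<open>2 n + 1\<close>; one degree is lost because \<open>Q n\<close> is orthogonal only to
  degrees below \<open>n\<close>.\<close>

lemma quadrature:
  assumes "degree p \<le> 2 * n"
  shows "I p = (\<Sum>x\<in>S n. W n x * poly p x)"
proof -
  define a where "a = p div Q n"
  define r where "r = p mod Q n"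
  have p: "p = Q n * a + r" by (simp add: a_def r_def)
  have r: "degree r \<le> n"
    using degree_mod_less[of "Q n" p] by (auto simp: r_def)
  have "\<forall>i\<ge>n. coeff a i = 0"
  proof (cases "a = 0")
    case False
    have "degree (Q n * a) = Suc n + degree a" using False by (simp add: degree_mult_eq)
    moreover have "Q n * a = p - r" using p by simp
    then have "degree (Q n * a) \<le> 2 * n"
      using degree_diff_le[of p "2 * n" r] assms r by simp
    ultimately show ?thesis by (auto intro: coeff_eq_0)
  qed simp
  then have "I p = I r" using I_Q_ortho[of n a] by (simp add: p I_add)
  also have "\<dots> = (\<Sum>x\<in>S n. W n x * poly r x)" by (rule quadrature_interpolation[OF r])
  also have "\<dots> = (\<Sum>x\<in>S n. W n x * poly p x)" by (rule sum.cong) (auto simp: p S_def)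
  finally show ?thesis .
qed

text \<open>The square of a Lagrange polynomial still has degree at most \<open>2 n\<close>, so its
  positive integral equals a single weight.\<close>

lemma W_pos:
  assumes "x \<in> S n" shows "W n x > 0"
proof -
  have "lagrange n x \<noteq> 0" using poly_lagrange[OF assms assms] by auto
  then have "0 < I (lagrange n x * lagrange n x)" by (rule I_sq_pos)
  also have "\<dots> = (\<Sum>y\<in>S n. W n y * poly (lagrange n x * lagrange n x) y)"
    by (rule quadrature) (use degree_lagrange[OF assms] degree_mult_le[of "lagrange n x" "lagrange n x"] in linarith)
  also have "\<dots> = (\<Sum>y\<in>S n. if y = x then W n x else 0)"
    by (rule sum.cong) (use assms in \<open>auto simp: poly_lagrange\<close>)
  finally show ?thesis using assms finite_S by simp
qed

lemma poly_P_rec: "n > 0 \<Longrightarrow> x * poly (P n) x = poly (P (Suc n)) x + b n * poly (P n) x + c (n - 1) * poly (P (n - 1)) x"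
  "x * poly (P 0) x = poly (P (Suc 0)) x + b 0 * poly (P 0) x"
  by (cases n) (simp_all add: P_rec P_1 del: P.simps)

text \<open>\<open>x\<close> is an eigenvalue of the truncated Jacobi matrix whose last diagonal entry is
  shifted by \<open>\<tau> n\<close>; its absolute value is at most the largest row sum.\<close>

lemma S_bounded:
  assumes "x \<in> S n" shows "\<bar>x\<bar> \<le> 3 + \<bar>\<tau> n\<bar>"
proof -
  define v where "v i = \<bar>poly (P i) x\<bar>" for i
  obtain i where i: "i \<le> n" "\<And>k. k \<le> n \<Longrightarrow> v k \<le> v i"
  proof -
    obtain i where "i \<in> {..n}" "v i = Max (v ` {..n})" by (rule obtains_MAX[of "{..n}" v]) auto
    then show thesis using that[of i] by (auto simp: Max_ge)
  qed
  have "v 0 = 1" by (simp add: v_def)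
  then have vi: "v i > 0" using i(2)[of 0] by simp
  \<comment> \<open>In the row \<open>i = n\<close> the value of \<open>P (Suc n)\<close> is
    \<open>\<tau> n\<close> times that of \<open>P n\<close>, as \<open>Q n\<close> vanishes at
    \<open>x\<close>. The superdiagonal entry \<open>1\<close> and the bounds on \<open>b\<close>
    and \<open>c\<close> contribute the \<open>3\<close> in the row sum.\<close>
  have next_le: "\<bar>poly (P (Suc i)) x\<bar> \<le> (1 + \<bar>\<tau> n\<bar>) * v i"
  proof (cases "i = n")
    case True
    have "poly (P (Suc n)) x = \<tau> n * poly (P n) x" using assms by (simp add: S_def Q_def)
    then show ?thesis using True vi by (simp add: abs_mult v_def algebra_simps)
  next
    case False
    then have "v (Suc i) \<le> v i" using i by auto
    also have "\<dots> \<le> (1 + \<bar>\<tau> n\<bar>) * v i" using vi mult_right_mono[of 1 "1 + \<bar>\<tau> n\<bar>" "v i"] by simp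
    finally show ?thesis by (simp add: v_def)
  qed
  have b: "\<bar>b i * poly (P i) x\<bar> \<le> v i"
    using mult_right_mono[OF b_bound[of i], of "v i"] by (simp add: abs_mult v_def)
  have "\<bar>x * poly (P i) x\<bar> \<le> (3 + \<bar>\<tau> n\<bar>) * v i"
  proof (cases "i = 0")
    case True
    have "\<bar>x * poly (P i) x\<bar> \<le> (1 + \<bar>\<tau> n\<bar>) * v i + v i"
      unfolding True poly_P_rec(2) using next_le[unfolded True] b[unfolded True] by linarith
    then show ?thesis using vi by (simp add: algebra_simps)
  next
    case False
    have "v (i - 1) \<le> v i" using i by simp
    moreover have "\<bar>c (i - 1) * poly (P (i - 1)) x\<bar> \<le> v (i - 1)"
      using mult_right_mono[OF c_le_1[of "i - 1"], of "v (i - 1)"] c_pos[of "i - 1"] by (simp add: abs_mult v_def)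
    ultimately have "\<bar>x * poly (P i) x\<bar> \<le> (1 + \<bar>\<tau> n\<bar>) * v i + v i + v i"
      using next_le b poly_P_rec(1)[of i x] False by linarith
    then show ?thesis by (simp add: algebra_simps)
  qed
  then show ?thesis using vi by (simp add: abs_mult v_def)
qed

text \<open>\<open>\<tau> n + b n\<close> is the average of the nodes with weights
  \<open>W n x * V x / h n\<close>: multiply the recurrence at a node by \<open>P n\<close> and sum.
  The quadrature is exact for \<open>P n ^ 2\<close> and for \<open>P (n - 1) * P n\<close>, whose
  integral is zero.\<close>

lemma \<tau>_bounded:
  assumes "\<And>x. x \<in> S n \<Longrightarrow> \<bar>x\<bar> \<le> M"
  shows "\<bar>\<tau> n\<bar> \<le> M + 1"
proof -
  define V where "V x = poly (P n) x * poly (P n) x" for x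
  have V0: "V x \<ge> 0" for x by (simp add: V_def)
  have h: "h n = (\<Sum>x\<in>S n. W n x * V x)"
    unfolding h_def V_def by (subst quadrature[of _ n]) (use degree_mult_le[of "P n" "P n"] in auto)
  have e: "x * V x = (\<tau> n + b n) * V x + (if n = 0 then 0 else c (n - 1) * (poly (P (n - 1)) x * poly (P n) x))"
    if "x \<in> S n" for x
  proof -
    have "poly (P (Suc n)) x = \<tau> n * poly (P n) x" using that by (simp add: S_def Q_def)
    then have "x * poly (P n) x = (\<tau> n + b n) * poly (P n) x + (if n = 0 then 0 else c (n - 1) * poly (P (n - 1)) x)"
      using poly_P_rec(1)[of n x] poly_P_rec(2)[of x] by (auto simp: algebra_simps)
    from arg_cong[OF this, of "\<lambda>u. u * poly (P n) x"] show ?thesis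
      unfolding V_def by (cases "n = 0") (simp_all only: if_True if_False distrib_right mult.assoc add_0_right, simp_all)
  qed
  have z: "(\<Sum>x\<in>S n. W n x * (poly (P (n - 1)) x * poly (P n) x)) = 0" if "n > 0"
  proof -
    have "I (P (n - 1) * P n) = (\<Sum>x\<in>S n. W n x * poly (P (n - 1) * P n) x)"
      by (rule quadrature) (use degree_mult_le[of "P (n - 1)" "P n"] in auto)
    then show ?thesis using that I_P_P[of "n - 1" n] by simp
  qed
  have "(\<Sum>x\<in>S n. W n x * (x * V x)) = (\<Sum>x\<in>S n. W n x * ((\<tau> n + b n) * V x) +
      (if n = 0 then 0 else c (n - 1)) * (W n x * (poly (P (n - 1)) x * poly (P n) x)))"
    by (rule sum.cong) (auto simp: e algebra_simps)
  also have "\<dots> = (\<tau> n + b n) * h n + (if n = 0 then 0 else c (n - 1)) *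
      (\<Sum>x\<in>S n. W n x * (poly (P (n - 1)) x * poly (P n) x))"
    by (simp add: sum.distrib h sum_distrib_left mult_ac)
  also have "\<dots> = (\<tau> n + b n) * h n" using z by simp
  finally have eq: "(\<tau> n + b n) * h n = (\<Sum>x\<in>S n. W n x * (x * V x))" ..
  have "\<bar>\<tau> n + b n\<bar> * h n = \<bar>\<Sum>x\<in>S n. W n x * (x * V x)\<bar>" using h_pos[of n] by (simp add: abs_mult flip: eq)
  also have "\<dots> \<le> (\<Sum>x\<in>S n. \<bar>W n x * (x * V x)\<bar>)" by (rule sum_abs)
  also have "\<dots> \<le> (\<Sum>x\<in>S n. M * (W n x * V x))"
  proof (rule sum_mono)
    fix x assume x: "x \<in> S n"
    have "\<bar>x\<bar> * (W n x * V x) \<le> M * (W n x * V x)"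
      using assms[OF x] V0[of x] W_pos[OF x] by (intro mult_right_mono) auto
    then show "\<bar>W n x * (x * V x)\<bar> \<le> M * (W n x * V x)"
      using V0[of x] W_pos[OF x] by (simp add: abs_mult mult_ac)
  qed
  also have "\<dots> = M * h n" by (simp add: h sum_distrib_left)
  finally have "\<bar>\<tau> n + b n\<bar> \<le> M" using h_pos[of n] by simp
  then show ?thesis using b_bound[of n] by linarith
qed

end


section \<open>Block matrices\<close>

locale gap_sequence =
  fixes N :: "nat \<Rightarrow> nat"
  assumes N_0: "N 0 = 0"
    and gap: "N (Suc j) = Suc (N j) \<or> N (Suc j) = Suc (Suc (N j))"
begin

definition two :: "nat \<Rightarrow> bool" where "two j \<longleftrightarrow> N (Suc j) = Suc (Suc (N j))"

lemma Suc_Suc_N: "two j \<Longrightarrow> Suc (Suc (N j)) = N (Suc j)"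
  by (simp add: two_def)

lemma Suc_N: "\<not> two j \<Longrightarrow> Suc (N j) = N (Suc j)"
  using gap[of j] by (simp add: two_def)

lemma strict_mono_N: "strict_mono N"
  unfolding strict_mono_Suc_iff using gap by (metis lessI less_Suc_eq)

lemma N_eq_iff [simp]: "N i = N j \<longleftrightarrow> i = j"
  using strict_mono_eq[OF strict_mono_N] by blast

lemma N_less_iff [simp]: "N i < N j \<longleftrightarrow> i < j"
  using strict_mono_less[OF strict_mono_N] by blast

lemma N_le_iff [simp]: "N i \<le> N j \<longleftrightarrow> i \<le> j"
  using strict_mono_less_eq[OF strict_mono_N] by blast

lemma block_of_eqI: "N j \<le> i \<Longrightarrow> i < N (Suc j) \<Longrightarrow> block_of N i = j"
  unfolding block_of_def
  by (rule the_equality) (auto, metis N_less_iff le_less_trans less_Suc_eq_le order_antisym)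

lemma block_of_N [simp]: "block_of N (N j) = j"
  by (rule block_of_eqI) auto

lemma block_of_Suc_N [simp]: "two j \<Longrightarrow> block_of N (Suc (N j)) = j"
  unfolding two_def by (rule block_of_eqI) linarith+

lemma block_size_eq: "block_size N j = (if two j then 2 else 1)"
  using gap[of j] unfolding block_size_def two_def by auto

lemma index_cases:
  obtains j where "i = N j" | j where "i = Suc (N j)" "two j"
proof -
  have "\<exists>j. i = N j \<or> i = Suc (N j) \<and> two j"
  proof (induction i)
    case 0
    show ?case by (rule exI[of _ 0]) (simp add: N_0)
  next
    case (Suc i)
    then obtain j where "i = N j \<or> i = Suc (N j) \<and> two j" by blast
    then show ?case using gap[of j] unfolding two_def by metis
  qed
  then show thesis using that by blast
qed

lemma Suc_N_neq [simp]: "two j \<Longrightarrow> Suc (N j) \<noteq> N i" "two j \<Longrightarrow> N i \<noteq> Suc (N j)"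
proof -
  show "Suc (N j) \<noteq> N i" if "two j"
  proof
    assume "Suc (N j) = N i"
    then have "N j < N i" "N i < N (Suc j)" using that unfolding two_def by linarith+
    then show False by simp
  qed
  then show "two j \<Longrightarrow> N i \<noteq> Suc (N j)" by metis
qed

declare Suc_Suc_N [simp] Suc_N [simp]

lemma lower_N: "block_lower N l (N i) m =
    (if m = N i then 1 else if i > 0 \<and> m = N (i - 1) then l i else 0)"
  by (rule index_cases[of m]; cases i)
     (auto simp: block_lower_def block_matrix_def)

lemma lower_Suc_N: "two i \<Longrightarrow> block_lower N l (Suc (N i)) m = (if m = Suc (N i) then 1 else 0)"
  by (rule index_cases[of m])
     (auto simp: block_lower_def block_matrix_def)

lemma lower_col_N: "block_lower N l i (N k) =
    (if i = N k then 1 else if i = N (Suc k) then l (Suc k) else 0)"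
  by (rule index_cases[of i])
     (auto simp: block_lower_def block_matrix_def)

lemma lower_col_Suc_N: "two k \<Longrightarrow> block_lower N l i (Suc (N k)) = (if i = Suc (N k) then 1 else 0)"
  by (rule index_cases[of i])
     (auto simp: block_lower_def block_matrix_def)

lemma upper_N: "block_upper N u0 u1 (N i) k =
    (if k = Suc (N i) then 1 else if k = N i \<and> \<not> two i then u0 i else 0)"
  by (cases "two i"; rule index_cases[of k])
     (auto simp: block_upper_def block_matrix_def diag_block_def corner_block_def block_size_eq)

lemma upper_Suc_N: "two i \<Longrightarrow> block_upper N u0 u1 (Suc (N i)) k =
    (if k = N (Suc i) then 1 else if k = Suc (N i) then u1 i else if k = N i then u0 i else 0)"
  by (rule index_cases[of k])
     (auto simp: block_upper_def block_matrix_def diag_block_def corner_block_def block_size_eq)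

text \<open>The shape of \<open>gen_jacobi_matrix\<close> with free entries, so that the product
  \<open>U L\<close> can be computed independently of the Schur algorithm.\<close>

definition block_tridiag :: "(nat \<Rightarrow> real) \<Rightarrow> (nat \<Rightarrow> real) \<Rightarrow> (nat \<Rightarrow> real) \<Rightarrow> nat \<Rightarrow> nat \<Rightarrow> real" where
  "block_tridiag d0 d1 e = block_matrix N (\<lambda>I K.
     if I = K then diag_block (block_size N I) (d0 I) (d1 I)
     else if K = Suc I then corner_block (block_size N I) 1
     else if I = Suc K then corner_block (block_size N I) (e K)
     else (\<lambda>r c. 0))"


lemma tridiag_N: "block_tridiag d0 d1 e (N i) k =
    (if k = Suc (N i) then 1 else if two i then 0 else if k = N i then d0 i
     else if (\<exists>j. i = Suc j \<and> k = N j) then e (i - 1) else 0)"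
  by (cases "two i"; rule index_cases[of k]; cases i)
     (auto simp: block_tridiag_def block_matrix_def diag_block_def corner_block_def block_size_eq)

lemma tridiag_Suc_N: "two i \<Longrightarrow> block_tridiag d0 d1 e (Suc (N i)) k =
    (if k = N (Suc i) then 1 else if k = Suc (N i) then d1 i else if k = N i then d0 i
     else if (\<exists>j. i = Suc j \<and> k = N j) then e (i - 1) else 0)"
  by (rule index_cases[of k]; cases i)
     (auto simp: block_tridiag_def block_matrix_def diag_block_def corner_block_def block_size_eq)

lemma matrix_prod_lower_N: "matrix_prod (block_lower N l) B (N i) k =
    B (N i) k + (if i > 0 then l i * B (N (i - 1)) k else 0)"
  unfolding matrix_prod_def
  by (subst suminf_finite[where N = "{N i, N (i - 1)}"]) (auto simp: lower_N sum.insert_if)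

lemma matrix_prod_lower_Suc_N: "two i \<Longrightarrow> matrix_prod (block_lower N l) B (Suc (N i)) k = B (Suc (N i)) k"
  unfolding matrix_prod_def
  by (subst suminf_finite[where N = "{Suc (N i)}"]) (auto simp: lower_Suc_N)

lemma matrix_prod_lower_col_N: "matrix_prod A (block_lower N l) i (N k) =
    A i (N k) + l (Suc k) * A i (N (Suc k))"
  unfolding matrix_prod_def
  by (subst suminf_finite[where N = "{N k, N (Suc k)}"]) (auto simp: lower_col_N)

lemma matrix_prod_lower_col_Suc_N: "two k \<Longrightarrow>
    matrix_prod A (block_lower N l) i (Suc (N k)) = A i (Suc (N k))"
  unfolding matrix_prod_def
  by (subst suminf_finite[where N = "{Suc (N k)}"]) (auto simp: lower_col_Suc_N)

lemma block_upper_cong: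
  assumes "\<And>i. u0 i = u0' i" "\<And>i. two i \<Longrightarrow> u1 i = u1' i"
  shows "block_upper N u0 u1 = block_upper N u0' u1'"
proof (intro ext)
  fix i k show "block_upper N u0 u1 i k = block_upper N u0' u1' i k"
    by (rule index_cases[of i]) (auto simp: upper_N upper_Suc_N assms)
qed

text \<open>Alternating elimination: \<open>u0 i\<close> determines \<open>l (Suc i)\<close>, which
  determines \<open>u0 (Suc i)\<close>. After a block of size 1 the matrix shows
  \<open>l (Suc i) * u0 i\<close>, so the pivot must not vanish; after a block of size 2 the column
  \<open>Suc (N i)\<close> shows \<open>l (Suc i)\<close> itself.\<close>

lemma LU_unique:
  assumes eq: "matrix_prod (block_lower N l) (block_upper N u0 u1) =
               matrix_prod (block_lower N l') (block_upper N u0' u1')"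
    and nz: "\<And>i. u0 i \<noteq> 0"
  shows "block_upper N u0 u1 = block_upper N u0' u1'"
proof (rule block_upper_cong)
  note e = fun_cong[OF fun_cong[OF eq]]
  show u0: "u0 i = u0' i" for i
  proof (induction i)
    case 0
    show ?case
      using e[of "N 0" "N 0"] e[of "Suc (N 0)" "N 0"]
      by (cases "two 0") (simp_all add: matrix_prod_lower_N matrix_prod_lower_Suc_N upper_N upper_Suc_N)
  next
    case (Suc i)
    have l: "l (Suc i) = l' (Suc i)"
      using e[of "N (Suc i)" "N i"] e[of "N (Suc i)" "Suc (N i)"] Suc nz[of i]
      by (cases "two i"; cases "two (Suc i)") (simp_all add: matrix_prod_lower_N upper_N)
    show ?case
      using e[of "Suc (N (Suc i))" "N (Suc i)"] e[of "N (Suc i)" "N (Suc i)"] l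
      by (cases "two (Suc i)"; cases "two i")
         (simp_all add: matrix_prod_lower_Suc_N matrix_prod_lower_N upper_N upper_Suc_N)
  qed
  show "u1 i = u1' i" if "two i" for i
    using e[of "Suc (N i)" "Suc (N i)"] that by (simp add: matrix_prod_lower_Suc_N upper_Suc_N)
qed

text \<open>Besides \<open>u1\<close>, the product shows only \<open>u0 i + l (Suc i)\<close> and
  \<open>l (Suc i) * u0 (Suc i)\<close>. So \<open>u0 0\<close> is a free parameter, and once it is
  fixed the remaining entries follow in turn.\<close>

lemma UL_unique:
  assumes eq: "matrix_prod (block_upper N u0 u1) (block_lower N l) =
               matrix_prod (block_upper N u0' u1') (block_lower N l')"
    and nz: "\<And>i. l (Suc i) \<noteq> 0" and start: "u0 0 = u0' 0"
  shows "block_upper N u0 u1 = block_upper N u0' u1'"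
proof (rule block_upper_cong)
  note e = fun_cong[OF fun_cong[OF eq]]
  show u0: "u0 i = u0' i" for i
  proof (induction i)
    case (Suc i)
    have l: "l (Suc i) = l' (Suc i)"
      using e[of "N i" "N i"] e[of "Suc (N i)" "N i"] Suc
      by (cases "two i") (simp_all add: matrix_prod_lower_col_N upper_N upper_Suc_N)
    then show ?case
      using e[of "N (Suc i)" "N i"] e[of "Suc (N (Suc i))" "N i"] nz[of i]
      by (cases "two (Suc i)") (simp_all add: matrix_prod_lower_col_N upper_N upper_Suc_N)
  qed (rule start)
  show "u1 i = u1' i" if "two i" for i
    using e[of "Suc (N i)" "Suc (N i)"] that by (simp add: matrix_prod_lower_col_Suc_N upper_Suc_N)
qed

text \<open>The upper-left entry \<open>l (Suc i)\<close> of its block meets the lower-left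
  \<open>1\<close> of the superdiagonal block of \<open>U\<close> and lands at the lower left of
  diagonal block \<open>i\<close>, where \<open>u0 i\<close> stands too.\<close>

lemma UL_tridiag:
  "matrix_prod (block_upper N u0 u1) (block_lower N l) =
   block_tridiag (\<lambda>i. u0 i + l (Suc i)) u1 (\<lambda>i. l (Suc i) * u0 (Suc i))"
proof (intro ext)
  fix i k
  show "matrix_prod (block_upper N u0 u1) (block_lower N l) i k =
      block_tridiag (\<lambda>i. u0 i + l (Suc i)) u1 (\<lambda>i. l (Suc i) * u0 (Suc i)) i k"
    by (rule index_cases[of i]; rule index_cases[of k])
       (auto simp: matrix_prod_lower_col_N matrix_prod_lower_col_Suc_N upper_N upper_Suc_N
        tridiag_N tridiag_Suc_N)
qed

lemma N_eq_Suc_N_iff: "N i = Suc (N j) \<longleftrightarrow> i = Suc j \<and> \<not> two j"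
  by (cases "two j") auto

declare Suc_Suc_N [simp del] Suc_N [simp del]

end

section \<open>Boundedness of tridiagonal matrices\<close>

lemma summable_shift_down:
  fixes y :: "nat \<Rightarrow> real"
  assumes "summable y"
  shows "summable (\<lambda>i. if i = 0 then 0 else y (i - 1))" "(\<Sum>i. if i = 0 then 0 else y (i - 1)) = suminf y"
  using sums_Suc_imp[of "\<lambda>i. if i = 0 then 0 else y (i - 1)" "suminf y"] summable_sums[OF assms]
  by (auto simp: sums_iff)

lemma tridiagonal_app:
  assumes "\<And>i k. A i k \<noteq> 0 \<Longrightarrow> k \<le> Suc i \<and> i \<le> Suc k"
  shows "summable (\<lambda>k. of_real (A i k) * x k)"
    and "matrix_app A x i = (if i = 0 then 0 else of_real (A i (i - 1)) * x (i - 1)) +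
      of_real (A i i) * x i + of_real (A i (Suc i)) * x (Suc i)"
proof -
  have z: "of_real (A i k) * x k = 0" if "k \<notin> {i - 1, i, Suc i}" for k
    using assms[of i k] that by fastforce
  show "summable (\<lambda>k. of_real (A i k) * x k)"
    by (rule summable_finite[of "{i - 1, i, Suc i}"]) (use z in auto)
  show "matrix_app A x i = (if i = 0 then 0 else of_real (A i (i - 1)) * x (i - 1)) +
      of_real (A i i) * x i + of_real (A i (Suc i)) * x (Suc i)"
    unfolding matrix_app_def
    by (subst suminf_finite[of "{i - 1, i, Suc i}"]) (use z in \<open>auto simp: sum.insert_if\<close>)
qed

lemma cmod_sum3_sq: "(cmod (a + b + c))\<^sup>2 \<le> 3 * ((cmod a)\<^sup>2 + (cmod b)\<^sup>2 + (cmod c)\<^sup>2)"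
proof -
  have "(cmod (a + b + c))\<^sup>2 \<le> (cmod a + cmod b + cmod c)\<^sup>2"
    by (intro power_mono norm_triangle_le add_right_mono norm_triangle_ineq) auto
  also have "\<dots> \<le> 3 * ((cmod a)\<^sup>2 + (cmod b)\<^sup>2 + (cmod c)\<^sup>2)"
    using sum_squares_ge_zero[of "cmod a - cmod b" 0] zero_le_power2[of "cmod a - cmod b"]
      zero_le_power2[of "cmod b - cmod c"] zero_le_power2[of "cmod a - cmod c"]
    by (simp add: power2_eq_square algebra_simps)
  finally show ?thesis .
qed

text \<open>Unit vectors show that a bounded operator has bounded entries. Conversely, each row is a
  sum of three terms and each coordinate occurs in at most three rows, which gives the norm bound
  \<open>3 * C\<close>.\<close>

lemma ell2_bounded_tridiagonal_iff:
  assumes tri: "\<And>i k. A i k \<noteq> 0 \<Longrightarrow> k \<le> Suc i \<and> i \<le> Suc k"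
  shows "ell2_bounded A \<longleftrightarrow> (\<exists>C. \<forall>i k. \<bar>A i k\<bar> \<le> C)"
proof
  assume "ell2_bounded A"
  then obtain C where C: "\<And>x. x \<in> ell2 \<Longrightarrow> matrix_app A x \<in> ell2 \<and> ell2_norm (matrix_app A x) \<le> C * ell2_norm x"
    by (auto simp: ell2_bounded_def)
  have "\<bar>A i k\<bar> \<le> C" for i k
  proof -
    define e :: "nat \<Rightarrow> complex" where "e = (\<lambda>m. if m = k then 1 else 0)"
    have sq: "(cmod (e m))\<^sup>2 = (if m = k then 1 else 0)" for m by (simp add: e_def)
    have e: "e \<in> ell2" "ell2_norm e = 1"
      unfolding ell2_def ell2_norm_def using sums_single[of k "\<lambda>_. 1 :: real"] by (auto simp: sums_iff sq)
    have app: "matrix_app A e m = of_real (A m k)" for m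
      unfolding matrix_app_def by (subst suminf_finite[of "{k}"]) (auto simp: e_def)
    have sm: "summable (\<lambda>m. (A m k)\<^sup>2)" using C[OF e(1)] by (simp add: ell2_def app)
    have "(A i k)\<^sup>2 = sum (\<lambda>m. (A m k)\<^sup>2) {i}" by simp
    also have "\<dots> \<le> (\<Sum>m. (A m k)\<^sup>2)" by (rule sum_le_suminf[OF sm]) auto
    finally have "\<bar>A i k\<bar> \<le> sqrt (\<Sum>m. (A m k)\<^sup>2)" by (metis real_sqrt_abs real_sqrt_le_mono)
    also have "\<dots> \<le> C" using C[OF e(1)] e(2) by (simp add: ell2_norm_def app)
    finally show ?thesis .
  qed
  then show "\<exists>C. \<forall>i k. \<bar>A i k\<bar> \<le> C" by blast
next
  assume "\<exists>C. \<forall>i k. \<bar>A i k\<bar> \<le> C"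
  then obtain C where C: "\<And>i k. \<bar>A i k\<bar> \<le> C" by blast
  have C0: "C \<ge> 0" using C[of 0 0] by linarith
  have "matrix_app A x \<in> ell2 \<and> ell2_norm (matrix_app A x) \<le> 3 * C * ell2_norm x" if x: "x \<in> ell2" for x
  proof -
    define y where "y i = (cmod (x i))\<^sup>2" for i
    define y' where "y' i = (if i = 0 then 0 else y (i - 1))" for i
    have y: "summable y" using x by (simp add: ell2_def y_def[abs_def])
    have y': "summable y'" "suminf y' = suminf y"
      using summable_shift_down[OF y] by (auto simp: y'_def[abs_def])
    have ys: "summable (\<lambda>i. y (Suc i))" using y by (simp add: summable_Suc_iff)
    have ysle: "(\<Sum>i. y (Suc i)) \<le> suminf y"
      using suminf_split_head[OF y] by (simp add: y_def)
    have m: "(cmod (of_real (A i k) * z))\<^sup>2 \<le> C\<^sup>2 * (cmod z)\<^sup>2" for i k z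
      using C[of i k] power_mono[of "\<bar>A i k\<bar>" C 2] by (simp add: norm_mult power_mult_distrib mult_right_mono)
    have bd: "(cmod (matrix_app A x i))\<^sup>2 \<le> 3 * C\<^sup>2 * (y' i + y i + y (Suc i))" for i
    proof -
      have "(cmod (matrix_app A x i))\<^sup>2 \<le> 3 * ((cmod (if i = 0 then 0 else of_real (A i (i - 1)) * x (i - 1)))\<^sup>2 +
        (cmod (of_real (A i i) * x i))\<^sup>2 + (cmod (of_real (A i (Suc i)) * x (Suc i)))\<^sup>2)"
        by (subst tridiagonal_app(2)) (use tri in blast, rule cmod_sum3_sq)
      also have "\<dots> \<le> 3 * (C\<^sup>2 * y' i + C\<^sup>2 * y i + C\<^sup>2 * y (Suc i))"
        using m[of i "i - 1" "x (i - 1)"] m[of i i "x i"] m[of i "Suc i" "x (Suc i)"]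
        by (cases "i = 0") (auto simp: y'_def y_def intro!: mult_left_mono add_mono)
      finally show ?thesis by (simp add: algebra_simps)
    qed
    have sums: "summable (\<lambda>i. 3 * C\<^sup>2 * (y' i + y i + y (Suc i)))"
      by (intro summable_mult summable_add y y' ys)
    have sm: "summable (\<lambda>i. (cmod (matrix_app A x i))\<^sup>2)"
      by (rule summable_comparison_test'[OF sums]) (use bd in auto)
    have "(\<Sum>i. (cmod (matrix_app A x i))\<^sup>2) \<le> (\<Sum>i. 3 * C\<^sup>2 * (y' i + y i + y (Suc i)))"
      by (rule suminf_le[OF bd sm sums])
    also have "\<dots> = 3 * C\<^sup>2 * (suminf y' + suminf y + (\<Sum>i. y (Suc i)))"
      using suminf_add[OF summable_add[OF y'(1) y] ys] suminf_add[OF y'(1) y]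
      by (subst suminf_mult) (auto intro!: summable_add y y' ys)
    also have "\<dots> \<le> 3 * C\<^sup>2 * (3 * suminf y)"
      by (rule mult_left_mono) (use y' ysle in auto)
    finally have "(\<Sum>i. (cmod (matrix_app A x i))\<^sup>2) \<le> (3 * C)\<^sup>2 * suminf y" by (simp add: power2_eq_square)
    then have "ell2_norm (matrix_app A x) \<le> sqrt ((3 * C)\<^sup>2 * suminf y)"
      unfolding ell2_norm_def by (rule real_sqrt_le_mono)
    also have "\<dots> = 3 * C * ell2_norm x" using C0 by (simp add: real_sqrt_mult ell2_norm_def y_def[abs_def])
    finally show ?thesis using sm by (simp add: ell2_def)
  qed
  then show "ell2_bounded A" unfolding ell2_bounded_def using tridiagonal_app(1)[where A = A] tri by blast
qed


section \<open>The Riemann sphere\<close>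

lemma norm_stereo_denom: "norm (1 + (complex_of_real (cmod z))\<^sup>2) = 1 + (cmod z)\<^sup>2"
  using norm_of_real[of "1 + (cmod z)\<^sup>2", where ?'a = complex] by simp

text \<open>Each of the two components of the stereographic embedding has Lipschitz constant
  \<open>2\<close>; bounding the distance by the sum of the component distances gives
  \<open>4\<close>.\<close>

lemma dist_Fin_Fin_le: "dist (Fin z) (Fin w) \<le> 4 * cmod (z - w)"
proof -
  define a b where "a = cmod z" and "b = cmod w"
  have ab: "a \<ge> 0" "b \<ge> 0" by (auto simp: a_def b_def)
  have pos: "1 + a\<^sup>2 > 0" "1 + b\<^sup>2 > 0" by (auto intro: add_pos_nonneg)
  have prod: "1 + a * b \<le> (1 + a\<^sup>2) * (1 + b\<^sup>2)"
  proof -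
    have "0 \<le> (a - b)\<^sup>2 + a\<^sup>2 + b\<^sup>2 + 2 * (a * b)\<^sup>2" by simp
    then show ?thesis by (simp add: power2_eq_square algebra_simps)
  qed
  have sum: "a + b \<le> (1 + a\<^sup>2) * (1 + b\<^sup>2)"
  proof -
    have "0 \<le> (a - 1 / 2)\<^sup>2 + (b - 1 / 2)\<^sup>2 + (a * b)\<^sup>2" by simp
    then show ?thesis by (simp add: power2_eq_square algebra_simps)
  qed
  have nz: "complex_of_real (1 + a\<^sup>2) \<noteq> 0" "complex_of_real (1 + b\<^sup>2) \<noteq> 0"
    using pos by (simp_all only: of_real_eq_0_iff)
  \<comment> \<open>With \<open>a ^ 2 = z * cnj z\<close> and \<open>b ^ 2 = w * cnj w\<close>, each
    summand of the numerator carries the factor \<open>z - w\<close> up to conjugation and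
    sign.\<close>
  have num: "z * of_real (1 + b\<^sup>2) - w * of_real (1 + a\<^sup>2) = (z - w) + z * w * cnj (w - z)"
  proof -
    have "complex_of_real (b\<^sup>2) = w * cnj w" "complex_of_real (a\<^sup>2) = z * cnj z"
      by (simp_all add: a_def b_def complex_mult_cnj cmod_power2)
    then show ?thesis by (simp add: algebra_simps)
  qed
  have "2 * z / of_real (1 + a\<^sup>2) - 2 * w / of_real (1 + b\<^sup>2) =
      2 * ((z - w) + z * w * cnj (w - z)) / (of_real (1 + a\<^sup>2) * of_real (1 + b\<^sup>2))"
    unfolding num[symmetric] using nz by (simp add: divide_simps)
  then have "cmod (2 * z / of_real (1 + a\<^sup>2) - 2 * w / of_real (1 + b\<^sup>2)) =
      2 * cmod ((z - w) + z * w * cnj (w - z)) / ((1 + a\<^sup>2) * (1 + b\<^sup>2))"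
    using pos by (simp only: norm_divide norm_mult norm_of_real) simp
  also have "\<dots> \<le> 2 * (cmod (z - w) * (1 + a * b)) / ((1 + a\<^sup>2) * (1 + b\<^sup>2))"
  proof -
    have "cmod ((z - w) + z * w * cnj (w - z)) \<le> cmod (z - w) + a * b * cmod (z - w)"
      using norm_triangle_ineq[of "z - w" "z * w * cnj (w - z)"]
      by (simp only: norm_mult complex_mod_cnj a_def b_def norm_minus_commute[of w z])
    then show ?thesis using pos by (intro divide_right_mono) (auto simp: algebra_simps)
  qed
  also have "\<dots> \<le> 2 * cmod (z - w)"
    using mult_left_mono[OF prod, of "cmod (z - w)"] pos by (simp add: divide_le_eq mult_ac)
  finally have 1: "cmod (2 * z / of_real (1 + a\<^sup>2) - 2 * w / of_real (1 + b\<^sup>2)) \<le> 2 * cmod (z - w)" .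
  have "(a\<^sup>2 - 1) / (a\<^sup>2 + 1) - (b\<^sup>2 - 1) / (b\<^sup>2 + 1) = 2 * ((a - b) * (a + b)) / ((1 + a\<^sup>2) * (1 + b\<^sup>2))"
    using pos by (simp add: divide_simps) (simp add: power2_eq_square algebra_simps)
  then have "\<bar>(a\<^sup>2 - 1) / (a\<^sup>2 + 1) - (b\<^sup>2 - 1) / (b\<^sup>2 + 1)\<bar> = 2 * (\<bar>a - b\<bar> * (a + b)) / ((1 + a\<^sup>2) * (1 + b\<^sup>2))"
    using pos ab by (simp add: abs_mult)
  also have "\<dots> \<le> 2 * \<bar>a - b\<bar>"
    using mult_left_mono[OF sum, of "\<bar>a - b\<bar>"] pos by (simp add: divide_le_eq mult_ac)
  also have "\<bar>a - b\<bar> \<le> cmod (z - w)" unfolding a_def b_def by (rule norm_triangle_ineq3)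
  finally have 2: "\<bar>(a\<^sup>2 - 1) / (a\<^sup>2 + 1) - (b\<^sup>2 - 1) / (b\<^sup>2 + 1)\<bar> \<le> 2 * cmod (z - w)" by simp
  have "dist (Fin z) (Fin w) = sqrt ((cmod (2 * z / of_real (1 + a\<^sup>2) - 2 * w / of_real (1 + b\<^sup>2)))\<^sup>2 +
      ((a\<^sup>2 - 1) / (a\<^sup>2 + 1) - (b\<^sup>2 - 1) / (b\<^sup>2 + 1))\<^sup>2)"
    by (simp add: dist_rsphere_def dist_prod_def dist_norm a_def b_def)
  also have "\<dots> \<le> cmod (2 * z / of_real (1 + a\<^sup>2) - 2 * w / of_real (1 + b\<^sup>2)) +
      \<bar>(a\<^sup>2 - 1) / (a\<^sup>2 + 1) - (b\<^sup>2 - 1) / (b\<^sup>2 + 1)\<bar>"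
    using sqrt_sum_squares_le_sum_abs[of "cmod (2 * z / of_real (1 + a\<^sup>2) - 2 * w / of_real (1 + b\<^sup>2))"] by simp
  finally show ?thesis using 1 2 by linarith
qed

lemma continuous_on_stereo: "continuous_on UNIV stereo"
  by (auto simp: continuous_on_iff dist_rsphere_def)

lemma continuous_on_Fin: "continuous_on UNIV Fin"
proof (rule lipschitz_on_continuous_on)
  show "4-lipschitz_on UNIV Fin"
    by (rule lipschitz_onI) (use dist_Fin_Fin_le in \<open>auto simp: dist_norm\<close>)
qed

lemma snd_stereo_Fin: "snd (stereo (Fin z)) = 1 - 2 / (1 + (cmod z)\<^sup>2)"
proof -
  have "1 + (cmod z)\<^sup>2 > 0" by (auto intro: add_pos_nonneg)
  then show ?thesis by (simp add: field_simps)
qed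

lemma snd_stereo_less_1: "snd (stereo (Fin z)) < 1"
  unfolding snd_stereo_Fin by (auto intro!: divide_pos_pos add_pos_nonneg)

lemma unstereo: "fst (stereo (Fin z)) / of_real (1 - snd (stereo (Fin z))) = z"
proof -
  have "complex_of_real (1 + (cmod z)\<^sup>2) \<noteq> 0"
    unfolding of_real_eq_0_iff using zero_le_power2[of "cmod z"] by linarith
  moreover have "of_real (1 - snd (stereo (Fin z))) = 2 / complex_of_real (1 + (cmod z)\<^sup>2)"
    unfolding snd_stereo_Fin by simp
  ultimately show ?thesis by simp
qed

text \<open>Off the north pole \<open>stereo\<close> has the continuous left inverse of
  \<open>unstereo\<close>, so the image is a preimage under a continuous map on an open set.\<close>

lemma open_Fin_image:
  assumes "open U" shows "open (Fin ` U)"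
proof -
  let ?D = "{p. snd (stereo p) < 1}"
  let ?u = "\<lambda>p. fst (stereo p) / of_real (1 - snd (stereo p)) :: complex"
  have D: "open ?D"
    by (rule open_Collect_less) (auto intro!: continuous_intros continuous_on_stereo)
  have "continuous_on ?D ?u"
    by (intro continuous_intros continuous_on_subset[OF continuous_on_stereo])
       (auto simp: complex_eq_iff)
  then have "open (?D \<inter> ?u -` U)" by (rule continuous_open_preimage) (use D assms in auto)
  also have "?D \<inter> ?u -` U = Fin ` U"
  proof (intro Set.set_eqI iffI)
    fix p assume p: "p \<in> ?D \<inter> ?u -` U"
    then obtain z where z: "p = Fin z" by (cases p) auto
    then show "p \<in> Fin ` U" using p unstereo[of z] by auto
  next
    fix p assume "p \<in> Fin ` U"
    then show "p \<in> ?D \<inter> ?u -` U" using snd_stereo_less_1 unstereo by auto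
  qed
  finally show ?thesis .
qed

lemma open_Infty_nhd: "open (insert Infty (Fin ` {z. R < cmod z}))"
proof (cases "R < 0")
  case True
  then have "{z. R < cmod z} = UNIV" by (auto intro: less_le_trans)
  then have "insert Infty (Fin ` {z. R < cmod z}) = UNIV" by (auto intro: rsphere.exhaust)
  then show ?thesis by (simp only: open_UNIV)
next
  case False
  \<comment> \<open>By \<open>snd_stereo_Fin\<close> this polar cap is bounded by the circle of
    radius \<open>R\<close>.\<close>
  let ?D = "{p. 1 - 2 / (1 + R\<^sup>2) < snd (stereo p)}"
  have "open ?D"
    by (rule open_Collect_less) (auto intro!: continuous_intros continuous_on_stereo)
  also have "?D = insert Infty (Fin ` {z. R < cmod z})"
  proof (rule Set.set_eqI)
    fix p
    show "p \<in> ?D \<longleftrightarrow> p \<in> insert Infty (Fin ` {z. R < cmod z})"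
    proof (cases p)
      case (Fin z)
      have "1 + R\<^sup>2 > 0" "1 + (cmod z)\<^sup>2 > 0" by (auto intro: add_pos_nonneg)
      then have "1 - 2 / (1 + R\<^sup>2) < 1 - 2 / (1 + (cmod z)\<^sup>2) \<longleftrightarrow> R\<^sup>2 < (cmod z)\<^sup>2"
        by (simp add: field_simps)
      also have "\<dots> \<longleftrightarrow> R < cmod z"
        using False power_mono_iff[of "cmod z" R 2] by (simp add: not_le[symmetric])
      finally show ?thesis using Fin by (auto simp: snd_stereo_Fin simp del: stereo.simps)
    next
      case Infty
      have "0 < 2 / (1 + R\<^sup>2)" by (intro divide_pos_pos add_pos_nonneg) auto
      then show ?thesis using Infty by simp
    qed
  qed
  finally show ?thesis .
qed

lemma dist_Fin_Infty: "(dist (Fin z) Infty)\<^sup>2 = 4 / (1 + (cmod z)\<^sup>2)"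
proof -
  have pos: "1 + (cmod z)\<^sup>2 > 0" by (auto intro: add_pos_nonneg)
  have "(dist (Fin z) Infty)\<^sup>2 = (2 * cmod z / (1 + (cmod z)\<^sup>2))\<^sup>2 + (2 / (1 + (cmod z)\<^sup>2))\<^sup>2"
    unfolding dist_rsphere_def dist_prod_def snd_stereo_Fin
    by (simp add: dist_norm norm_divide norm_mult norm_stereo_denom snd_stereo_Fin[simplified])
  also have "\<dots> = 4 * (1 + (cmod z)\<^sup>2) / (1 + (cmod z)\<^sup>2)\<^sup>2"
    by (simp add: power_divide power_mult_distrib add_divide_distrib[symmetric])
  also have "\<dots> = 4 / (1 + (cmod z)\<^sup>2)"
    using pos unfolding power2_eq_square[of "1 + (cmod z)\<^sup>2"] by (intro mult_divide_mult_cancel_right) simp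
  finally show ?thesis .
qed

lemma open_contains_Infty_nhd:
  assumes "open V" "Infty \<in> V"
  obtains R where "R > 0" "\<And>z. R < cmod z \<Longrightarrow> Fin z \<in> V"
proof -
  obtain e where e: "e > 0" "ball Infty e \<subseteq> V" using assms open_contains_ball by blast
  define R where "R = 2 / e"
  have "Fin z \<in> V" if "R < cmod z" for z
  proof -
    have "4 / e\<^sup>2 < (cmod z)\<^sup>2"
      using power_strict_mono[OF that, of 2] e(1) by (simp add: R_def power_divide)
    then have "4 < (cmod z)\<^sup>2 * e\<^sup>2" using e(1) by (simp add: divide_less_eq)
    then have "4 < e\<^sup>2 * (1 + (cmod z)\<^sup>2)" using e(1) by (simp add: algebra_simps add_strict_increasing)
    moreover have "1 + (cmod z)\<^sup>2 > 0" by (auto intro: add_pos_nonneg)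
    ultimately have "(dist (Fin z) Infty)\<^sup>2 < e\<^sup>2" unfolding dist_Fin_Infty by (simp add: divide_less_eq)
    then have "dist (Fin z) Infty < e" by (rule power2_less_imp_less) (use e in simp)
    then show ?thesis using e(2) by (auto simp: dist_commute)
  qed
  moreover have "R > 0" using e by (simp add: R_def)
  ultimately show thesis using that by blast
qed

text \<open>Turns spherical closeness to a bounded function into a Euclidean bound by comparing
  heights: \<open>b\<close> lies at height at most \<open>0\<close>, so \<open>a\<close> lies below
  height \<open>1 / 2\<close>, that is \<open>|a| ^ 2 < 3\<close>.\<close>

lemma norm_le_2_if_dist_Fin_less:
  assumes "dist (Fin a) (Fin b) < 1 / 2" "cmod b \<le> 1"
  shows "cmod a \<le> 2"
proof -
  have "dist (snd (stereo (Fin a))) (snd (stereo (Fin b))) < 1 / 2"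
    using assms(1) dist_snd_le[of "stereo (Fin a)" "stereo (Fin b)"] unfolding dist_rsphere_def by linarith
  then have 1: "2 / (1 + (cmod b)\<^sup>2) - 2 / (1 + (cmod a)\<^sup>2) < 1 / 2"
    unfolding snd_stereo_Fin dist_real_def by linarith
  have "(cmod b)\<^sup>2 \<le> 1" using assms(2) by (simp add: abs_square_le_1)
  then have "1 \<le> 2 / (1 + (cmod b)\<^sup>2)" by (simp add: le_divide_eq add_pos_nonneg)
  then have "1 / 2 < 2 / (1 + (cmod a)\<^sup>2)" using 1 by linarith
  then have "(cmod a)\<^sup>2 < 3" by (simp add: less_divide_eq add_pos_nonneg)
  then show ?thesis by (intro power2_le_imp_le[of "cmod a" 2]) auto
qed

text \<open>Together with \<open>at_Infty_eq\<close> this reduces limits on the sphere, and so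
  \<open>sphere_ext\<close>, to limits in the plane.\<close>

lemma at_Fin_eq: "at (Fin z) = filtermap Fin (at z)"
proof (rule antisym)
  show "at (Fin z) \<le> filtermap Fin (at z)"
  proof (rule filter_leI)
    fix Pr assume "eventually Pr (filtermap Fin (at z))"
    then obtain U where "open U" "z \<in> U" "\<And>w. w \<in> U \<Longrightarrow> w \<noteq> z \<Longrightarrow> Pr (Fin w)"
      unfolding eventually_filtermap eventually_at_topological by blast
    then show "eventually Pr (at (Fin z))"
      unfolding eventually_at_topological by (intro exI[of _ "Fin ` U"]) (auto intro: open_Fin_image)
  qed
  have "(Fin \<longlongrightarrow> Fin z) (at z)"
    using continuous_on_Fin by (simp add: continuous_on_eq_continuous_at isCont_def)
  then have "filterlim Fin (at (Fin z)) (at z)"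
    unfolding filterlim_at by (auto simp: eventually_at_topological)
  then show "filtermap Fin (at z) \<le> at (Fin z)" by (simp add: filterlim_def)
qed

lemma at_Infty_eq: "at Infty = filtermap Fin at_infinity"
proof (rule antisym)
  show "at Infty \<le> filtermap Fin at_infinity"
  proof (rule filter_leI)
    fix Pr assume "eventually Pr (filtermap Fin at_infinity)"
    then obtain R where "\<And>z. R \<le> cmod z \<Longrightarrow> Pr (Fin z)"
      unfolding eventually_filtermap eventually_at_infinity by blast
    then show "eventually Pr (at Infty)"
      unfolding eventually_at_topological
      by (intro exI[of _ "insert Infty (Fin ` {z. R < cmod z})"]) (auto intro: open_Infty_nhd)
  qed
  show "filtermap Fin at_infinity \<le> at Infty"
  proof (rule filter_leI)
    fix Pr assume "eventually Pr (at Infty)"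
    then obtain V where V: "open V" "Infty \<in> V" "\<And>p. p \<in> V \<Longrightarrow> p \<noteq> Infty \<Longrightarrow> Pr p"
      unfolding eventually_at_topological by blast
    obtain R where "R > 0" "\<And>z. R < cmod z \<Longrightarrow> Fin z \<in> V"
      using open_contains_Infty_nhd[OF V(1,2)] by blast
    then show "eventually Pr (filtermap Fin at_infinity)"
      unfolding eventually_filtermap eventually_at_infinity
      by (intro exI[of _ "R + 1"]) (auto intro!: V(3))
  qed
qed

lemma tendsto_Fin: "(f \<longlongrightarrow> l) F \<Longrightarrow> ((\<lambda>x. Fin (f x)) \<longlongrightarrow> Fin l) F"
  using continuous_on_tendsto_compose[OF continuous_on_Fin] by fastforce

lemma sphere_ext_Fin: "(f \<longlongrightarrow> l) (at z) \<Longrightarrow> sphere_ext f (Fin z) = Fin l"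
  unfolding sphere_ext_def at_Fin_eq
  by (rule tendsto_Lim) (auto simp: filtermap_bot_iff filterlim_filtermap trivial_limit_at_infinity intro: tendsto_Fin)

lemma sphere_ext_Infty: "(f \<longlongrightarrow> l) at_infinity \<Longrightarrow> sphere_ext f Infty = Fin l"
  unfolding sphere_ext_def at_Infty_eq
  by (rule tendsto_Lim) (auto simp: filtermap_bot_iff filterlim_filtermap trivial_limit_at_infinity intro: tendsto_Fin)

text \<open>Punctured neighbourhoods can avoid a finite set, so both sides have the same limits at
  every point; where there is none, \<open>Lim\<close> is unspecified but the same. This discards
  the values that come from division by zero.\<close>

lemma sphere_ext_cong_finite:
  assumes "finite {z. f z \<noteq> g z}"
  shows "sphere_ext f = sphere_ext g"
proof
  fix p
  let ?h = "\<lambda>f q. case q of Fin w \<Rightarrow> Fin (f w) | Infty \<Rightarrow> Infty"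
  have "open (- (Fin ` {z. f z \<noteq> g z} - {p}))"
    by (rule open_Compl[OF finite_imp_closed]) (use assms in simp)
  then have "eventually (\<lambda>q. ?h f q = ?h g q) (at p)"
    unfolding eventually_at_topological
    by (intro exI[of _ "- (Fin ` {z. f z \<noteq> g z} - {p})"]) (auto split: rsphere.split)
  then have "(?h f \<longlongrightarrow> l) (at p) \<longleftrightarrow> (?h g \<longlongrightarrow> l) (at p)" for l by (rule tendsto_cong)
  then show "sphere_ext f p = sphere_ext g p" by (simp add: sphere_ext_def Topological_Spaces.Lim_def)
qed


section \<open>Expansions at infinity\<close>

definition fps_cnj :: "complex fps \<Rightarrow> complex fps" where
  "fps_cnj F = Abs_fps (\<lambda>n. cnj (fps_nth F n))"

text \<open>Stated as invariance under conjugation, realness passes to a quotient by cancelling the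
  denominator, without a formula for its coefficients.\<close>

definition real_fps :: "complex fps \<Rightarrow> bool" where
  "real_fps F \<longleftrightarrow> fps_cnj F = F"

lemma fps_cnj_mult: "fps_cnj (F * G) = fps_cnj F * fps_cnj G"
  by (rule fps_ext) (simp add: fps_cnj_def fps_mult_nth)

lemma real_fps_iff: "real_fps F \<longleftrightarrow> (\<forall>n. fps_nth F n \<in> \<real>)"
  by (simp add: real_fps_def fps_eq_iff fps_cnj_def Reals_cnj_iff)

lemma real_fps_cmult: "c \<in> \<real> \<Longrightarrow> real_fps F \<Longrightarrow> real_fps (fps_const c * F)"
  by (simp add: real_fps_iff)

lemma real_fps_divide:
  assumes "real_fps F" "real_fps G" "G \<noteq> 0" "subdegree G \<le> subdegree F"
  shows "real_fps (F / G)"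
proof -
  have "G dvd F"
  proof (cases "F = 0")
    case False
    then show ?thesis using assms by (simp add: fps_dvd_iff)
  qed simp
  then have FG: "F / G * G = F" by (rule dvd_div_mult_self)
  then have "fps_cnj (F / G) * G = F / G * G"
    using fps_cnj_mult[of "F / G" G] assms(1,2) by (simp add: real_fps_def)
  then show ?thesis using assms(3) by (simp add: real_fps_def)
qed

text \<open>An analytic germ in the variable \<open>1 / z\<close>. The functions met in the Schur
  algorithm have such germs because the measure has compact support. A germ gives the expansions in
  all sectors at once, and quotients are computed with formal power series.\<close>

definition expands_at_infinity :: "(complex \<Rightarrow> complex) \<Rightarrow> complex fps \<Rightarrow> bool" where
  "expands_at_infinity f F \<longleftrightarrow>
     (\<exists>G. G has_fps_expansion F \<and> eventually (\<lambda>z. f z = G (inverse z)) at_infinity)"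

lemma expands_cong:
  assumes "expands_at_infinity f F" "eventually (\<lambda>z. g z = f z) at_infinity"
  shows "expands_at_infinity g F"
proof -
  obtain G where G: "G has_fps_expansion F" "eventually (\<lambda>z. f z = G (inverse z)) at_infinity"
    using assms(1) by (auto simp: expands_at_infinity_def)
  from assms(2) G(2) have "eventually (\<lambda>z. g z = G (inverse z)) at_infinity" by eventually_elim simp
  then show ?thesis using G(1) by (auto simp: expands_at_infinity_def)
qed

lemma expands_cmult:
  assumes "expands_at_infinity f F"
  shows "expands_at_infinity (\<lambda>z. c * f z) (fps_const c * F)"
proof -
  obtain G where G: "G has_fps_expansion F" "eventually (\<lambda>z. f z = G (inverse z)) at_infinity"
    using assms by (auto simp: expands_at_infinity_def)
  have "(\<lambda>w. c * G w) has_fps_expansion fps_const c * F" by (rule has_fps_expansion_cmult_left) fact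
  moreover have "eventually (\<lambda>z. c * f z = c * G (inverse z)) at_infinity"
    using G(2) by eventually_elim simp
  ultimately show ?thesis unfolding expands_at_infinity_def by (intro exI[of _ "\<lambda>w. c * G w"]) simp
qed

lemma eventually_nonzero_at_infinity: "eventually (\<lambda>z::complex. z \<noteq> 0) at_infinity"
  unfolding eventually_at_infinity by (intro exI[of _ 1]) auto

lemma expands_divide:
  assumes "expands_at_infinity f F" "expands_at_infinity g G" "G \<noteq> 0" "subdegree G \<le> subdegree F"
  shows "expands_at_infinity (\<lambda>z. f z / g z) (F / G)"
proof -
  obtain f' where f': "f' has_fps_expansion F" "eventually (\<lambda>z. f z = f' (inverse z)) at_infinity"
    using assms(1) by (auto simp: expands_at_infinity_def)
  obtain g' where g': "g' has_fps_expansion G" "eventually (\<lambda>z. g z = g' (inverse z)) at_infinity"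
    using assms(2) by (auto simp: expands_at_infinity_def)
  define c where "c = fps_nth F (subdegree G) / fps_nth G (subdegree G)"
  have "(\<lambda>w. if w = 0 then c else f' w / g' w) has_fps_expansion (F / G)"
    by (rule has_fps_expansion_divide) (use f' g' assms c_def in auto)
  moreover have "eventually (\<lambda>z. f z / g z = (if inverse z = 0 then c else f' (inverse z) / g' (inverse z))) at_infinity"
    using f'(2) g'(2) eventually_nonzero_at_infinity by eventually_elim auto
  ultimately show ?thesis
    unfolding expands_at_infinity_def by (intro exI[of _ "\<lambda>w. if w = 0 then c else f' w / g' w"]) simp
qed

lemma expands_tendsto_gen:
  assumes "expands_at_infinity f F" "\<And>i. i < n \<Longrightarrow> fps_nth F i = 0"
  shows "((\<lambda>z. f z * z ^ n) \<longlongrightarrow> fps_nth F n) at_infinity"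
proof -
  obtain G where G: "G has_fps_expansion F" "eventually (\<lambda>z. f z = G (inverse z)) at_infinity"
    using assms(1) by (auto simp: expands_at_infinity_def)
  have "\<exists>H. H has_fps_expansion fps_shift n F \<and> (\<forall>w. w \<noteq> 0 \<longrightarrow> H w = G w / w ^ n)"
  \<comment> \<open>\<open>subdegree 0 = 0\<close>, so the zero series does not satisfy the premise
    of the shift lemma for \<open>n > 0\<close>.\<close>
  proof (cases "F = 0")
    case True
    have "(\<lambda>w. G w / w ^ n) has_fps_expansion 0"
      using G(1) True unfolding has_fps_expansion_def by (auto elim!: eventually_mono)
    then show ?thesis using True by (intro exI[of _ "\<lambda>w. G w / w ^ n"]) auto
  next
    case False
    then have "n \<le> subdegree F" using assms(2) by (metis nth_subdegree_nonzero not_le)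
    from has_fps_expansion_shift[OF G(1) this refl] show ?thesis
      by (intro exI[of _ "\<lambda>w. if w = 0 then fps_nth F n else G w / w ^ n"]) auto
  qed
  then obtain H where H: "H has_fps_expansion fps_shift n F" "\<And>w. w \<noteq> 0 \<Longrightarrow> H w = G w / w ^ n" by blast
  have H0: "H 0 = fps_nth F n" using has_fps_expansion_imp_0_eq_fps_nth_0[OF H(1)] by simp
  have "isCont H 0" by (rule has_fps_expansion_imp_continuous[OF H(1)])
  then have A: "((\<lambda>z. H (inverse z)) \<longlongrightarrow> H 0) at_infinity"
    by (rule isCont_tendsto_compose) (rule tendsto_inverse_0)
  have B: "eventually (\<lambda>z. H (inverse z) = f z * z ^ n) at_infinity"
    using G(2) eventually_nonzero_at_infinity
    by eventually_elim (simp add: H(2) power_inverse divide_inverse)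
  show ?thesis using A unfolding tendsto_cong[OF B] H0 .
qed

lemma expands_tendsto_0:
  "expands_at_infinity f F \<Longrightarrow> fps_nth F 0 = 0 \<Longrightarrow> (f \<longlongrightarrow> 0) at_infinity"
  using expands_tendsto_gen[of f F 0] by simp

lemma sector_le_at_infinity: "sector_at_infinity \<epsilon> \<le> at_infinity"
  by (simp add: sector_at_infinity_def)

lemma has_asymp_expansionI:
  assumes "expands_at_infinity f F" "real_fps F" "fps_nth F 0 = 0"
  shows "has_asymp_expansion f (\<lambda>j. - Re (fps_nth F (Suc j)))"
  unfolding has_asymp_expansion_def
proof (intro allI impI)
  fix \<epsilon> :: real and n :: nat
  let ?p = "\<lambda>z. (\<Sum>j\<le>n. of_real (- Re (fps_nth F (Suc j))) / z ^ (j + 1))"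
  let ?T = "\<Sum>j\<le>n. fps_const (fps_nth F (Suc j)) * fps_X ^ Suc j"
  have re: "of_real (Re (fps_nth F j)) = fps_nth F j" for j
    using assms(2) by (auto simp: real_fps_iff elim: Reals_cases)
  obtain G where G: "G has_fps_expansion F" "eventually (\<lambda>z. f z = G (inverse z)) at_infinity"
    using assms(1) by (auto simp: expands_at_infinity_def)
  have "(\<lambda>w. G w - (\<Sum>j\<le>n. fps_nth F (Suc j) * w ^ Suc j)) has_fps_expansion F - ?T"
    by (intro fps_expansion_intros G(1))
  moreover have "eventually (\<lambda>z. f z + ?p z = G (inverse z) - (\<Sum>j\<le>n. fps_nth F (Suc j) * inverse z ^ Suc j)) at_infinity"
    using G(2) by eventually_elim
      (simp add: re sum_negf divide_inverse power_inverse del: power_Suc)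
  ultimately have ex: "expands_at_infinity (\<lambda>z. f z + ?p z) (F - ?T)"
    unfolding expands_at_infinity_def by blast
  have T: "fps_nth ?T i = (if i = 0 \<or> i > Suc n then 0 else fps_nth F i)" for i
  proof -
    have "fps_nth ?T i = (\<Sum>j\<le>n. if i = Suc j then fps_nth F (Suc j) else 0)"
      by (simp add: fps_sum_nth fps_X_power_nth if_distrib[of "(*) _"] del: power_Suc cong: if_cong)
    also have "\<dots> = (if i = 0 \<or> i > Suc n then 0 else fps_nth F i)"
      by (cases i) auto
    finally show ?thesis .
  qed
  have "((\<lambda>z. (f z + ?p z) * z ^ (n + 1)) \<longlongrightarrow> fps_nth (F - ?T) (n + 1)) at_infinity"
    by (rule expands_tendsto_gen[OF ex]) (use assms(3) in \<open>simp add: fps_sub_nth T del: power_Suc\<close>)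
  then have "((\<lambda>z. (f z + ?p z) * z ^ (n + 1)) \<longlongrightarrow> 0) at_infinity"
    by (simp only: fps_sub_nth T) simp
  then have "((\<lambda>z. (f z + ?p z) / (1 / z ^ (n + 1))) \<longlongrightarrow> 0) at_infinity" by simp
  then have "(\<lambda>z. f z + ?p z) \<in> o[at_infinity](\<lambda>z. 1 / z ^ (n + 1))"
    by (rule smalloI_tendsto) (use eventually_nonzero_at_infinity in \<open>auto elim: eventually_mono\<close>)
  then show "(\<lambda>z. f z + ?p z) \<in> o[sector_at_infinity \<epsilon>](\<lambda>z. 1 / z ^ (n + 1))"
    by (rule landau_o.small.filter_mono[OF sector_le_at_infinity])
qed

text \<open>Expansions are required for all positive \<open>\<epsilon>\<close>, also those with an
  empty sector. Uniqueness needs one nontrivial filter; the sector for \<open>pi / 4\<close>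
  contains the positive imaginary axis.\<close>

lemma sector_nontrivial: "sector_at_infinity (pi / 4) \<noteq> bot"
proof
  assume bot: "sector_at_infinity (pi / 4) = bot"
  have "eventually (\<lambda>y::real. pi / 4 < Arg (\<i> * of_real y) \<and> Arg (\<i> * of_real y) < pi - pi / 4) at_top"
    using eventually_gt_at_top[of 0]
  proof eventually_elim
    case (elim y)
    then have e: "Arg (\<i> * of_real y) = pi / 2" by (simp only: Arg_times_of_real2 Arg_ii)
    show ?case unfolding e using pi_gt_zero by simp
  qed
  moreover have "filterlim (\<lambda>y::real. \<i> * of_real y) at_infinity at_top"
    by (rule tendsto_mult_filterlim_at_infinity[OF tendsto_const]) (auto intro: filterlim_of_real_at_infinity)
  ultimately have "filterlim (\<lambda>y::real. \<i> * of_real y) (sector_at_infinity (pi / 4)) at_top"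
    unfolding sector_at_infinity_def filterlim_inf filterlim_principal by simp
  then show False unfolding bot by (simp add: filterlim_def filtermap_bot_iff bot_unique)
qed

lemma has_asymp_expansion_unique:
  assumes "has_asymp_expansion f s" "has_asymp_expansion f s'"
  shows "s = s'"
proof
  fix n show "s n = s' n"
  proof (induction n rule: less_induct)
    case (less n)
    let ?S = "sector_at_infinity (pi / 4)"
    have "(\<lambda>z. f z + (\<Sum>j\<le>n. of_real (s j) / z ^ (j + 1))) \<in> o[?S](\<lambda>z. 1 / z ^ (n + 1))"
         "(\<lambda>z. f z + (\<Sum>j\<le>n. of_real (s' j) / z ^ (j + 1))) \<in> o[?S](\<lambda>z. 1 / z ^ (n + 1))"
      using assms pi_gt_zero unfolding has_asymp_expansion_def by simp_all
    from sum_in_smallo(2)[OF this]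
    have "(\<lambda>z. (f z + (\<Sum>j\<le>n. of_real (s j) / z ^ (j + 1))) - (f z + (\<Sum>j\<le>n. of_real (s' j) / z ^ (j + 1))))
        \<in> o[?S](\<lambda>z. 1 / z ^ (n + 1))" .
    moreover have "(f z + (\<Sum>j\<le>n. of_real (s j) / z ^ (j + 1))) - (f z + (\<Sum>j\<le>n. of_real (s' j) / z ^ (j + 1))) =
        of_real (s n - s' n) / z ^ (n + 1)" for z
    proof -
      have "(\<Sum>j\<in>{..<n}. complex_of_real (s j) / z ^ (j + 1)) = (\<Sum>j\<in>{..<n}. of_real (s' j) / z ^ (j + 1))"
        by (rule sum.cong) (use less in auto)
      then show ?thesis by (simp add: lessThan_Suc_atMost[symmetric] diff_divide_distrib del: power_Suc)
    qed
    ultimately have "(\<lambda>z. of_real (s n - s' n) / z ^ (n + 1)) \<in> o[?S](\<lambda>z. 1 / z ^ (n + 1))" by simp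
    from smalloD_tendsto[OF this]
    have "((\<lambda>z. of_real (s n - s' n) / z ^ (n + 1) / (1 / z ^ (n + 1))) \<longlongrightarrow> (0::complex)) ?S" .
    moreover have "eventually (\<lambda>z. of_real (s n - s' n) / z ^ (n + 1) / (1 / z ^ (n + 1)) = (of_real (s n - s' n) :: complex)) ?S"
      using filter_leD[OF sector_le_at_infinity eventually_nonzero_at_infinity] by eventually_elim simp
    ultimately have "((\<lambda>z::complex. of_real (s n - s' n)) \<longlongrightarrow> (0::complex)) ?S"
      by (rule Lim_transform_eventually)
    then show ?case using sector_nontrivial by (simp add: tendsto_const_iff)
  qed
qed

lemma asymp_coeffs_eq: "has_asymp_expansion f s \<Longrightarrow> asymp_coeffs f = s"
  unfolding asymp_coeffs_def by (rule the_equality) (auto dest: has_asymp_expansion_unique)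

lemma asymp_coeffs_expands:
  assumes "expands_at_infinity f F" "real_fps F" "fps_nth F 0 = 0"
  shows "asymp_coeffs f = (\<lambda>j. - Re (fps_nth F (Suc j)))"
  by (rule asymp_coeffs_eq[OF has_asymp_expansionI[OF assms]])

lemma first_coeff_expands:
  assumes "expands_at_infinity f F" "real_fps F" "fps_nth F 0 = 0" "F \<noteq> 0"
  shows "first_coeff f = - Re (fps_nth F (subdegree F))"
proof -
  have nz: "Re (fps_nth F j) = 0 \<longleftrightarrow> fps_nth F j = 0" for j
    using assms(2) by (auto simp: real_fps_iff complex_is_Real_iff complex_eq_iff)
  have sub: "subdegree F > 0" using assms(3,4) by (metis gr0I nth_subdegree_nonzero)
  have "(LEAST j. - Re (fps_nth F (Suc j)) \<noteq> 0) = subdegree F - 1"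
  proof (rule Least_equality)
    show "- Re (fps_nth F (Suc (subdegree F - 1))) \<noteq> 0" using sub assms(4) by (simp add: nz)
    fix j assume "- Re (fps_nth F (Suc j)) \<noteq> 0"
    then have "fps_nth F (Suc j) \<noteq> 0" by (simp add: nz)
    then have "subdegree F \<le> Suc j" by (rule subdegree_leI)
    then show "subdegree F - 1 \<le> j" by simp
  qed
  then show ?thesis using sub by (simp add: first_coeff_def asymp_coeffs_expands[OF assms(1-3)])
qed

lemma poly_tendsto_0_sector:
  fixes p :: "complex poly"
  assumes "((\<lambda>z. poly p z) \<longlongrightarrow> 0) F" "F \<le> at_infinity" "F \<noteq> bot"
  shows "p = 0"
proof (cases "degree p = 0")
  case True
  then obtain c where "p = [:c:]" by (auto elim: degree_eq_zeroE)
  then show ?thesis using assms(1,3) by (simp add: tendsto_const_iff)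
next
  case False
  then have "filterlim (poly p) at_infinity F"
    using filterlim_poly_at_infinity[of p] assms(2) by (metis filterlim_mono gr0I order_refl)
  then show ?thesis using assms(1,3) not_tendsto_and_filterlim_at_infinity by blast
qed

section \<open>Identifying the ingredients of a Schur step\<close>

lemma poly_part_eq:
  assumes "lead_coeff p = 1" "first_coeff f \<noteq> 0"
    and "((\<lambda>z. - 1 / f z - of_real (first_coeff f) * poly (map_poly of_real p) z) \<longlongrightarrow> 0) at_infinity"
  shows "poly_part f = p"
  unfolding poly_part_def
proof (rule the_equality)
  have "(\<lambda>z. - 1 / f z - of_real (first_coeff f) * poly (map_poly of_real p) z) \<in> o[at_infinity](\<lambda>z. 1)"
    by (rule smalloI_tendsto) (use assms(3) in auto)
  then show "lead_coeff p = 1 \<and> (\<forall>\<epsilon>>0. (\<lambda>z. - 1 / f z - of_real (first_coeff f) * poly (map_poly of_real p) z)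
       \<in> o[sector_at_infinity \<epsilon>](\<lambda>z. 1))"
    using assms(1) landau_o.small.filter_mono[OF sector_le_at_infinity] by blast
next
  fix q assume q: "lead_coeff q = 1 \<and> (\<forall>\<epsilon>>0. (\<lambda>z. - 1 / f z - of_real (first_coeff f) * poly (map_poly of_real q) z)
       \<in> o[sector_at_infinity \<epsilon>](\<lambda>z. 1))"
  let ?S = "sector_at_infinity (pi / 4)" and ?c = "complex_of_real (first_coeff f)"
  have "(\<lambda>z. - 1 / f z - ?c * poly (map_poly of_real q) z) \<in> o[?S](\<lambda>z. 1)" using q pi_gt_zero by simp
  from smalloD_tendsto[OF this] have 1: "((\<lambda>z. - 1 / f z - ?c * poly (map_poly of_real q) z) \<longlongrightarrow> 0) ?S" by simp
  have 2: "((\<lambda>z. - 1 / f z - ?c * poly (map_poly of_real p) z) \<longlongrightarrow> 0) ?S"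
    by (rule tendsto_mono[OF sector_le_at_infinity assms(3)])
  have "((\<lambda>z. poly (Polynomial.smult ?c (map_poly of_real p - map_poly of_real q)) z) \<longlongrightarrow> 0) ?S"
    using tendsto_diff[OF 1 2] by (simp add: algebra_simps)
  then have "Polynomial.smult ?c (map_poly of_real p - map_poly of_real q) = 0"
    by (rule poly_tendsto_0_sector[OF _ sector_le_at_infinity sector_nontrivial])
  then have "map_poly complex_of_real p = map_poly of_real q" using assms(2) by simp
  then have "complex_of_real (coeff p i) = of_real (coeff q i)" for i
    by (metis coeff_map_poly of_real_0)
  then show "q = p" by (simp add: poly_eq_iff)
qed

lemma schur_scale_eq:
  assumes "expands_at_infinity (schur_remainder f) F" "real_fps F" "fps_nth F 0 = 0" "F \<noteq> 0"
  shows "schur_scale f = sqrt \<bar>first_coeff (schur_remainder f)\<bar>"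
proof -
  let ?r = "first_coeff (schur_remainder f)"
  have r: "?r = - Re (fps_nth F (subdegree F))" by (rule first_coeff_expands[OF assms])
  have nz: "Re (fps_nth F j) = 0 \<longleftrightarrow> fps_nth F j = 0" for j
    using assms(2) by (auto simp: real_fps_iff complex_is_Real_iff complex_eq_iff)
  have r0: "?r \<noteq> 0" using assms(4) by (simp add: r nz)
  have fc: "first_coeff (\<lambda>z. schur_remainder f z / of_real (b\<^sup>2)) = ?r / b\<^sup>2" if "b > 0" for b
  proof -
    define k where "k = complex_of_real (1 / b\<^sup>2)"
    have k: "k \<noteq> 0" "k \<in> \<real>" "Re k = 1 / b\<^sup>2" "Im k = 0" using that by (auto simp: k_def)
    have e: "expands_at_infinity (\<lambda>z. schur_remainder f z / of_real (b\<^sup>2)) (fps_const k * F)"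
      by (rule expands_cong[OF expands_cmult[OF assms(1), of k]]) (simp add: k_def)
    have sd: "subdegree (fps_const k * F) = subdegree F"
      using subdegree_mult[of "fps_const k" F] k(1) assms(4) by simp
    show ?thesis
      by (subst first_coeff_expands[OF e real_fps_cmult[OF k(2) assms(2)]])
         (use k assms(3,4) sd r in auto)
  qed
  show ?thesis unfolding schur_scale_def
  proof (rule the_equality)
    have p: "sqrt \<bar>?r\<bar> > 0" using r0 by simp
    then show "sqrt \<bar>?r\<bar> > 0 \<and> normalized (\<lambda>z. schur_remainder f z / of_real ((sqrt \<bar>?r\<bar>)\<^sup>2))"
      using r0 unfolding normalized_def fc[OF p] by simp
  next
    fix b assume b: "b > 0 \<and> normalized (\<lambda>z. schur_remainder f z / of_real (b\<^sup>2))"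
    then have bp: "b > 0" by simp
    have "\<bar>?r / b\<^sup>2\<bar> = 1" using b unfolding normalized_def fc[OF bp] by (rule conjunct2)
    then have "\<bar>?r\<bar> = b\<^sup>2" using bp r0 by (simp add: abs_divide divide_eq_eq)
    then show "b = sqrt \<bar>?r\<bar>" using bp by simp
  qed
qed


section \<open>Pade approximants\<close>

text \<open>The reversed polynomial \<open>z ^ m * D (1 / z)\<close> is a polynomial in
  \<open>z\<close> that tends to \<open>0\<close> at infinity.\<close>

lemma poly_reciprocal_bigo_imp_0:
  fixes D :: "complex poly"
  assumes "degree D \<le> m" "(\<lambda>z. poly D (1 / z)) \<in> O[at_infinity](\<lambda>z. 1 / z ^ (m + 1))"
  shows "D = 0"
proof -
  define R where "R = (\<Sum>i\<le>m. monom (coeff D i) (m - i))"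
  have R: "poly R z = poly D (1 / z) * z ^ m" if "z \<noteq> 0" for z
  proof -
    have "poly D (1 / z) * z ^ m = (\<Sum>i\<le>m. coeff D i * (1 / z) ^ i) * z ^ m"
      unfolding poly_altdef
      by (intro arg_cong2[where f = "(*)"] refl sum.mono_neutral_left) (use assms(1) in \<open>auto simp: coeff_eq_0\<close>)
    also have "\<dots> = (\<Sum>i\<le>m. coeff D i * z ^ (m - i))"
      unfolding sum_distrib_right
      by (rule sum.cong) (use that in \<open>auto simp: power_diff power_divide\<close>)
    finally show ?thesis by (simp add: R_def poly_sum poly_monom)
  qed
  have ev: "eventually (\<lambda>z. poly R z = poly D (1 / z) * z ^ m) at_infinity"
    using eventually_nonzero_at_infinity by eventually_elim (rule R)
  have "(\<lambda>z. poly D (1 / z) * z ^ m) \<in> O[at_infinity](\<lambda>z. 1 / z ^ (m + 1) * z ^ m)"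
    by (intro landau_o.big.mult assms(2)) simp
  also have "(\<lambda>z::complex. 1 / z ^ (m + 1) * z ^ m) \<in> \<Theta>[at_infinity](\<lambda>z. inverse z)"
    by (rule bigthetaI_cong) (use eventually_nonzero_at_infinity in \<open>eventually_elim, auto simp: divide_inverse\<close>)
  also have "(\<lambda>z::complex. inverse z) \<in> o[at_infinity](\<lambda>z. 1)"
    by (rule smalloI_tendsto) (auto intro: tendsto_inverse_0)
  finally have "((\<lambda>z. poly D (1 / z) * z ^ m) \<longlongrightarrow> 0) at_infinity"
    using smalloD_tendsto by fastforce
  then have "((\<lambda>z. poly R z) \<longlongrightarrow> 0) at_infinity" unfolding tendsto_cong[OF ev] .
  then have "R = 0" by (rule poly_tendsto_0_sector) (auto simp: trivial_limit_at_infinity)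
  have "coeff D i = 0" for i
  proof (cases "i \<le> m")
    case True
    have "coeff R (m - i) = (\<Sum>k\<le>m. if k = i then coeff D k else 0)"
      unfolding R_def coeff_sum by (rule sum.cong) (use True in auto)
    then show ?thesis using True \<open>R = 0\<close> by simp
  next
    case False
    then show ?thesis using assms(1) by (intro coeff_eq_0) simp
  qed
  then show ?thesis by (simp add: poly_eq_iff)
qed

lemma finite_poly_reciprocal_roots:
  fixes B :: "complex poly"
  assumes "B \<noteq> 0" shows "finite {z. poly B (1 / z) = 0}"
proof -
  have "{z. poly B (1 / z) = 0} \<subseteq> insert 0 ((\<lambda>w. 1 / w) ` {w. poly B w = 0})"
  proof
    fix z assume "z \<in> {z. poly B (1 / z) = 0}"
    then show "z \<in> insert 0 ((\<lambda>w. 1 / w) ` {w. poly B w = 0})"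
      by (cases "z = 0") (auto intro!: image_eqI[of _ _ "1 / z"])
  qed
  then show ?thesis by (rule finite_subset) (simp add: poly_roots_finite[OF assms])
qed

lemma tendsto_poly_reciprocal: "((\<lambda>z. poly B (1 / z)) \<longlongrightarrow> poly B 0) at_infinity" for B :: "complex poly"
  using isCont_tendsto_compose[OF _ tendsto_inverse_0, of "poly B"] by (simp add: divide_inverse)

text \<open>For two admissible pairs the cross difference \<open>A' * B - A * B'\<close> has degree
  at most \<open>L + M\<close> in \<open>1 / z\<close> and order \<open>L + M + 1\<close>, so it
  vanishes. The quotients then agree off finitely many points, which \<open>sphere_ext\<close> does
  not see.\<close>

lemma pade_approximantI:
  fixes A B :: "complex poly"
  assumes AB: "degree A \<le> L" "degree B \<le> M" "poly B 0 \<noteq> 0"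
    "(\<lambda>z. (\<Sum>j<L + M. of_real (s j) / z ^ (j + 1)) + poly A (1 / z) / poly B (1 / z))
       \<in> O[at_infinity](\<lambda>z. 1 / z ^ (L + M + 1))"
  shows "pade_approximant s L M = sphere_ext (\<lambda>z. poly A (1 / z) / poly B (1 / z))"
  unfolding pade_approximant_def
proof (rule the_equality)
  show "\<exists>A' B'. degree A' \<le> L \<and> degree B' \<le> M \<and> poly B' 0 \<noteq> 0 \<and>
    (\<lambda>z. (\<Sum>j<L + M. of_real (s j) / z ^ (j + 1)) + poly A' (1 / z) / poly B' (1 / z))
       \<in> O[at_infinity](\<lambda>z. 1 / z ^ (L + M + 1)) \<and>
    sphere_ext (\<lambda>z. poly A (1 / z) / poly B (1 / z)) = sphere_ext (\<lambda>z. poly A' (1 / z) / poly B' (1 / z))"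
    using AB by blast
next
  fix R assume "\<exists>A' B'. degree A' \<le> L \<and> degree B' \<le> M \<and> poly B' 0 \<noteq> 0 \<and>
    (\<lambda>z. (\<Sum>j<L + M. of_real (s j) / z ^ (j + 1)) + poly A' (1 / z) / poly B' (1 / z))
       \<in> O[at_infinity](\<lambda>z. 1 / z ^ (L + M + 1)) \<and>
    R = sphere_ext (\<lambda>z. poly A' (1 / z) / poly B' (1 / z))"
  then obtain A' B' where AB': "degree A' \<le> L" "degree B' \<le> M" "poly B' 0 \<noteq> 0"
    "(\<lambda>z. (\<Sum>j<L + M. of_real (s j) / z ^ (j + 1)) + poly A' (1 / z) / poly B' (1 / z))
       \<in> O[at_infinity](\<lambda>z. 1 / z ^ (L + M + 1))"
    and R: "R = sphere_ext (\<lambda>z. poly A' (1 / z) / poly B' (1 / z))" by blast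
  have nz: "B \<noteq> 0" "B' \<noteq> 0" using AB(3) AB'(3) by auto
  define D where "D = A' * B - A * B'"
  have degD: "degree D \<le> L + M"
    unfolding D_def
    by (rule degree_diff_le; rule order_trans[OF degree_mult_le]) (use AB AB' in linarith)+
  have b0: "eventually (\<lambda>z. poly C (1 / z) \<noteq> 0) at_infinity" if "poly C 0 \<noteq> 0" for C :: "complex poly"
    using tendsto_imp_eventually_ne[OF tendsto_poly_reciprocal that] .
  have bO: "(\<lambda>z. poly C (1 / z)) \<in> O[at_infinity](\<lambda>_. 1)" for C :: "complex poly"
    by (rule bigoI_tendsto[where c = "poly C 0"]) (auto intro: tendsto_poly_reciprocal)
  have "(\<lambda>z. poly A' (1 / z) / poly B' (1 / z) - poly A (1 / z) / poly B (1 / z))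
      \<in> O[at_infinity](\<lambda>z. 1 / z ^ (L + M + 1))"
    using sum_in_bigo(2)[OF AB'(4) AB(4)] by (simp add: algebra_simps)
  from landau_o.big.mult[OF landau_o.big.mult[OF this bO[of B]] bO[of B']]
  have "(\<lambda>z. (poly A' (1 / z) / poly B' (1 / z) - poly A (1 / z) / poly B (1 / z)) * poly B (1 / z) * poly B' (1 / z))
      \<in> O[at_infinity](\<lambda>z. 1 / z ^ (L + M + 1))" by simp
  moreover have "eventually (\<lambda>z. (poly A' (1 / z) / poly B' (1 / z) - poly A (1 / z) / poly B (1 / z)) * poly B (1 / z) * poly B' (1 / z)
      = poly D (1 / z)) at_infinity"
    using b0[OF AB(3)] b0[OF AB'(3)]
  proof eventually_elim
    case (elim z)
    have "(a' / b' - a / b) * b * b' = a' * b - a * b'" if "b \<noteq> 0" "b' \<noteq> 0" for a a' b b' :: complex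
      using that by (simp add: field_simps)
    from this[OF elim] show ?case by (simp only: D_def poly_diff poly_mult)
  qed
  ultimately have "(\<lambda>z. poly D (1 / z)) \<in> O[at_infinity](\<lambda>z. 1 / z ^ (L + M + 1))"
    by (subst (asm) landau_o.big.in_cong)
  then have "D = 0" by (rule poly_reciprocal_bigo_imp_0[OF degD])
  have "poly A' w * poly B w = poly A w * poly B' w" for w
  proof -
    have "poly D w = 0" using \<open>D = 0\<close> by simp
    then show ?thesis by (simp add: D_def)
  qed
  then have "poly A' w / poly B' w = poly A w / poly B w" if "poly B w \<noteq> 0" "poly B' w \<noteq> 0" for w
    using that by (simp only: frac_eq_eq not_False_eq_True)
  then have "{z. poly A' (1 / z) / poly B' (1 / z) \<noteq> poly A (1 / z) / poly B (1 / z)} \<subseteq>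
      {z. poly B (1 / z) = 0} \<union> {z. poly B' (1 / z) = 0}"
    by blast
  then have "finite {z. poly A' (1 / z) / poly B' (1 / z) \<noteq> poly A (1 / z) / poly B (1 / z)}"
    by (rule finite_subset) (simp add: finite_poly_reciprocal_roots nz)
  then show "R = sphere_ext (\<lambda>z. poly A (1 / z) / poly B (1 / z))"
    unfolding R by (rule sphere_ext_cong_finite)
qed

text \<open>Convergence at the finitely many centres of a net is uniform, and the common Lipschitz
  constant carries it over the balls, with an error of at most \<open>e / 3\<close> on either
  side.\<close>

lemma pointwise_imp_uniform_limit_lipschitz:
  fixes f :: "nat \<Rightarrow> 'a::metric_space \<Rightarrow> 'b::metric_space"
  assumes "compact T" "\<And>x. x \<in> T \<Longrightarrow> (\<lambda>n. f n x) \<longlonglongrightarrow> g x"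
    and L: "\<And>n x y. x \<in> T \<Longrightarrow> y \<in> T \<Longrightarrow> dist (f n x) (f n y) \<le> L * dist x y"
      "\<And>x y. x \<in> T \<Longrightarrow> y \<in> T \<Longrightarrow> dist (g x) (g y) \<le> L * dist x y"
  shows "uniform_limit T f g sequentially"
proof (rule uniform_limitI)
  fix e :: real assume e: "e > 0"
  define d where "d = e / (3 * (\<bar>L\<bar> + 1))"
  have d: "d > 0" using e by (simp add: d_def add_pos_nonneg)
  have Ld: "L * r \<le> e / 3" if "0 \<le> r" "r < d" for r
  proof -
    have "L * r \<le> (\<bar>L\<bar> + 1) * d" using that by (intro mult_mono) auto
    also have "\<dots> = e / 3" unfolding d_def using abs_ge_zero[of L] by (simp add: field_simps)
    finally show ?thesis .
  qed
  obtain k where k: "k \<subseteq> T" "finite k" "T \<subseteq> (\<Union>x\<in>k. ball x d)"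
    by (rule compactE_image[OF assms(1), of T "\<lambda>x. ball x d"]) (use d in auto)
  have "eventually (\<lambda>n. \<forall>x\<in>k. dist (f n x) (g x) < e / 3) sequentially"
    by (rule eventually_ball_finite[OF k(2)]) (use k(1) tendstoD[OF assms(2), of _ "e / 3"] e in auto)
  then show "eventually (\<lambda>n. \<forall>x\<in>T. dist (f n x) (g x) < e) sequentially"
  proof eventually_elim
    case (elim n)
    show ?case
    proof
      fix y assume y: "y \<in> T"
      then obtain x where x: "x \<in> k" "dist x y < d" using k(3) by auto
      have "dist (f n y) (g y) \<le> dist (f n y) (f n x) + dist (f n x) (g x) + dist (g x) (g y)"
        using dist_triangle[of "f n y" "g y" "f n x"] dist_triangle[of "f n x" "g y" "g x"] by linarith
      moreover have "dist (f n y) (f n x) \<le> e / 3"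
        using L(1)[of y x n] Ld[of "dist x y"] x y k(1) by (force simp: dist_commute)
      moreover have "dist (g x) (g y) \<le> e / 3"
        using L(2)[of x y] Ld[of "dist x y"] x y k(1) by force
      moreover have "dist (f n x) (g x) < e / 3" using elim x by blast
      ultimately show "dist (f n y) (g y) < e" by linarith
    qed
  qed
qed

text \<open>At \<open>t = 0\<close> this is \<open>0\<close> for every \<open>z\<close>, by
  \<open>x / 0 = 0\<close> also for \<open>z = 0\<close>. So the node \<open>0\<close> produces no
  pole and can be carried along in all sums.\<close>

definition t_kernel :: "real \<Rightarrow> complex \<Rightarrow> complex" where
  "t_kernel t z = of_real t / (of_real t - z)"

lemma t_kernel_0 [simp]: "t_kernel 0 z = 0" by (simp add: t_kernel_def)

lemma t_kernel_expand:
  assumes "z \<noteq> 0" "z \<noteq> of_real t"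
  shows "t_kernel t z = (of_real t / z) ^ m * t_kernel t z - (\<Sum>j<m. of_real (t ^ (j + 1)) / z ^ (j + 1))"
proof (induction m)
  case (Suc m)
  have "of_real t - z \<noteq> 0" using assms by auto
  then have "t_kernel t z + of_real t / z = of_real t / z * t_kernel t z" using assms(1)
    by (simp add: t_kernel_def divide_simps) (simp add: algebra_simps)
  then have "(of_real t / z) ^ Suc m * t_kernel t z = (of_real t / z) ^ m * (t_kernel t z + of_real t / z)"
    by simp
  also have "\<dots> = (of_real t / z) ^ m * t_kernel t z + of_real (t ^ (m + 1)) / z ^ (m + 1)"
    by (simp add: distrib_left power_divide add_divide_distrib mult_ac)
  finally show ?case using Suc.IH by (simp add: algebra_simps)
qed simp

lemma norm_t_kernel_diff_le:
  assumes "\<delta> > 0" "t = 0 \<or> \<delta> \<le> cmod (of_real t - z) \<and> \<delta> \<le> cmod (of_real t - z')" "\<bar>t\<bar> \<le> M"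
  shows "cmod (t_kernel t z - t_kernel t z') \<le> M / \<delta>\<^sup>2 * cmod (z - z')"
proof (cases "t = 0")
  case True
  then show ?thesis using assms by simp
next
  case False
  then have d: "\<delta> \<le> cmod (of_real t - z)" "\<delta> \<le> cmod (of_real t - z')" using assms(2) by auto
  then have nz: "of_real t - z \<noteq> 0" "of_real t - z' \<noteq> 0" using assms(1) by auto
  have "t_kernel t z - t_kernel t z' = of_real t * (z - z') / ((of_real t - z) * (of_real t - z'))"
    using nz by (simp add: t_kernel_def divide_simps) (simp add: algebra_simps)
  then have "cmod (t_kernel t z - t_kernel t z') = \<bar>t\<bar> * cmod (z - z') / (cmod (of_real t - z) * cmod (of_real t - z'))"
    by (simp add: norm_mult norm_divide)
  also have "\<dots> \<le> M * cmod (z - z') / (\<delta> * \<delta>)"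
    using assms d by (intro frac_le mult_mono) auto
  finally show ?thesis by (simp add: power2_eq_square)
qed

lemma norm_t_kernel_le:
  assumes "\<bar>t\<bar> \<le> M" "M < cmod z"
  shows "cmod (t_kernel t z) \<le> M / (cmod z - M)"
proof -
  have "cmod z - M \<le> cmod (of_real t - z)"
    using norm_triangle_ineq2[of z "of_real t"] assms(1) by (simp add: norm_minus_commute)
  then show ?thesis unfolding t_kernel_def norm_divide norm_of_real using assms by (intro frac_le) auto
qed

text \<open>The nodes lie in \<open>insert 0 K\<close>. For \<open>z = 0\<close> the kernel jumps at
  \<open>t = 0\<close>, but then \<open>0\<close> is outside the closed set \<open>K\<close> and
  isolated in \<open>insert 0 K\<close>.\<close>

lemma continuous_t_kernel:
  assumes "closed K" "z \<notin> of_real ` K"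
  shows "continuous_on (insert 0 K) (\<lambda>t. t_kernel t z)"
proof -
  have "continuous_on K (\<lambda>t. t_kernel t z)" unfolding t_kernel_def
    by (intro continuous_intros) (use assms(2) in auto)
  then have "continuous_on ({0} \<union> K) (\<lambda>t. t_kernel t z)"
    by (intro continuous_on_closed_Un assms) auto
  then show ?thesis by simp
qed

lemma t_kernel_measurable [measurable]: "(\<lambda>t. t_kernel t z) \<in> borel_measurable borel"
  unfolding t_kernel_def by measurable

context two_interval_measure begin

section \<open>The approximants as quadrature sums\<close>

definition FF where "FF z = (LINT t|\<sigma>. t_kernel t z)"
definition R where "R n z = (\<Sum>x\<in>S n. of_real (W n x) * t_kernel x z)"
definition mass where "mass = measure \<sigma> UNIV"

lemma mass_eq_I: "I 1 = mass" by (simp add: I_def mass_def)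

lemma sum_W: "(\<Sum>x\<in>S n. W n x) = mass"
  using quadrature[of 1 n] by (simp add: mass_eq_I)

lemma mass_nonneg: "mass \<ge> 0" by (simp add: mass_def)

lemma norm_sum_W_le:
  fixes f :: "real \<Rightarrow> 'b::real_normed_field"
  assumes "\<And>x. x \<in> S n \<Longrightarrow> norm (f x) \<le> B"
  shows "norm (\<Sum>x\<in>S n. of_real (W n x) * f x) \<le> B * mass"
proof -
  have "norm (\<Sum>x\<in>S n. of_real (W n x) * f x) \<le> (\<Sum>x\<in>S n. W n x * B)"
  proof (rule sum_norm_le)
    fix x assume "x \<in> S n"
    then show "norm (of_real (W n x) * f x) \<le> W n x * B"
      using assms[of x] W_pos[of x n] by (simp add: norm_mult)
  qed
  also have "\<dots> = B * mass" by (simp add: sum_W[of n, symmetric] sum_distrib_left mult.commute)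
  finally show ?thesis .
qed

lemma s_quadrature: "j < 2 * n \<Longrightarrow> s j = (\<Sum>x\<in>S n. W n x * x ^ (j + 1))"
  unfolding s_eq by (subst quadrature[of _ n]) (auto simp: degree_monom_eq poly_monom)

text \<open>The moment \<open>s j\<close> with \<open>j < m\<close> is the integral of
  \<open>t ^ (j + 1)\<close>, of degree at most \<open>2 n\<close>, so the quadrature reproduces
  it.\<close>

lemma R_expand:
  assumes "z \<noteq> 0" "z \<notin> of_real ` S n" "m \<le> 2 * n"
  shows "R n z + (\<Sum>j<m. of_real (s j) / z ^ (j + 1)) = (\<Sum>x\<in>S n. of_real (W n x) * ((of_real x / z) ^ m * t_kernel x z))"
proof -
  have "R n z = (\<Sum>x\<in>S n. of_real (W n x) * ((of_real x / z) ^ m * t_kernel x z - (\<Sum>j<m. of_real (x ^ (j + 1)) / z ^ (j + 1))))"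
    unfolding R_def
  proof (rule sum.cong[OF refl])
    fix x assume "x \<in> S n"
    then have "z \<noteq> of_real x" using assms(2) by auto
    from t_kernel_expand[OF assms(1) this, of m]
    show "of_real (W n x) * t_kernel x z = of_real (W n x) * ((of_real x / z) ^ m * t_kernel x z - (\<Sum>j<m. of_real (x ^ (j + 1)) / z ^ (j + 1)))"
      by (rule arg_cong)
  qed
  also have "\<dots> = (\<Sum>x\<in>S n. of_real (W n x) * ((of_real x / z) ^ m * t_kernel x z)) -
      (\<Sum>x\<in>S n. \<Sum>j<m. of_real (W n x) * (of_real (x ^ (j + 1)) / z ^ (j + 1)))"
    by (simp add: right_diff_distrib sum_subtractf sum_distrib_left)
  also have "(\<Sum>x\<in>S n. \<Sum>j<m. of_real (W n x) * (of_real (x ^ (j + 1)) / z ^ (j + 1))) =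
      (\<Sum>j<m. of_real (s j) / z ^ (j + 1))"
    unfolding sum.swap[of _ "{..<m}"]
    by (rule sum.cong) (use assms(3) in \<open>auto simp: s_quadrature[of _ n] sum_divide_distrib\<close>)
  finally show ?thesis by simp
qed

lemma integrable_t_kernel:
  assumes "z \<notin> of_real ` E"
  shows "integrable \<sigma> (\<lambda>t. t_kernel t z)"
  by (rule integrable_continuous[OF t_kernel_measurable])
     (rule continuous_on_subset[OF continuous_t_kernel[OF compact_imp_closed[OF compact_E] assms]], auto)

lemma FF_expand:
  assumes "z \<noteq> 0" "z \<notin> of_real ` E"
  shows "FF z + (\<Sum>j<m. of_real (s j) / z ^ (j + 1)) = (LINT t|\<sigma>. (of_real t / z) ^ m * t_kernel t z)"
proof -
  have 1: "integrable \<sigma> (\<lambda>t. complex_of_real (t ^ (j + 1)) / z ^ (j + 1))" for j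
    by (rule integrable_continuous) (use assms(1) in \<open>auto intro!: borel_measurable_continuous_onI continuous_intros\<close>)
  have 2: "(LINT t|\<sigma>. complex_of_real (t ^ (j + 1)) / z ^ (j + 1)) = of_real (s j) / z ^ (j + 1)" for j
    unfolding s_def by (simp only: integral_divide_zero integral_complex_of_real)
  have "(LINT t|\<sigma>. (of_real t / z) ^ m * t_kernel t z) = (LINT t|\<sigma>. t_kernel t z + (\<Sum>j<m. of_real (t ^ (j + 1)) / z ^ (j + 1)))"
  proof (rule integral_cong_AE)
    show "AE t in \<sigma>. (of_real t / z) ^ m * t_kernel t z = t_kernel t z + (\<Sum>j<m. of_real (t ^ (j + 1)) / z ^ (j + 1))"
      using AE_E
    proof eventually_elim
      case (elim t)
      then have "z \<noteq> of_real t" using assms(2) by auto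
      from t_kernel_expand[OF assms(1) this, of m] show ?case by (simp only: algebra_simps)
    qed
  qed (unfold t_kernel_def, measurable)
  also have "\<dots> = FF z + (\<Sum>j<m. of_real (s j) / z ^ (j + 1))"
    by (subst Bochner_Integration.integral_add[OF integrable_t_kernel[OF assms(2)] Bochner_Integration.integrable_sum[OF 1]])
       (simp only: FF_def 2 Bochner_Integration.integral_sum[OF 1])
  finally show ?thesis ..
qed

text \<open>By \<open>R_expand\<close> with \<open>m = n + n\<close> the error is a sum of kernels
  times \<open>(x / z) ^ (n + n)\<close>, and each kernel is itself of order
  \<open>1 / z\<close>.\<close>

lemma pade_eq:
  assumes "p0 n \<noteq> 0"
  shows "pade_approximant s n n = sphere_ext (R n)"
proof -
  define T where "T = S n - {0}"
  have T: "finite T" "card T = n" using finite_S card_S zero_in_S[OF assms] by (auto simp: T_def)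
  \<comment> \<open>In \<open>w = 1 / z\<close> the kernel is \<open>x * w / (x * w - 1)\<close>.
    Without the node \<open>0\<close> there are \<open>n\<close> such denominators, and each has the
    value \<open>- 1\<close> at \<open>w = 0\<close>.\<close>
  define B :: "complex poly" where "B = (\<Prod>x\<in>T. [:- 1, of_real x:])"
  define B' :: "real \<Rightarrow> complex poly" where "B' x = (\<Prod>y\<in>T - {x}. [:- 1, of_real y:])" for x
  define A :: "complex poly" where "A = (\<Sum>x\<in>T. Polynomial.smult (of_real (W n x * x)) ([:0, 1:] * B' x))"
  have deg: "degree (\<Prod>x\<in>X. [:- 1, of_real x :: complex:]) \<le> card X" if "finite X" for X
  proof -
    have "degree (\<Prod>x\<in>X. [:- 1, of_real x :: complex:]) \<le> sum (degree \<circ> (\<lambda>x. [:- 1, of_real x :: complex:])) X"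
      by (rule degree_prod_sum_le[OF that])
    also have "\<dots> \<le> (\<Sum>x\<in>X. 1)" by (rule sum_mono) simp
    finally show ?thesis by simp
  qed
  have degB: "degree B \<le> n" using deg[OF T(1)] T(2) by (simp add: B_def)
  have degA: "degree A \<le> n"
    unfolding A_def
  proof (rule degree_sum_le[OF T(1)])
    fix x assume x: "x \<in> T"
    have "degree (B' x) \<le> n - 1" using deg[of "T - {x}"] T x by (simp add: B'_def)
    moreover have "n > 0" using T x by (auto simp: card_gt_0_iff)
    ultimately have "degree ([:0, 1:] * B' x) \<le> n"
      using degree_mult_le[of "[:0, 1:]" "B' x"] by simp
    then show "degree (Polynomial.smult (of_real (W n x * x)) ([:0, 1:] * B' x)) \<le> n"
      by (rule order_trans[OF degree_smult_le])
  qed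
  have B0: "poly B 0 \<noteq> 0" using T(1) by (simp add: B_def poly_prod)
  have AB: "poly A (1 / z) / poly B (1 / z) = R n z" if "z \<notin> insert 0 (of_real ` S n)" for z
  proof -
    have nz: "of_real x - z \<noteq> 0" if "x \<in> T" for x using \<open>z \<notin> _\<close> that by (auto simp: T_def)
    have nz': "1 / z * of_real x - 1 \<noteq> 0" if "x \<in> T" for x
      using nz[OF that] \<open>z \<notin> _\<close> by (auto simp: field_simps)
    have "poly A (1 / z) / poly B (1 / z) = (\<Sum>x\<in>T. of_real (W n x * x) * (1 / z * poly (B' x) (1 / z)) / poly B (1 / z))"
      by (simp add: A_def poly_sum sum_divide_distrib)
    also have "\<dots> = (\<Sum>x\<in>T. of_real (W n x) * t_kernel x z)"
    proof (rule sum.cong[OF refl])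
      fix x assume x: "x \<in> T"
      have "poly B (1 / z) = (1 / z * of_real x - 1) * poly (B' x) (1 / z)"
      proof -
        have "poly [:- 1, of_real y:] (1 / z) = 1 / z * of_real y - 1" for y by simp
        then show ?thesis by (simp only: B_def B'_def poly_mult poly_prod prod.remove[OF T(1) x])
      qed
      moreover have "poly (B' x) (1 / z) \<noteq> 0"
        unfolding B'_def poly_prod using T(1) nz' by (auto simp: mult.commute)
      ultimately have "of_real (W n x * x) * (1 / z * poly (B' x) (1 / z)) / poly B (1 / z) =
          of_real (W n x * x) * (1 / z) / (1 / z * of_real x - 1)" by simp
      also have "\<dots> = of_real (W n x) * t_kernel x z"
        using nz[OF x] nz'[OF x] \<open>z \<notin> _\<close> by (simp add: t_kernel_def divide_simps)
      finally show "of_real (W n x * x) * (1 / z * poly (B' x) (1 / z)) / poly B (1 / z) = of_real (W n x) * t_kernel x z" .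
    qed
    also have "\<dots> = R n z" unfolding R_def T_def
      using finite_S by (intro sum.mono_neutral_left) auto
    finally show ?thesis .
  qed
  have fin: "finite (insert 0 (complex_of_real ` S n))" using finite_S by simp
  have ev: "eventually (\<lambda>z. z \<notin> insert 0 (complex_of_real ` S n)) at_infinity"
  proof -
    have "bounded (insert 0 (complex_of_real ` S n))" using fin by (rule finite_imp_bounded)
    then obtain b where "\<forall>z\<in>insert 0 (complex_of_real ` S n). norm z \<le> b" unfolding bounded_iff by blast
    then show ?thesis unfolding eventually_at_infinity by (intro exI[of _ "b + 1"]) force
  qed
  have O: "(\<lambda>z. \<Sum>x\<in>S n. of_real (W n x) * ((of_real x / z) ^ (n + n) * t_kernel x z)) \<in> O[at_infinity](\<lambda>z. 1 / z ^ (n + n + 1))"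
  proof (rule big_sum_in_bigo)
    fix x assume "x \<in> S n"
    have h: "((\<lambda>z. complex_of_real x / z) \<longlongrightarrow> 0) at_infinity"
      using tendsto_mult_right_zero[OF tendsto_inverse_0, of "complex_of_real x"] by (simp add: divide_inverse)
    have "((\<lambda>z. of_real x / (of_real x / z - 1)) \<longlongrightarrow> complex_of_real x / (0 - 1)) at_infinity"
      by (intro tendsto_divide tendsto_diff tendsto_const h) auto
    then have "((\<lambda>z. of_real (W n x) * of_real x ^ (n + n) * (of_real x / (of_real x / z - 1))) \<longlongrightarrow>
       of_real (W n x) * of_real x ^ (n + n) * (complex_of_real x / (0 - 1))) at_infinity"
      by (rule tendsto_mult[OF tendsto_const])
    moreover have "eventually (\<lambda>z. of_real (W n x) * of_real x ^ (n + n) * (of_real x / (of_real x / z - 1)) =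
       of_real (W n x) * ((of_real x / z) ^ (n + n) * t_kernel x z) / (1 / z ^ (n + n + 1))) at_infinity"
      using eventually_nonzero_at_infinity ev
    proof eventually_elim
      case (elim z)
      then have "of_real x - z \<noteq> 0" using \<open>x \<in> S n\<close> by auto
      then have "of_real x / (of_real x / z - 1) = z * t_kernel x z"
        using elim by (simp add: t_kernel_def divide_simps)
      then show ?case using elim by (simp add: power_divide)
    qed
    ultimately have "((\<lambda>z. of_real (W n x) * ((of_real x / z) ^ (n + n) * t_kernel x z) / (1 / z ^ (n + n + 1))) \<longlongrightarrow>
       of_real (W n x) * of_real x ^ (n + n) * (complex_of_real x / (0 - 1))) at_infinity"
      by (rule Lim_transform_eventually)
    then show "(\<lambda>z. of_real (W n x) * ((of_real x / z) ^ (n + n) * t_kernel x z)) \<in> O[at_infinity](\<lambda>z. 1 / z ^ (n + n + 1))"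
      by (rule bigoI_tendsto) (use eventually_nonzero_at_infinity in \<open>auto elim: eventually_mono\<close>)
  qed
  have "eventually (\<lambda>z. (\<Sum>j<n + n. of_real (s j) / z ^ (j + 1)) + poly A (1 / z) / poly B (1 / z) =
      (\<Sum>x\<in>S n. of_real (W n x) * ((of_real x / z) ^ (n + n) * t_kernel x z))) at_infinity"
    using ev
  proof eventually_elim
    case (elim z)
    then show ?case using R_expand[of z n "n + n"] AB[of z] by (simp add: add.commute)
  qed
  from landau_o.big.in_cong[OF this, THEN iffD2, OF O]
  have "(\<lambda>z. (\<Sum>j<n + n. of_real (s j) / z ^ (j + 1)) + poly A (1 / z) / poly B (1 / z))
       \<in> O[at_infinity](\<lambda>z. 1 / z ^ (n + n + 1))" .
  from pade_approximantI[OF degA degB B0 this]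
  have "pade_approximant s n n = sphere_ext (\<lambda>z. poly A (1 / z) / poly B (1 / z))" .
  also have "\<dots> = sphere_ext (R n)"
    by (rule sphere_ext_cong_finite, rule finite_subset[OF _ fin]) (use AB in blast)
  finally show ?thesis .
qed

lemma R_ext:
  assumes "z \<notin> of_real ` (S n - {0})"
  shows "sphere_ext (R n) (Fin z) = Fin (R n z)"
proof (rule sphere_ext_Fin)
  show "(R n \<longlongrightarrow> R n z) (at z)"
    unfolding R_def
  proof (rule tendsto_sum, rule tendsto_mult[OF tendsto_const])
    fix x assume x: "x \<in> S n"
    show "(t_kernel x \<longlongrightarrow> t_kernel x z) (at z)"
    proof (cases "x = 0")
      case True
      then show ?thesis by (simp add: t_kernel_0[abs_def])
    next
      case False
      then have "of_real x - z \<noteq> 0" using assms x by auto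
      then show ?thesis unfolding t_kernel_def by (intro tendsto_intros)
    qed
  qed
qed

lemma FF_lipschitz:
  assumes "\<delta> > 0" "\<And>t. t \<in> E \<Longrightarrow> \<delta> \<le> cmod (of_real t - z)" "\<And>t. t \<in> E \<Longrightarrow> \<delta> \<le> cmod (of_real t - z')"
  shows "cmod (FF z - FF z') \<le> 1 / \<delta>\<^sup>2 * cmod (z - z') * mass"
proof -
  have "z \<notin> of_real ` E" "z' \<notin> of_real ` E" using assms by fastforce+
  then have "FF z - FF z' = (LINT t|\<sigma>. t_kernel t z - t_kernel t z')"
    using integrable_t_kernel by (simp add: FF_def)
  also have "cmod \<dots> \<le> 1 / \<delta>\<^sup>2 * cmod (z - z') * mass"
    unfolding mass_def
    by (rule integral_norm_bound) (use assms norm_t_kernel_diff_le[of \<delta> _ z z' 1] E_bounded in auto)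
  finally show ?thesis .
qed

lemma FF_ext:
  assumes "z \<notin> of_real ` E"
  shows "sphere_ext FF (Fin z) = Fin (FF z)"
proof (rule sphere_ext_Fin)
  have "closed (complex_of_real ` E)"
    by (intro compact_imp_closed compact_continuous_image compact_E continuous_intros)
  from separate_point_closed[OF this assms] obtain d
    where d: "d > 0" "\<And>t. t \<in> E \<Longrightarrow> d \<le> dist z (of_real t)" by auto
  have lip: "cmod (FF w - FF z) \<le> 1 / (d / 2)\<^sup>2 * mass * cmod (w - z)" if "dist w z < d / 2" for w
  proof -
    have "cmod (FF w - FF z) \<le> 1 / (d / 2)\<^sup>2 * cmod (w - z) * mass"
    proof (rule FF_lipschitz)
      fix t assume "t \<in> E"
      then have "d \<le> dist z (of_real t)" by (rule d(2))
      then show "d / 2 \<le> cmod (of_real t - w)" "d / 2 \<le> cmod (of_real t - z)"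
        using that d(1) dist_triangle[of z "of_real t" w] by (auto simp: dist_norm norm_minus_commute)
    qed (use d in simp)
    then show ?thesis by (simp add: mult_ac)
  qed
  have "((\<lambda>w. FF w - FF z) \<longlongrightarrow> 0) (at z)"
  proof (rule Lim_null_comparison)
    show "eventually (\<lambda>w. cmod (FF w - FF z) \<le> 1 / (d / 2)\<^sup>2 * mass * cmod (w - z)) (at z)"
      unfolding eventually_at using lip d(1) by (intro exI[of _ "d / 2"]) auto
    have "((\<lambda>w. 1 / (d / 2)\<^sup>2 * mass * cmod (w - z)) \<longlongrightarrow> 1 / (d / 2)\<^sup>2 * mass * cmod (z - z)) (at z)"
      by (intro tendsto_intros)
    then show "((\<lambda>w. 1 / (d / 2)\<^sup>2 * mass * cmod (w - z)) \<longlongrightarrow> 0) (at z)" by simp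
  qed
  then show "(FF \<longlongrightarrow> FF z) (at z)" by (simp add: LIM_zero_iff)
qed

lemma norm_FF_le: "1 < cmod z \<Longrightarrow> cmod (FF z) \<le> 1 / (cmod z - 1) * mass"
  unfolding FF_def mass_def by (rule integral_norm_bound) (use norm_t_kernel_le[of _ 1] E_bounded in auto)

lemma norm_R_le:
  assumes "\<And>x. x \<in> S n \<Longrightarrow> \<bar>x\<bar> \<le> M" "M < cmod z"
  shows "cmod (R n z) \<le> M / (cmod z - M) * mass"
  unfolding R_def by (rule norm_sum_W_le) (use norm_t_kernel_le assms in auto)

lemma tendsto_inverse_norm_at_infinity: "((\<lambda>z::complex. M / (cmod z - M) * m) \<longlongrightarrow> 0) at_infinity"
proof -
  have "filterlim (\<lambda>z::complex. - M + cmod z) at_top at_infinity"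
    by (rule filterlim_tendsto_add_at_top[OF tendsto_const filterlim_norm_at_top])
  then have "((\<lambda>z::complex. M / (- M + cmod z)) \<longlongrightarrow> 0) at_infinity"
    by (intro real_tendsto_divide_at_top[OF tendsto_const])
  from tendsto_mult_left_zero[OF this, of m] show ?thesis by simp
qed

lemma FF_ext_Infty: "sphere_ext FF Infty = Fin 0"
proof (rule sphere_ext_Infty, rule Lim_null_comparison[OF _ tendsto_inverse_norm_at_infinity])
  show "eventually (\<lambda>z. cmod (FF z) \<le> 1 / (cmod z - 1) * mass) at_infinity"
    unfolding eventually_at_infinity by (intro exI[of _ 2] allI impI norm_FF_le) simp
qed

lemma R_ext_Infty: "sphere_ext (R n) Infty = Fin 0"
proof (rule sphere_ext_Infty)
  have "bounded (S n)" using finite_S by (rule finite_imp_bounded)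
  then obtain M where M: "\<And>x. x \<in> S n \<Longrightarrow> \<bar>x\<bar> \<le> M" by (auto simp: bounded_iff)
  show "(R n \<longlongrightarrow> 0) at_infinity"
  proof (rule Lim_null_comparison[OF _ tendsto_inverse_norm_at_infinity])
    show "eventually (\<lambda>z. cmod (R n z) \<le> M / (cmod z - M) * mass) at_infinity"
      unfolding eventually_at_infinity by (intro exI[of _ "M + 1"] allI impI norm_R_le M) simp_all
  qed
qed

lemma N_ge: "j \<le> N j"
proof (induction j)
  case (Suc j)
  then show ?case using N_Suc[of j] by (auto split: if_splits)
qed simp

text \<open>On \<open>K\<close> the function \<open>g\<close> is close to a polynomial
  \<open>p\<close>. Quadrature and integral have the same total mass, and they agree on
  \<open>p\<close> as soon as \<open>m <= j\<close>, because \<open>j <= N j\<close>.\<close>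

lemma quadrature_tendsto:
  assumes K: "compact K" "E \<subseteq> K" "\<And>j. S (N j) \<subseteq> K"
    and g: "continuous_on K g" "g \<in> borel_measurable borel"
  shows "(\<lambda>j. \<Sum>x\<in>S (N j). W (N j) x * g x) \<longlonglongrightarrow> (LINT t|\<sigma>. g t)"
proof (rule LIMSEQ_I)
  fix e :: real assume e: "e > 0"
  \<comment> \<open>The approximation error \<open>e' * mass\<close> occurs twice, for the
    quadrature and for the integral.\<close>
  define e' where "e' = e / (2 * mass + 1)"
  have e': "e' > 0" "2 * (e' * mass) < e"
    using e mass_nonneg by (auto simp: e'_def field_simps add_nonneg_pos)
  obtain f where f: "real_polynomial_function f" "\<And>t. t \<in> K \<Longrightarrow> \<bar>g t - f t\<bar> < e'"
    using Stone_Weierstrass_real_polynomial_function[OF K(1) g(1) e'(1)] by blast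
  obtain a m where am: "f = (\<lambda>t. \<Sum>i\<le>m. a i * t ^ i)"
    using f(1) unfolding real_polynomial_function_iff_sum by blast
  define p where "p = (\<Sum>i\<le>m. monom (a i) i)"
  have p: "poly p = f" by (simp add: p_def poly_sum poly_monom am fun_eq_iff)
  have degp: "degree p \<le> m" unfolding p_def
    by (rule degree_sum_le) (auto intro: order_trans[OF degree_monom_le])
  have ig: "integrable \<sigma> g" by (rule integrable_continuous[OF g(2) continuous_on_subset[OF g(1) K(2)]])
  have mp: "poly p \<in> borel_measurable borel"
    by (intro borel_measurable_continuous_onI continuous_intros)
  have 1: "\<bar>(LINT t|\<sigma>. g t) - I p\<bar> \<le> e' * mass"
  proof -
    have "norm (LINT t|\<sigma>. g t - poly p t) \<le> e' * mass" unfolding mass_def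
      by (rule integral_norm_bound) (use f(2) p K(2) g(2) mp in \<open>auto intro!: less_imp_le\<close>)
    then show ?thesis using ig by (simp add: I_def)
  qed
  have "\<bar>(\<Sum>x\<in>S (N j). W (N j) x * g x) - (LINT t|\<sigma>. g t)\<bar> < e" if "j \<ge> m" for j
  proof -
    have "I p = (\<Sum>x\<in>S (N j). W (N j) x * poly p x)"
      by (rule quadrature) (use degp N_ge[of j] that in linarith)
    then have "(\<Sum>x\<in>S (N j). W (N j) x * g x) - I p = (\<Sum>x\<in>S (N j). of_real (W (N j) x) * (g x - poly p x))"
      by (simp add: sum_subtractf right_diff_distrib)
    moreover have "norm (\<Sum>x\<in>S (N j). of_real (W (N j) x) * (g x - poly p x)) \<le> e' * mass"
      by (rule norm_sum_W_le) (use f(2) p K(3) in \<open>auto intro!: less_imp_le\<close>)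
    ultimately show ?thesis using 1 e'(2) by simp
  qed
  then show "\<exists>no. \<forall>j\<ge>no. norm ((\<Sum>x\<in>S (N j). W (N j) x * g x) - (LINT t|\<sigma>. g t)) < e" by auto
qed

lemma R_tendsto_FF:
  assumes "compact K" "E \<subseteq> K" "\<And>j. S (N j) \<subseteq> insert 0 K" "z \<notin> of_real ` K"
  shows "(\<lambda>j. R (N j) z) \<longlonglongrightarrow> FF z"
proof -
  have zE: "z \<notin> of_real ` E" using assms(2,4) by auto
  have K: "compact (insert 0 K)" "E \<subseteq> insert 0 K" using assms by auto
  have cont: "continuous_on (insert 0 K) (\<lambda>t. t_kernel t z)"
    by (rule continuous_t_kernel[OF compact_imp_closed[OF assms(1)] assms(4)])
  have "(\<lambda>j. \<Sum>x\<in>S (N j). W (N j) x * Re (t_kernel x z)) \<longlonglongrightarrow> (LINT t|\<sigma>. Re (t_kernel t z))"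
    by (rule quadrature_tendsto[OF K assms(3)]) (intro continuous_on_Re cont, measurable)
  moreover have "(\<lambda>j. \<Sum>x\<in>S (N j). W (N j) x * Im (t_kernel x z)) \<longlonglongrightarrow> (LINT t|\<sigma>. Im (t_kernel t z))"
    by (rule quadrature_tendsto[OF K assms(3)]) (intro continuous_on_Im cont, measurable)
  ultimately show ?thesis
    unfolding tendsto_complex_iff R_def FF_def
    using integrable_t_kernel[OF zE] by (simp add: Re_sum Im_sum)
qed

lemma R_lipschitz:
  assumes "\<delta> > 0" "S n \<subseteq> insert 0 K" "\<And>x. x \<in> S n \<Longrightarrow> \<bar>x\<bar> \<le> M"
    "\<And>t. t \<in> K \<Longrightarrow> \<delta> \<le> cmod (of_real t - z)" "\<And>t. t \<in> K \<Longrightarrow> \<delta> \<le> cmod (of_real t - z')"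
  shows "cmod (R n z - R n z') \<le> M / \<delta>\<^sup>2 * cmod (z - z') * mass"
proof -
  have "R n z - R n z' = (\<Sum>x\<in>S n. of_real (W n x) * (t_kernel x z - t_kernel x z'))"
    by (simp add: R_def sum_subtractf right_diff_distrib)
  also have "cmod \<dots> \<le> M / \<delta>\<^sup>2 * cmod (z - z') * mass"
  proof (rule norm_sum_W_le)
    fix x assume "x \<in> S n"
    then show "cmod (t_kernel x z - t_kernel x z') \<le> M / \<delta>\<^sup>2 * cmod (z - z')"
      using assms by (intro norm_t_kernel_diff_le) auto
  qed
  finally show ?thesis .
qed

text \<open>Covers a neighbourhood of infinity, which no compact subset of the plane contains. Both
  functions share the first \<open>n\<close> terms of the expansion, and each remainder is at most
  \<open>(1 / 2) ^ n * mass\<close> since \<open>|t / z| <= 1 / 2\<close>.\<close>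

lemma R_FF_near_infinity:
  assumes "1 \<le> M" "\<And>x. x \<in> S n \<Longrightarrow> \<bar>x\<bar> \<le> M" "2 * M \<le> cmod z"
  shows "cmod (R n z - FF z) \<le> 2 * ((1 / 2) ^ n * mass)"
proof -
  have z: "z \<noteq> 0" "z \<notin> of_real ` S n" "z \<notin> of_real ` E"
    using assms E_bounded by (force dest: spec[of _ "Re z"])+
  have bd: "cmod ((of_real t / z) ^ n * t_kernel t z) \<le> (1 / 2) ^ n" if "\<bar>t\<bar> \<le> M" for t
  proof -
    have "\<bar>t\<bar> / cmod z \<le> 1 / 2" using that assms z(1) by (simp add: field_simps)
    then have "cmod ((of_real t / z) ^ n) \<le> (1 / 2) ^ n"
      by (simp only: norm_power norm_divide norm_of_real) (intro power_mono, auto)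
    moreover have "cmod (t_kernel t z) \<le> 1"
    proof -
      have "cmod (t_kernel t z) \<le> M / (cmod z - M)" by (rule norm_t_kernel_le) (use that assms in auto)
      also have "\<dots> \<le> 1" using assms by (simp add: divide_le_eq)
      finally show ?thesis .
    qed
    ultimately have "cmod ((of_real t / z) ^ n) * cmod (t_kernel t z) \<le> (1 / 2) ^ n * 1"
      by (intro mult_mono) auto
    then show ?thesis by (simp add: norm_mult)
  qed
  have "cmod (R n z + (\<Sum>j<n. of_real (s j) / z ^ (j + 1))) \<le> (1 / 2) ^ n * mass"
    unfolding R_expand[OF z(1,2) order_trans[OF le_add1 eq_refl[OF mult_2[symmetric]]]]
    by (rule norm_sum_W_le) (rule bd, rule assms(2))
  moreover have "cmod (FF z + (\<Sum>j<n. of_real (s j) / z ^ (j + 1))) \<le> (1 / 2) ^ n * mass"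
    unfolding FF_expand[OF z(1,3)] mass_def
  proof (rule integral_norm_bound)
    show "(\<lambda>t. (of_real t / z) ^ n * t_kernel t z) \<in> borel_measurable borel" by measurable
    show "cmod ((of_real t / z) ^ n * t_kernel t z) \<le> (1 / 2) ^ n" if "t \<in> E" for t
      by (rule bd) (use E_bounded[OF that] assms(1) in linarith)
  qed
  ultimately show ?thesis
    using norm_triangle_ineq4[of "R n z + (\<Sum>j<n. of_real (s j) / z ^ (j + 1))" "FF z + (\<Sum>j<n. of_real (s j) / z ^ (j + 1))"]
    by simp
qed

lemma pade_N: "pade_approximant s (N j) (N j) = sphere_ext (R (N j))"
  by (rule pade_eq) (rule p0_N)

lemma pade_converges:
  assumes \<tau>: "\<And>j. \<bar>\<tau> (N j)\<bar> \<le> C"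
  shows "locally_uniform_limit (- Fin ` complex_of_real ` ({-1 - (2 + C)..\<alpha>} \<union> {\<beta>..1 + (2 + C)}))
     (\<lambda>j. pade_approximant s (N j) (N j)) (sphere_ext FF)"
proof -
  \<comment> \<open>The bound of \<open>S_bounded\<close>; it equals \<open>1 + \<epsilon>\<close>
    for the choice \<open>\<epsilon> = 2 + C\<close>.\<close>
  define M where "M = 3 + C"
  define K where "K = {- M..\<alpha>} \<union> {\<beta>..M}"
  have C: "C \<ge> 0" using \<tau>[of 0] by linarith
  have M: "M \<ge> 1" using C by (simp add: M_def)
  have EK: "E \<subseteq> K" using M by (auto simp: E_def K_def)
  have cK: "compact K" by (simp add: K_def compact_Un)
  have nodes: "\<bar>x\<bar> \<le> M" if "x \<in> S (N j)" for x j
    using S_bounded[OF that] \<tau>[of j] by (simp add: M_def)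
  have SK: "S (N j) \<subseteq> insert 0 K" for j
    using S_gap[OF p0_N] nodes[of _ j] by (force simp: K_def abs_le_iff)
  have K_le: "\<bar>t\<bar> \<le> M" if "t \<in> K" for t using that M bounds by (auto simp: K_def)
  have Keq: "{-1 - (2 + C)..\<alpha>} \<union> {\<beta>..1 + (2 + C)} = K" by (simp add: K_def M_def)
  have val: "sphere_ext (R (N j)) (Fin z) = Fin (R (N j) z)" "sphere_ext FF (Fin z) = Fin (FF z)"
    if "z \<notin> of_real ` K" for z j
    using that SK[of j] EK by (auto intro!: R_ext FF_ext)
  show ?thesis
    unfolding locally_uniform_limit_def Keq pade_N
  proof
    fix p assume p: "p \<in> - Fin ` complex_of_real ` K"
    show "\<exists>V. open V \<and> p \<in> V \<and> uniform_limit (V \<inter> - Fin ` complex_of_real ` K)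
        (\<lambda>j. sphere_ext (R (N j))) (sphere_ext FF) sequentially"
    proof (cases p)
      case (Fin z0)
      then have z0: "z0 \<notin> of_real ` K" using p by auto
      have "closed (complex_of_real ` K)"
        by (intro compact_imp_closed compact_continuous_image cK continuous_intros)
      from separate_point_closed[OF this z0] obtain d
        where d: "d > 0" "\<And>t. t \<in> K \<Longrightarrow> d \<le> dist z0 (of_real t)" by auto
      define r where "r = d / 2"
      have r: "r > 0" using d by (simp add: r_def)
      have far: "r \<le> cmod (of_real t - z)" if "t \<in> K" "z \<in> cball z0 r" for t z
        using d(2)[OF that(1)] that(2) dist_triangle[of z0 "of_real t" z]
        by (auto simp: r_def dist_norm norm_minus_commute)
      have out: "z \<notin> of_real ` K" if "z \<in> cball z0 r" for z
        using far[OF _ that] r by fastforce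
      have "uniform_limit (cball z0 r) (\<lambda>j. R (N j)) FF sequentially"
      proof (rule pointwise_imp_uniform_limit_lipschitz[where L = "M / r\<^sup>2 * mass"])
        show "(\<lambda>j. R (N j) z) \<longlonglongrightarrow> FF z" if "z \<in> cball z0 r" for z
          by (rule R_tendsto_FF[OF cK EK SK out[OF that]])
        show "dist (R (N j) z) (R (N j) z') \<le> M / r\<^sup>2 * mass * dist z z'"
          if "z \<in> cball z0 r" "z' \<in> cball z0 r" for j z z'
          using R_lipschitz[OF r SK nodes far[OF _ that(1)] far[OF _ that(2)], of j]
          by (simp add: dist_norm mult_ac)
        show "dist (FF z) (FF z') \<le> M / r\<^sup>2 * mass * dist z z'"
          if "z \<in> cball z0 r" "z' \<in> cball z0 r" for z z'
        proof -
          have "dist (FF z) (FF z') \<le> 1 / r\<^sup>2 * cmod (z - z') * mass"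
            unfolding dist_norm by (rule FF_lipschitz[OF r]) (use far that EK in blast)+
          also have "\<dots> \<le> M / r\<^sup>2 * cmod (z - z') * mass"
            using M mass_nonneg by (intro mult_right_mono divide_right_mono) auto
          finally show ?thesis by (simp add: dist_norm mult_ac)
        qed
      qed simp
      then have ul: "uniform_limit (cball z0 r) (\<lambda>j. R (N j)) FF sequentially" .
      show ?thesis
      proof (intro exI conjI)
        show "open (Fin ` ball z0 r)" by (rule open_Fin_image) simp
        show "p \<in> Fin ` ball z0 r" using Fin r by simp
        show "uniform_limit (Fin ` ball z0 r \<inter> - Fin ` complex_of_real ` K)
            (\<lambda>j. sphere_ext (R (N j))) (sphere_ext FF) sequentially"
        proof (rule uniform_limitI)
          fix e :: real assume "e > 0"
          then have "eventually (\<lambda>j. \<forall>z\<in>cball z0 r. dist (R (N j) z) (FF z) < e / 4) sequentially"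
            by (intro uniform_limitD[OF ul]) simp
          then show "eventually (\<lambda>j. \<forall>q\<in>Fin ` ball z0 r \<inter> - Fin ` complex_of_real ` K.
              dist (sphere_ext (R (N j)) q) (sphere_ext FF q) < e) sequentially"
          proof eventually_elim
            case (elim j)
            show ?case
            proof
              fix q assume "q \<in> Fin ` ball z0 r \<inter> - Fin ` complex_of_real ` K"
              then obtain z where z: "q = Fin z" "z \<in> cball z0 r" by auto
              have "dist (sphere_ext (R (N j)) q) (sphere_ext FF q) = dist (Fin (R (N j) z)) (Fin (FF z))"
                using val[OF out[OF z(2)]] z(1) by simp
              also have "\<dots> \<le> 4 * dist (R (N j) z) (FF z)" using dist_Fin_Fin_le by (simp add: dist_norm)
              finally show "dist (sphere_ext (R (N j)) q) (sphere_ext FF q) < e" using elim z(2) by fastforce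
            qed
          qed
        qed
      qed
    next
      case Infty
      show ?thesis
      proof (intro exI conjI)
        let ?V = "insert Infty (Fin ` {z. 2 * M < cmod z})"
        show "open ?V" by (rule open_Infty_nhd)
        show "p \<in> ?V" using Infty by simp
        show "uniform_limit (?V \<inter> - Fin ` complex_of_real ` K)
            (\<lambda>j. sphere_ext (R (N j))) (sphere_ext FF) sequentially"
        proof (rule uniform_limitI)
          fix e :: real assume e: "e > 0"
          have "(\<lambda>j. 8 * mass * (1 / 2) ^ j) \<longlonglongrightarrow> 8 * mass * 0"
            by (intro tendsto_intros LIMSEQ_realpow_zero) auto
          then have "eventually (\<lambda>j. 8 * mass * (1 / 2) ^ j < e) sequentially"
            using e by (intro order_tendstoD(2)) auto
          then show "eventually (\<lambda>j. \<forall>q\<in>?V \<inter> - Fin ` complex_of_real ` K.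
              dist (sphere_ext (R (N j)) q) (sphere_ext FF q) < e) sequentially"
          proof eventually_elim
            case (elim j)
            show ?case
            proof
              fix q assume q: "q \<in> ?V \<inter> - Fin ` complex_of_real ` K"
              show "dist (sphere_ext (R (N j)) q) (sphere_ext FF q) < e"
              proof (cases q)
                case (Fin z)
                then have z: "2 * M < cmod z" "z \<notin> of_real ` K" using q by auto
                have "dist (sphere_ext (R (N j)) q) (sphere_ext FF q) = dist (Fin (R (N j) z)) (Fin (FF z))"
                  using val[OF z(2)] Fin by simp
                also have "\<dots> \<le> 4 * cmod (R (N j) z - FF z)" by (rule dist_Fin_Fin_le)
                also have "\<dots> \<le> 4 * (2 * ((1 / 2) ^ N j * mass))"
                  by (intro mult_left_mono R_FF_near_infinity[OF M]) (use nodes z(1) in auto)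
                also have "\<dots> \<le> 8 * mass * (1 / 2) ^ j"
                  using power_decreasing[OF N_ge[of j], of "1 / 2 :: real"] mass_nonneg
                  by (simp add: mult_left_mono mult.commute)
                finally show ?thesis using elim by linarith
              next
                case Infty
                then show ?thesis using e by (simp add: R_ext_Infty FF_ext_Infty)
              qed
            qed
          qed
        qed
      qed
    qed
  qed
qed

text \<open>A nonzero node is a genuine pole: along the vertical line through \<open>x\<close>, the
  product \<open>(x - z) * R n z\<close> tends to \<open>W n x * x\<close>, which is nonzero as the
  weights are positive, while boundedness would force the limit \<open>0\<close>.\<close>

lemma S_bounded_if_R_bounded:
  assumes "x \<in> S n" "x \<noteq> 0" "\<And>\<delta>. \<delta> > 0 \<Longrightarrow> cmod (R n (Complex x \<delta>)) \<le> B"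
  shows False
proof -
  let ?z = "\<lambda>\<delta>. Complex x \<delta>"
  define r where "r z = (\<Sum>y\<in>S n - {x}. of_real (W n y) * t_kernel y z)" for z
  have lim: "((\<lambda>\<delta>. ?z \<delta>) \<longlongrightarrow> of_real x) (at_right 0)"
    unfolding tendsto_complex_iff by simp
  have "(r \<longlongrightarrow> r (of_real x)) (nhds (of_real x))"
    unfolding r_def t_kernel_def by (intro tendsto_intros) (auto intro: filterlim_ident)
  then have "((\<lambda>\<delta>. r (?z \<delta>)) \<longlongrightarrow> r (of_real x)) (at_right 0)"
    using lim by (rule filterlim_compose)
  then have "((\<lambda>\<delta>. of_real (W n x * x) + (of_real x - ?z \<delta>) * r (?z \<delta>)) \<longlongrightarrow>
      of_real (W n x * x) + (of_real x - of_real x) * r (of_real x)) (at_right 0)"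
    by (intro tendsto_intros lim)
  moreover have "eventually (\<lambda>\<delta>. of_real (W n x * x) + (of_real x - ?z \<delta>) * r (?z \<delta>) = (of_real x - ?z \<delta>) * R n (?z \<delta>)) (at_right 0)"
    using eventually_at_right_less[of 0]
  proof eventually_elim
    case (elim \<delta>)
    then have "of_real x - ?z \<delta> \<noteq> 0" by (simp add: complex_eq_iff)
    then have "(of_real x - ?z \<delta>) * (of_real (W n x) * t_kernel x (?z \<delta>)) = of_real (W n x * x)"
      by (simp add: t_kernel_def)
    moreover have "R n (?z \<delta>) = of_real (W n x) * t_kernel x (?z \<delta>) + r (?z \<delta>)"
      unfolding R_def r_def using finite_S assms(1) by (rule sum.remove)
    ultimately show ?case by (simp only: distrib_left)
  qed
  ultimately have 1: "((\<lambda>\<delta>. (of_real x - ?z \<delta>) * R n (?z \<delta>)) \<longlongrightarrow> of_real (W n x * x)) (at_right 0)"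
    by (simp add: Lim_transform_eventually)
  have "((\<lambda>\<delta>. (of_real x - ?z \<delta>) * R n (?z \<delta>)) \<longlongrightarrow> 0) (at_right 0)"
  proof (rule Lim_null_comparison)
    show "eventually (\<lambda>\<delta>. cmod ((of_real x - ?z \<delta>) * R n (?z \<delta>)) \<le> cmod (of_real x - ?z \<delta>) * B) (at_right 0)"
      using eventually_at_right_less[of 0]
      by eventually_elim (auto simp: norm_mult intro!: mult_left_mono assms(3))
    have "((\<lambda>\<delta>. cmod (of_real x - ?z \<delta>) * B) \<longlongrightarrow> cmod (of_real x - of_real x) * B) (at_right 0)"
      by (intro tendsto_intros lim)
    then show "((\<lambda>\<delta>. cmod (of_real x - ?z \<delta>) * B) \<longlongrightarrow> 0) (at_right 0)" by simp
  qed
  from tendsto_unique[OF _ 1 this] have "W n x * x = 0" by simp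
  then show False using W_pos[OF assms(1)] assms(2) by simp
qed

lemma \<tau>_bounded_if_pade_converges:
  assumes "\<epsilon> \<ge> 0" and lim: "locally_uniform_limit (- Fin ` complex_of_real ` ({-1 - \<epsilon>..\<alpha>} \<union> {\<beta>..1 + \<epsilon>}))
     (\<lambda>j. pade_approximant s (N j) (N j)) (sphere_ext FF)"
  shows "\<exists>C. \<forall>j. \<bar>\<tau> (N j)\<bar> \<le> C"
proof -
  let ?D = "- Fin ` complex_of_real ` ({-1 - \<epsilon>..\<alpha>} \<union> {\<beta>..1 + \<epsilon>})"
  have "Infty \<in> ?D" by auto
  then obtain V where V: "open V" "Infty \<in> V"
    "uniform_limit (V \<inter> ?D) (\<lambda>j. sphere_ext (R (N j))) (sphere_ext FF) sequentially"
    using lim unfolding locally_uniform_limit_def pade_N by blast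
  obtain r where r: "r > 0" "\<And>z. r < cmod z \<Longrightarrow> Fin z \<in> V"
    using open_contains_Infty_nhd[OF V(1,2)] by blast
  \<comment> \<open>Beyond \<open>r\<close> the points lie in \<open>V\<close>; beyond
    \<open>2 + mass\<close> the bound of \<open>norm_FF_le\<close> is at most
    \<open>1\<close>.\<close>
  define M where "M = max r (2 + mass)"
  have FF1: "cmod (FF z) \<le> 1" if "M < cmod z" for z
  proof -
    have "1 < cmod z" "mass \<le> cmod z - 1" using that mass_nonneg by (auto simp: M_def)
    then have "1 / (cmod z - 1) * mass \<le> 1" by (simp add: divide_le_eq)
    then show ?thesis using norm_FF_le[OF \<open>1 < cmod z\<close>] by linarith
  qed
  have "eventually (\<lambda>j. \<forall>q\<in>V \<inter> ?D. dist (sphere_ext (R (N j)) q) (sphere_ext FF q) < 1 / 2) sequentially"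
    by (rule uniform_limitD[OF V(3)]) simp
  then obtain j0 where j0: "\<And>j q. j \<ge> j0 \<Longrightarrow> q \<in> V \<inter> ?D \<Longrightarrow> dist (sphere_ext (R (N j)) q) (sphere_ext FF q) < 1 / 2"
    unfolding eventually_sequentially by blast
  have nodes: "\<bar>x\<bar> \<le> M" if "j \<ge> j0" "x \<in> S (N j)" for j x
  proof (rule ccontr)
    assume x: "\<not> \<bar>x\<bar> \<le> M"
    \<comment> \<open>Points above the real axis lie in the domain of convergence for every
      \<open>\<epsilon>\<close>, and there both spherical extensions are the plain values.\<close>
    have "cmod (R (N j) (Complex x \<delta>)) \<le> 2" if "\<delta> > 0" for \<delta>
    proof -
      let ?z = "Complex x \<delta>"
      have nr: "?z \<notin> range of_real" using \<open>\<delta> > 0\<close> by (auto simp: complex_eq_iff)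
      have "M < cmod ?z" using x abs_Re_le_cmod[of ?z] by simp
      then have "Fin ?z \<in> V \<inter> ?D" using r(2)[of ?z] nr by (auto simp: M_def)
      moreover have "sphere_ext (R (N j)) (Fin ?z) = Fin (R (N j) ?z)" using nr by (intro R_ext) auto
      moreover have "sphere_ext FF (Fin ?z) = Fin (FF ?z)" using nr by (intro FF_ext) auto
      ultimately have "dist (Fin (R (N j) ?z)) (Fin (FF ?z)) < 1 / 2" using j0[OF \<open>j \<ge> j0\<close>, of "Fin ?z"] by simp
      then show ?thesis by (rule norm_le_2_if_dist_Fin_less) (rule FF1[OF \<open>M < cmod ?z\<close>])
    qed
    moreover have "x \<noteq> 0" using x mass_nonneg by (auto simp: M_def)
    ultimately show False using S_bounded_if_R_bounded[OF \<open>x \<in> S (N j)\<close>] by blast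
  qed
  have "\<bar>\<tau> (N j)\<bar> \<le> max (M + 1) (Max ((\<lambda>j. \<bar>\<tau> (N j)\<bar>) ` {..j0}))" for j
  proof (cases "j \<ge> j0")
    case True
    then have "\<bar>\<tau> (N j)\<bar> \<le> M + 1" using nodes by (intro \<tau>_bounded) auto
    then show ?thesis by simp
  next
    case False
    then have "\<bar>\<tau> (N j)\<bar> \<le> Max ((\<lambda>j. \<bar>\<tau> (N j)\<bar>) ` {..j0})" by (intro Max_ge) auto
    then show ?thesis by simp
  qed
  then show ?thesis by blast
qed

lemma pade_converges_iff:
  "(\<exists>\<epsilon>\<ge>0. locally_uniform_limit (- Fin ` complex_of_real ` ({-1 - \<epsilon>..\<alpha>} \<union> {\<beta>..1 + \<epsilon>}))
     (\<lambda>j. pade_approximant s (N j) (N j)) (sphere_ext FF)) \<longleftrightarrow> (\<exists>C. \<forall>j. \<bar>\<tau> (N j)\<bar> \<le> C)"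
proof
  assume "\<exists>C. \<forall>j. \<bar>\<tau> (N j)\<bar> \<le> C"
  then obtain C where C: "\<And>j. \<bar>\<tau> (N j)\<bar> \<le> C" by blast
  then have "C \<ge> 0" by (metis abs_ge_zero order_trans)
  then show "\<exists>\<epsilon>\<ge>0. locally_uniform_limit (- Fin ` complex_of_real ` ({-1 - \<epsilon>..\<alpha>} \<union> {\<beta>..1 + \<epsilon>}))
     (\<lambda>j. pade_approximant s (N j) (N j)) (sphere_ext FF)"
    using pade_converges[OF C] by (intro exI[of _ "2 + C"]) simp
qed (use \<tau>_bounded_if_pade_converges in blast)

end


section \<open>The LU-factorization of the Jacobi matrix\<close>

context two_interval_measure begin

sublocale blk: gap_sequence N
proof unfold_locales
  show "N 0 = 0" by (rule N_0)
  show "N (Suc j) = Suc (N j) \<or> N (Suc j) = Suc (Suc (N j))" for j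
    unfolding N_Suc by simp
qed

lemma two_iff: "blk.two j \<longleftrightarrow> p0 (Suc (N j)) = 0"
  by (simp add: blk.two_def N_Suc)

lemma \<tau>_eq_0_iff: "\<tau> (N j) = 0 \<longleftrightarrow> blk.two j"
  by (simp add: \<tau>_def two_iff p0_N)

text \<open>In a block of size 2 the number \<open>\<tau> (N j)\<close> is \<open>0\<close>, and the
  subdiagonal entry \<open>c (N j)\<close> of the Jacobi matrix takes over the role of the
  pivot.\<close>

definition u0 where "u0 j = (if blk.two j then c (N j) else - \<tau> (N j))"
definition u1 where "u1 j = b (Suc (N j))"
text \<open>The first nonvanishing moment of \<open>Q (N j)\<close>, see \<open>Q_moments\<close>.
  Its sign is the sign in step \<open>j\<close> of the Schur algorithm, see
  \<open>near_first_coeff\<close>.\<close>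

definition g where "g j = u0 j * h (N j)"
definition l where "l j = (if j = 0 then 0 else h (N j) / g (j - 1))"

lemma u0_nonzero: "u0 j \<noteq> 0"
  using c_pos[of "N j"] \<tau>_eq_0_iff[of j] by (auto simp: u0_def)

lemma g_nonzero: "g j \<noteq> 0"
  using u0_nonzero[of j] h_pos[of "N j"] by (simp add: g_def)

lemma l_nonzero: "l (Suc j) \<noteq> 0"
  using g_nonzero[of j] h_pos[of "N (Suc j)"] by (simp add: l_def)

lemma l_u0: "l (Suc j) * u0 (Suc j) = g (Suc j) / g j"
  by (simp add: l_def g_def)

lemma c_N: "\<not> blk.two j \<Longrightarrow> c (N j) = l (Suc j) * u0 j"
  using u0_nonzero[of j] h_pos[of "N j"] by (simp add: l_def g_def c_def blk.Suc_N)

lemma c_Suc_N: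
  assumes "blk.two j" shows "c (Suc (N j)) = l (Suc j)"
proof -
  have "g j = h (Suc (N j))" using assms h_pos[of "N j"] by (simp add: g_def u0_def c_def)
  then show ?thesis using assms by (simp add: l_def c_def blk.Suc_Suc_N)
qed

lemma b_N_0: "b (N 0) = - \<tau> (N 0)"
  by (simp add: \<tau>_def p0_rec)

text \<open>Divide the recurrence of \<open>p0\<close> at \<open>N (Suc j)\<close> by
  \<open>p0 (N (Suc j))\<close>. After a block of size 2 the preceding value of \<open>p0\<close> is
  \<open>0\<close> and the last term is absent; otherwise it involves
  \<open>c (N j) / \<tau> (N j)\<close>, that is \<open>- l (Suc j)\<close>.\<close>

lemma b_N_Suc: "b (N (Suc j)) = - \<tau> (N (Suc j)) + (if blk.two j then 0 else l (Suc j))"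
proof (cases "blk.two j")
  case True
  then have "N (Suc j) = Suc (Suc (N j))" by (simp add: blk.two_def)
  moreover have "p0 (Suc (N j)) = 0" using True by (simp add: two_iff)
  ultimately show ?thesis using True p0_N[of "Suc j"] p0_rec(3)[of "Suc (N j)"] by (simp add: \<tau>_def)
next
  case False
  then have N: "N (Suc j) = Suc (N j)" by (simp add: blk.Suc_N)
  have nz: "p0 (N j) \<noteq> 0" "p0 (Suc (N j)) \<noteq> 0" using p0_N[of j] p0_N[of "Suc j"] N by auto
  have "\<tau> (N (Suc j)) = - b (N (Suc j)) - c (N j) * p0 (N j) / p0 (Suc (N j))"
    unfolding N using nz by (simp add: \<tau>_def p0_rec(3) diff_divide_distrib)
  moreover have "c (N j) * p0 (N j) / p0 (Suc (N j)) = - l (Suc j)"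
    using False nz unfolding c_N[OF False] by (simp add: u0_def \<tau>_def)
  ultimately show ?thesis using False by simp
qed

lemma upper_diag: "block_upper N u0 u1 (N i) (N i) = - \<tau> (N i)"
  using \<tau>_eq_0_iff[of i] by (auto simp: blk.upper_N u0_def)

text \<open>\<open>L\<close> acts only on the first rows of blocks, where \<open>b_N_Suc\<close>,
  \<open>c_N\<close> and \<open>c_Suc_N\<close> are the identities required. The second row of a
  block of size 2 is a row of the Jacobi matrix itself.\<close>

lemma jacobi_LU: "monic_jacobi_matrix \<sigma> = matrix_prod (block_lower N l) (block_upper N u0 u1)"
proof (intro ext)
  fix i k
  show "monic_jacobi_matrix \<sigma> i k = matrix_prod (block_lower N l) (block_upper N u0 u1) i k"
  proof (rule blk.index_cases[of i])
    fix I assume i: "i = N I"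
    show ?thesis
    proof (cases I)
      case 0
      show ?thesis
      proof (cases "k = N 0")
        case True
        have "monic_jacobi_matrix \<sigma> i k = - \<tau> (N 0)"
          unfolding monic_jacobi_matrix_def i 0 True using b_N_0 by simp
        then show ?thesis unfolding i 0 True blk.matrix_prod_lower_N upper_diag by simp
      next
        case False
        then show ?thesis
          unfolding i 0 blk.matrix_prod_lower_N blk.upper_N monic_jacobi_matrix_def by auto
      qed
    next
      case (Suc J)
      show ?thesis
      proof (cases "k = N (Suc J)")
        case True
        have "monic_jacobi_matrix \<sigma> i k = - \<tau> (N (Suc J)) + (if blk.two J then 0 else l (Suc J))"
          unfolding monic_jacobi_matrix_def i Suc True using b_N_Suc by simp
        then show ?thesis unfolding i Suc True blk.matrix_prod_lower_N upper_diag
          by (auto simp: blk.upper_N blk.N_eq_Suc_N_iff)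
      next
        case False
        show ?thesis
          unfolding i Suc blk.matrix_prod_lower_N
          by (cases "blk.two J"; cases "blk.two (Suc J)"; rule blk.index_cases[of k])
             (use False in \<open>auto simp: blk.upper_N monic_jacobi_matrix_def c_N c_Suc_N blk.Suc_N blk.Suc_Suc_N blk.N_eq_Suc_N_iff\<close>)
      qed
    qed
  next
    fix I assume i: "i = Suc (N I)" "blk.two I"
    show ?thesis
      unfolding i(1) blk.matrix_prod_lower_Suc_N[OF i(2)] blk.upper_Suc_N[OF i(2)]
      using i(2) by (auto simp: monic_jacobi_matrix_def u0_def u1_def blk.Suc_Suc_N[symmetric])
  qed
qed

lemma upper_tridiagonal: "block_upper N u0 u1 i k \<noteq> 0 \<Longrightarrow> k \<le> Suc i \<and> i \<le> Suc k"
  by (rule blk.index_cases[of i]) (auto simp: blk.upper_N blk.upper_Suc_N blk.Suc_Suc_N[symmetric] split: if_splits)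

lemma upper_bounded_iff:
  "ell2_bounded (block_upper N u0 u1) \<longleftrightarrow> (\<exists>C. \<forall>j. \<bar>\<tau> (N j)\<bar> \<le> C)"
proof -
  have iff: "ell2_bounded (block_upper N u0 u1) \<longleftrightarrow> (\<exists>C. \<forall>i k. \<bar>block_upper N u0 u1 i k\<bar> \<le> C)"
    by (rule ell2_bounded_tridiagonal_iff) (rule upper_tridiagonal)
  show ?thesis unfolding iff
  proof
    assume "\<exists>C. \<forall>i k. \<bar>block_upper N u0 u1 i k\<bar> \<le> C"
    then obtain C where C: "\<And>i k. \<bar>block_upper N u0 u1 i k\<bar> \<le> C" by blast
    have "\<bar>\<tau> (N j)\<bar> \<le> C" for j using C[of "N j" "N j"] unfolding upper_diag by simp
    then show "\<exists>C. \<forall>j. \<bar>\<tau> (N j)\<bar> \<le> C" by blast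
  next
    assume "\<exists>C. \<forall>j. \<bar>\<tau> (N j)\<bar> \<le> C"
    then obtain C where C: "\<And>j. \<bar>\<tau> (N j)\<bar> \<le> C" by blast
    have c: "\<bar>c n\<bar> \<le> 1" for n using c_pos[of n] c_le_1[of n] by simp
    have "\<bar>block_upper N u0 u1 i k\<bar> \<le> max 1 C" for i k
    proof (rule blk.index_cases[of i])
      fix j assume "i = N j"
      then show ?thesis using C[of j] by (auto simp: blk.upper_N u0_def le_max_iff_disj)
    next
      fix j assume "i = Suc (N j)" "blk.two j"
      then show ?thesis using c b_bound by (auto simp: blk.upper_Suc_N u0_def u1_def le_max_iff_disj)
    qed
    then show "\<exists>C. \<forall>i k. \<bar>block_upper N u0 u1 i k\<bar> \<le> C" by blast
  qed
qed

text \<open>All factorizations have the same \<open>U\<close>; \<open>LU_unique\<close> asks for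
  nonzero pivots only in the explicit one.\<close>

lemma LU_bounded_iff:
  "(\<exists>L U. block_LU_factorization s (monic_jacobi_matrix \<sigma>) L U \<and> ell2_bounded U) \<longleftrightarrow>
   (\<exists>C. \<forall>j. \<bar>\<tau> (N j)\<bar> \<le> C)"
  unfolding upper_bounded_iff[symmetric]
proof
  assume "ell2_bounded (block_upper N u0 u1)"
  moreover have "block_LU_factorization s (monic_jacobi_matrix \<sigma>) (block_lower N l) (block_upper N u0 u1)"
    unfolding block_LU_factorization_def N_def[symmetric] using jacobi_LU by blast
  ultimately show "\<exists>L U. block_LU_factorization s (monic_jacobi_matrix \<sigma>) L U \<and> ell2_bounded U" by blast
next
  assume "\<exists>L U. block_LU_factorization s (monic_jacobi_matrix \<sigma>) L U \<and> ell2_bounded U"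
  then obtain l' u0' u1' where
    e: "monic_jacobi_matrix \<sigma> = matrix_prod (block_lower N l') (block_upper N u0' u1')"
    and bd: "ell2_bounded (block_upper N u0' u1')"
    unfolding block_LU_factorization_def N_def[symmetric] by blast
  have "block_upper N u0 u1 = block_upper N u0' u1'"
    by (rule blk.LU_unique[of l _ _ l']) (use e jacobi_LU u0_nonzero in auto)
  then show "ell2_bounded (block_upper N u0 u1)" using bd by simp
qed

end


section \<open>The UL-factorization of the generalized Jacobi matrix\<close>

lemma expands_eventually_nonzero:
  assumes "expands_at_infinity f F" "F \<noteq> 0"
  shows "eventually (\<lambda>z. f z \<noteq> 0) at_infinity"
proof -
  have "((\<lambda>z. f z * z ^ subdegree F) \<longlongrightarrow> fps_nth F (subdegree F)) at_infinity"
    by (rule expands_tendsto_gen[OF assms(1)]) (rule nth_less_subdegree_zero)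
  moreover have "fps_nth F (subdegree F) \<noteq> 0" using assms(2) by simp
  ultimately have "eventually (\<lambda>z. f z * z ^ subdegree F \<noteq> 0) at_infinity"
    by (rule tendsto_imp_eventually_ne)
  then show ?thesis by eventually_elim auto
qed

lemma cauchy_kernel_expand:
  fixes x z :: complex
  assumes "z \<noteq> 0" "x \<noteq> z"
  shows "1 / (x - z) = (x / z) ^ m / (x - z) - (\<Sum>j<m. x ^ j / z ^ (j + 1))"
proof (induction m)
  case (Suc m)
  have "x - z \<noteq> 0" using assms by auto
  then have "x / z / (x - z) = 1 / (x - z) + 1 / z" using assms(1)
    by (simp add: divide_simps)
  then have "(x / z) ^ m * (x / z / (x - z)) = (x / z) ^ m * (1 / (x - z) + 1 / z)" by simp
  then have "(x / z) ^ Suc m / (x - z) = (x / z) ^ m / (x - z) + x ^ m / z ^ (m + 1)"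
    by (simp add: distrib_left power_divide mult_ac)
  then show ?case using Suc.IH by simp
qed simp

text \<open>For a block of size 2: \<open>x\<close> is the function of the second kind that has to
  be eliminated between two successive relations, which makes the factor of \<open>p\<close>
  quadratic in \<open>z\<close>.\<close>

lemma eliminate_quadratic:
  fixes z :: "'a::comm_ring_1"
  assumes "z * p = x + v * p + u * y" "z * x = q + l * p"
  shows "(z * z - v * z - u - l) * p = q + u * (z * y - p)"
proof -
  have "z * (z * p) = z * (x + v * p + u * y)" by (simp only: assms(1))
  also have "\<dots> = z * x + v * (z * p) + u * (z * y)" by (simp add: algebra_simps)
  also have "\<dots> = q + l * p + v * (z * p) + u * (z * y)" by (simp only: assms(2))
  finally show ?thesis by (simp add: algebra_simps)
qed

context gap_sequence begin

lemma block_tridiag_cong: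
  assumes "\<And>i. d0 i = d0' i" "\<And>i. two i \<Longrightarrow> d1 i = d1' i" "\<And>i. e i = e' i"
  shows "block_tridiag d0 d1 e = block_tridiag d0' d1' e'"
proof (intro ext)
  fix i k show "block_tridiag d0 d1 e i k = block_tridiag d0' d1' e' i k"
    by (rule index_cases[of i]) (auto simp: tridiag_N tridiag_Suc_N assms)
qed

end

context two_interval_measure begin

section \<open>Functions of the second kind\<close>

definition cauchy :: "real poly \<Rightarrow> complex \<Rightarrow> complex" where "cauchy p z = (LINT t|\<sigma>. of_real (poly p t) / (of_real t - z))"

lemma cauchy_kernel:
  assumes "1 < cmod z"
  shows "integrable \<sigma> (\<lambda>t. of_real (poly p t) / (of_real t - z))"
    and "(\<lambda>t. of_real (poly p t) / (of_real t - z)) \<in> borel_measurable borel"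
proof -
  have m: "poly p \<in> borel_measurable borel"
    by (intro borel_measurable_continuous_onI continuous_intros)
  show 1: "(\<lambda>t. of_real (poly p t) / (of_real t - z)) \<in> borel_measurable borel"
    using m by measurable
  have "of_real t \<noteq> z" if "t \<in> E" for t using E_bounded[OF that] assms by auto
  then show "integrable \<sigma> (\<lambda>t. of_real (poly p t) / (of_real t - z))"
    by (intro integrable_continuous[OF 1] continuous_intros) auto
qed

lemma cauchy_diff: "1 < cmod z \<Longrightarrow> cauchy (p - q) z = cauchy p z - cauchy q z"
  and cauchy_add: "1 < cmod z \<Longrightarrow> cauchy (p + q) z = cauchy p z + cauchy q z"
  unfolding cauchy_def by (simp_all add: diff_divide_distrib add_divide_distrib cauchy_kernel)

lemma cauchy_smult: "cauchy (Polynomial.smult a p) z = of_real a * cauchy p z"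
proof -
  have "(\<lambda>t. complex_of_real (poly (Polynomial.smult a p) t) / (of_real t - z)) =
      (\<lambda>t. of_real a * (of_real (poly p t) / (of_real t - z)))" by simp
  then show ?thesis unfolding cauchy_def by (simp only: integral_mult_right_zero)
qed

text \<open>From \<open>t / (t - z) = 1 + z / (t - z)\<close>. The extra term vanishes for
  \<open>P n\<close> with \<open>n > 0\<close>, so the functions of the second kind obey the
  recurrence of the polynomials, with an inhomogeneous term \<open>mass\<close> at
  \<open>n = 0\<close>.\<close>

lemma cauchy_pCons: "1 < cmod z \<Longrightarrow> cauchy (pCons 0 p) z = z * cauchy p z + of_real (I p)"
proof -
  assume z: "1 < cmod z"
  have "cauchy (pCons 0 p) z = (LINT t|\<sigma>. z * (of_real (poly p t) / (of_real t - z)) + of_real (poly p t))"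
    unfolding cauchy_def
  proof (rule integral_cong_AE)
    show "AE t in \<sigma>. of_real (poly (pCons 0 p) t) / (of_real t - z) = z * (of_real (poly p t) / (of_real t - z)) + of_real (poly p t)"
      using AE_E
    proof eventually_elim
      case (elim t)
      then have "of_real t - z \<noteq> 0" using E_bounded[OF elim] z by auto
      then show ?case by (simp add: divide_simps) (simp add: algebra_simps)
    qed
    show "(\<lambda>t. of_real (poly (pCons 0 p) t) / (of_real t - z)) \<in> borel_measurable \<sigma>"
      using cauchy_kernel(2)[OF z, of "pCons 0 p"] by simp
    have "(\<lambda>t. complex_of_real (poly p t)) \<in> borel_measurable borel"
      by (intro borel_measurable_continuous_onI continuous_intros)
    then show "(\<lambda>t. z * (of_real (poly p t) / (of_real t - z)) + of_real (poly p t)) \<in> borel_measurable \<sigma>"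
      using cauchy_kernel(2)[OF z, of p] by simp
  qed
  also have "\<dots> = (LINT t|\<sigma>. z * (of_real (poly p t) / (of_real t - z))) + (LINT t|\<sigma>. complex_of_real (poly p t))"
    by (intro Bochner_Integration.integral_add integrable_mult_right cauchy_kernel(1)[OF z] integrable_of_real integrable_poly)
  finally show ?thesis unfolding cauchy_def I_def by (simp only: integral_mult_right_zero integral_complex_of_real)
qed

definition cauchy_fps :: "real poly \<Rightarrow> complex fps" where
  "cauchy_fps p = Abs_fps (\<lambda>i. if i = 0 then 0 else - of_real (I (p * monom 1 (i - 1))))"

lemma real_cauchy_fps: "real_fps (cauchy_fps p)"
  by (simp add: real_fps_iff cauchy_fps_def)

text \<open>The remainder of the finite geometric expansion is bounded by a multiple of
  \<open>(1 / |z|) ^ m\<close>, as \<open>|t| <= 1\<close> on \<open>E\<close>.\<close>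

lemma cauchy_sums:
  assumes "1 < cmod z"
  shows "(\<lambda>j. - of_real (I (p * monom 1 j)) / z ^ (j + 1)) sums cauchy p z"
proof -
  have "bounded (poly p ` E)"
    by (intro compact_imp_bounded compact_continuous_image compact_E continuous_intros)
  then obtain B where B: "\<And>t. t \<in> E \<Longrightarrow> \<bar>poly p t\<bar> \<le> B" by (auto simp: bounded_iff)
  have z0: "z \<noteq> 0" using assms by auto
  have tz: "of_real t \<noteq> z" "cmod z - 1 \<le> cmod (of_real t - z)" if "t \<in> E" for t
    using E_bounded[OF that] assms norm_triangle_ineq2[of z "of_real t"] by (auto simp: norm_minus_commute)
  let ?f = "\<lambda>m t. of_real (poly p t) * ((of_real t / z) ^ m / (of_real t - z)) :: complex"
  have mp: "poly p \<in> borel_measurable borel"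
    by (intro borel_measurable_continuous_onI continuous_intros)
  have mf: "?f m \<in> borel_measurable borel" for m using mp by measurable
  have bound: "cmod (?f m t) \<le> B / (cmod z - 1) * (1 / cmod z) ^ m" if "t \<in> E" for t m
  proof -
    have "cmod (?f m t) = \<bar>poly p t\<bar> * ((\<bar>t\<bar> / cmod z) ^ m / cmod (of_real t - z))"
      by (simp add: norm_mult norm_divide norm_power)
    also have "\<dots> \<le> B * ((1 / cmod z) ^ m / (cmod z - 1))"
      using B[OF that] E_bounded[OF that] tz[OF that] assms
      by (intro mult_mono frac_le power_mono divide_right_mono) auto
    finally show ?thesis by simp
  qed
  have eq: "cauchy p z + (\<Sum>j<m. of_real (I (p * monom 1 j)) / z ^ (j + 1)) = (LINT t|\<sigma>. ?f m t)" for m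
  proof -
    let ?h = "\<lambda>j t. complex_of_real (poly (p * monom 1 j) t) / z ^ (j + 1)"
    have i: "integrable \<sigma> (?h j)" for j by (intro integrable_divide integrable_of_real integrable_poly)
    have ih: "(LINT t|\<sigma>. ?h j t) = of_real (I (p * monom 1 j)) / z ^ (j + 1)" for j
      unfolding I_def by (simp only: integral_divide_zero integral_complex_of_real)
    have "(LINT t|\<sigma>. ?f m t) = (LINT t|\<sigma>. of_real (poly p t) / (of_real t - z) + (\<Sum>j<m. ?h j t))"
    proof (rule integral_cong_AE)
      show "AE t in \<sigma>. ?f m t = of_real (poly p t) / (of_real t - z) + (\<Sum>j<m. ?h j t)"
        using AE_E
      proof eventually_elim
        case (elim t)
        have "?f m t = of_real (poly p t) * (1 / (of_real t - z) + (\<Sum>j<m. of_real t ^ j / z ^ (j + 1)))"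
          using cauchy_kernel_expand[OF z0 tz(1)[OF elim], of m] by (simp only: diff_add_cancel)
        then show ?case by (simp add: distrib_left sum_distrib_left poly_monom)
      qed
      show "?f m \<in> borel_measurable \<sigma>" using mf[of m] by simp
      have "(\<lambda>t. \<Sum>j<m. ?h j t) \<in> borel_measurable borel"
        by (intro borel_measurable_continuous_onI continuous_intros) (use z0 in auto)
      then show "(\<lambda>t. of_real (poly p t) / (of_real t - z) + (\<Sum>j<m. ?h j t)) \<in> borel_measurable \<sigma>"
        using cauchy_kernel(2)[OF assms, of p] by simp
    qed
    also have "\<dots> = cauchy p z + (\<Sum>j<m. of_real (I (p * monom 1 j)) / z ^ (j + 1))"
      by (subst Bochner_Integration.integral_add[OF cauchy_kernel(1)[OF assms] Bochner_Integration.integrable_sum[OF i]])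
         (simp only: cauchy_def ih Bochner_Integration.integral_sum[OF i])
    finally show ?thesis ..
  qed
  have "(\<lambda>m. LINT t|\<sigma>. ?f m t) \<longlonglongrightarrow> 0"
  proof (rule Lim_null_comparison)
    show "eventually (\<lambda>m. norm (LINT t|\<sigma>. ?f m t) \<le> B / (cmod z - 1) * (1 / cmod z) ^ m * mass) sequentially"
      unfolding mass_def by (intro always_eventually allI integral_norm_bound mf bound)
    have "(\<lambda>m. B / (cmod z - 1) * (1 / cmod z) ^ m * mass) \<longlonglongrightarrow> B / (cmod z - 1) * 0 * mass"
      by (intro tendsto_intros LIMSEQ_realpow_zero) (use assms z0 in \<open>auto simp: divide_less_eq\<close>)
    then show "(\<lambda>m. B / (cmod z - 1) * (1 / cmod z) ^ m * mass) \<longlonglongrightarrow> 0" by simp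
  qed
  from tendsto_diff[OF tendsto_const[of "cauchy p z"] this]
  have "(\<lambda>m. cauchy p z - (LINT t|\<sigma>. ?f m t)) \<longlonglongrightarrow> cauchy p z" by simp
  moreover have "cauchy p z - (LINT t|\<sigma>. ?f m t) = (\<Sum>j<m. - of_real (I (p * monom 1 j)) / z ^ (j + 1))" for m
    unfolding eq[symmetric] by (simp add: sum_negf)
  ultimately show ?thesis unfolding sums_def by simp
qed

lemma cauchy_expands: "expands_at_infinity (cauchy p) (cauchy_fps p)"
proof -
  define G where "G w = (if w = 0 then 0 else cauchy p (inverse w))" for w :: complex
  have "G has_fps_expansion cauchy_fps p"
  proof (rule has_fps_expansionI)
    have "eventually (\<lambda>w::complex. w \<in> ball 0 1) (nhds 0)" by (rule eventually_nhds_in_open) auto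
    then show "eventually (\<lambda>w. (\<lambda>n. fps_nth (cauchy_fps p) n * w ^ n) sums G w) (nhds 0)"
    proof eventually_elim
      case (elim w)
      show ?case
      proof (cases "w = 0")
        case True
        then show ?thesis using powser_sums_zero[of "fps_nth (cauchy_fps p)"] by (simp add: G_def cauchy_fps_def)
      next
        case False
        then have "1 < cmod (inverse w)" using elim by (simp add: norm_inverse one_less_inverse)
        from cauchy_sums[OF this, of p]
        have "(\<lambda>j. fps_nth (cauchy_fps p) (Suc j) * w ^ Suc j) sums cauchy p (inverse w)"
          by (simp add: cauchy_fps_def divide_inverse power_inverse mult_ac)
        from sums_Suc_imp[OF _ this] show ?thesis using False by (simp add: G_def cauchy_fps_def)
      qed
    qed
  qed
  moreover have "eventually (\<lambda>z. cauchy p z = G (inverse z)) at_infinity"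
    using eventually_nonzero_at_infinity by eventually_elim (simp add: G_def)
  ultimately show ?thesis unfolding expands_at_infinity_def by blast
qed

text \<open>Row \<open>N j\<close> of \<open>U\<close> applied to the functions of the second kind,
  see \<open>\<psi>_eq\<close>.\<close>

definition \<psi> where "\<psi> j = cauchy (Q (N j))"

lemma cauchy_P_rec:
  assumes "1 < cmod z"
  shows "z * cauchy (P 0) z + of_real mass = cauchy (P (Suc 0)) z + of_real (b 0) * cauchy (P 0) z"
    and "z * cauchy (P (Suc n)) z = cauchy (P (Suc (Suc n))) z + of_real (b (Suc n)) * cauchy (P (Suc n)) z + of_real (c n) * cauchy (P n) z"
proof -
  have "cauchy (pCons 0 (P 0)) z = z * cauchy (P 0) z + of_real mass"
    using cauchy_pCons[OF assms, of "P 0"] by (simp add: mass_eq_I)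
  moreover have "pCons 0 (P 0) = P (Suc 0) + Polynomial.smult (b 0) (P 0)" by (simp only: P_1 diff_add_cancel)
  ultimately show "z * cauchy (P 0) z + of_real mass = cauchy (P (Suc 0)) z + of_real (b 0) * cauchy (P 0) z"
    by (simp only: cauchy_add[OF assms] cauchy_smult)
  have "cauchy (pCons 0 (P (Suc n))) z = z * cauchy (P (Suc n)) z"
    using cauchy_pCons[OF assms, of "P (Suc n)"] P_ortho_degree[of 1 "Suc n"] by simp
  moreover have "pCons 0 (P (Suc n)) = P (Suc (Suc n)) + Polynomial.smult (b (Suc n)) (P (Suc n)) + Polynomial.smult (c n) (P n)"
    unfolding P_rec by simp
  ultimately show "z * cauchy (P (Suc n)) z = cauchy (P (Suc (Suc n))) z + of_real (b (Suc n)) * cauchy (P (Suc n)) z + of_real (c n) * cauchy (P n) z"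
    by (simp only: cauchy_add[OF assms] cauchy_smult)
qed

lemma \<psi>_eq: "1 < cmod z \<Longrightarrow> \<psi> j z = cauchy (P (Suc (N j))) z - of_real (\<tau> (N j)) * cauchy (P (N j)) z"
  by (simp only: \<psi>_def Q_def cauchy_diff cauchy_smult)

lemma cauchy_P_0_eq: "1 < cmod z \<Longrightarrow> z * cauchy (P (N 0)) z = \<psi> 0 z - of_real mass"
proof -
  assume z: "1 < cmod z"
  have "z * cauchy (P 0) z = cauchy (P (Suc 0)) z + of_real (b 0) * cauchy (P 0) z - of_real mass"
    unfolding eq_diff_eq by (rule cauchy_P_rec(1)[OF z])
  then show ?thesis using \<psi>_eq[OF z, of 0] b_N_0 by simp
qed

text \<open>Row \<open>N (Suc j)\<close> of \<open>J = L U\<close> applied to the functions of the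
  second kind: below the first row \<open>J\<close> acts on them as multiplication by
  \<open>z\<close>, and \<open>L\<close> adds \<open>l (Suc j)\<close> times the row
  \<open>N j\<close>.\<close>

lemma cauchy_P_N_eq:
  assumes "1 < cmod z"
  shows "z * cauchy (P (N (Suc j))) z = \<psi> (Suc j) z + of_real (l (Suc j)) * \<psi> j z"
proof (cases "blk.two j")
  case True
  then have N: "N (Suc j) = Suc (Suc (N j))" by (simp add: blk.two_def)
  have "complex_of_real (\<tau> (N j)) = 0" using True by (simp add: \<tau>_eq_0_iff)
  moreover have "complex_of_real (c (Suc (N j))) = of_real (l (Suc j))" using c_Suc_N[OF True] by simp
  moreover have "complex_of_real (b (N (Suc j))) = - of_real (\<tau> (N (Suc j)))" using b_N_Suc[of j] True by simp
  ultimately show ?thesis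
    unfolding \<psi>_eq[OF assms] N cauchy_P_rec(2)[OF assms, of "Suc (N j)"] by simp
next
  case False
  then have N: "N (Suc j) = Suc (N j)" by (simp add: blk.Suc_N)
  have "complex_of_real (c (N j)) = - (of_real (l (Suc j)) * of_real (\<tau> (N j)))"
    using c_N[OF False] False by (simp add: u0_def)
  moreover have "complex_of_real (b (N (Suc j))) = - of_real (\<tau> (N (Suc j))) + of_real (l (Suc j))"
    using b_N_Suc[of j] False by simp
  ultimately show ?thesis
    unfolding \<psi>_eq[OF assms] N cauchy_P_rec(2)[OF assms, of "N j"] by (simp only:) (simp add: algebra_simps)
qed

text \<open>The lower coefficients are the entries of diagonal block \<open>j\<close> of
  \<open>U L\<close>, as in \<open>UL_tridiag\<close>, with opposite sign.\<close>

definition schur_poly :: "nat \<Rightarrow> real poly" where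
  "schur_poly j = (if blk.two j then [:- (u0 j + l (Suc j)), - u1 j, 1:] else [:- (u0 j + l (Suc j)), 1:])"

text \<open>\<open>U L\<close> acts on the functions \<open>\<psi>\<close> as multiplication by
  \<open>z\<close>, up to the inhomogeneous term at the start. The bracket is
  \<open>l j * \<psi> (j - 1)\<close> by \<open>cauchy_P_N_eq\<close>, and \<open>- mass\<close> for
  \<open>j = 0\<close>.\<close>

lemma schur_poly_\<psi>:
  assumes "1 < cmod z"
  shows "poly (map_poly of_real (schur_poly j)) z * \<psi> j z = \<psi> (Suc j) z + of_real (u0 j) * (z * cauchy (P (N j)) z - \<psi> j z)"
proof (cases "blk.two j")
  case True
  then have N: "N (Suc j) = Suc (Suc (N j))" by (simp add: blk.two_def)
  have t0: "\<tau> (N j) = 0" using True by (simp add: \<tau>_eq_0_iff)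
  have "z * \<psi> j z = cauchy (P (N (Suc j))) z + of_real (u1 j) * \<psi> j z + of_real (u0 j) * cauchy (P (N j)) z"
    using cauchy_P_rec(2)[OF assms, of "N j"] \<psi>_eq[OF assms, of j] t0 True
    unfolding N by (simp add: u1_def u0_def)
  moreover have "poly (map_poly of_real (schur_poly j)) z = z * z - of_real (u1 j) * z - of_real (u0 j) - of_real (l (Suc j))"
    using True by (simp add: schur_poly_def map_poly_pCons algebra_simps)
  ultimately show ?thesis using eliminate_quadratic[OF _ cauchy_P_N_eq[OF assms, of j]] by simp
next
  case False
  then have N: "N (Suc j) = Suc (N j)" by (simp add: blk.Suc_N)
  have "\<psi> j z = cauchy (P (N (Suc j))) z + of_real (u0 j) * cauchy (P (N j)) z"
    using \<psi>_eq[OF assms, of j] False unfolding N by (simp add: u0_def)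
  moreover have "poly (map_poly of_real (schur_poly j)) z = z - of_real (u0 j) - of_real (l (Suc j))"
    using False by (simp add: schur_poly_def map_poly_pCons algebra_simps)
  moreover have "z * \<psi> j z = z * cauchy (P (N (Suc j))) z + of_real (u0 j) * (z * cauchy (P (N j)) z)"
    by (subst calculation(1)) (simp add: algebra_simps)
  ultimately show ?thesis unfolding cauchy_P_N_eq[OF assms, of j] by (simp add: left_diff_distrib right_diff_distrib)
qed

text \<open>The value \<open>-1\<close> at index \<open>0\<close> makes the three-term recurrence below hold from the start.\<close>

fun \<Phi> :: "nat \<Rightarrow> complex \<Rightarrow> complex" where
  "\<Phi> 0 z = - 1"
| "\<Phi> (Suc j) z = \<psi> j z / of_real (g j)"

text \<open>Division by \<open>g\<close> makes the coefficient of the preceding function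
  \<open>1\<close>, as a continued fraction needs it. The last coefficient becomes
  \<open>g (Suc j) / g j\<close>, which by \<open>l_u0\<close> is the subdiagonal entry of
  \<open>U L\<close>.\<close>

lemma \<Phi>_rec:
  assumes "1 < cmod z"
  shows "\<Phi> j z = poly (map_poly of_real (schur_poly j)) z * \<Phi> (Suc j) z - of_real (g (Suc j) / g j) * \<Phi> (Suc (Suc j)) z"
proof -
  have g: "complex_of_real (g j) \<noteq> 0" "complex_of_real (g (Suc j)) \<noteq> 0" using g_nonzero by auto
  have "poly (map_poly of_real (schur_poly j)) z * \<psi> j z = \<psi> (Suc j) z + of_real (g j) * \<Phi> j z"
  proof (cases j)
    case 0
    have "h (N 0) = mass" by (simp add: h_def mass_eq_I)
    then have "complex_of_real (g 0) = of_real (u0 0) * of_real mass" by (simp add: g_def)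
    then show ?thesis using schur_poly_\<psi>[OF assms, of 0] cauchy_P_0_eq[OF assms] 0 by simp
  next
    case (Suc i)
    have "u0 (Suc i) * l (Suc i) = g (Suc i) / g i" using l_u0[of i] by (simp add: mult.commute)
    then have "complex_of_real (u0 (Suc i)) * of_real (l (Suc i)) = of_real (g (Suc i)) / of_real (g i)"
      by (metis of_real_divide of_real_mult)
    then show ?thesis
      using schur_poly_\<psi>[OF assms, of j] cauchy_P_N_eq[OF assms, of i] unfolding Suc
      by (simp flip: mult.assoc)
  qed
  then have "of_real (g j) * \<Phi> j z = poly (map_poly of_real (schur_poly j)) z * \<psi> j z - \<psi> (Suc j) z" by simp
  then have "\<Phi> j z = (poly (map_poly of_real (schur_poly j)) z * \<psi> j z - \<psi> (Suc j) z) / of_real (g j)"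
    using g(1) by (simp add: eq_divide_eq mult.commute)
  then show ?thesis using g by (simp add: diff_divide_distrib)
qed

definition \<Phi>fps :: "nat \<Rightarrow> complex fps" where
  "\<Phi>fps j = (case j of 0 \<Rightarrow> - 1 | Suc i \<Rightarrow> fps_const (1 / of_real (g i)) * cauchy_fps (Q (N i)))"

lemma \<Phi>_expands: "expands_at_infinity (\<Phi> j) (\<Phi>fps j)"
proof (cases j)
  case 0
  have "(\<lambda>w. - 1 :: complex) has_fps_expansion - 1" by (intro fps_expansion_intros)
  then show ?thesis unfolding expands_at_infinity_def 0 by (intro exI[of _ "\<lambda>w. - 1"]) (simp add: \<Phi>fps_def)
next
  case (Suc i)
  have "\<Phi>fps j = fps_const (1 / of_real (g i)) * cauchy_fps (Q (N i))" by (simp add: Suc \<Phi>fps_def)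
  then show ?thesis
    by (simp only:) (rule expands_cong[OF expands_cmult[OF cauchy_expands]], simp add: Suc \<psi>_def)
qed

lemma real_\<Phi>fps: "real_fps (\<Phi>fps j)"
proof (cases j)
  case (Suc i)
  then show ?thesis by (auto simp: \<Phi>fps_def intro!: real_fps_cmult real_cauchy_fps)
qed (simp add: \<Phi>fps_def real_fps_iff)

lemma I_P_monom: "I (P n * monom 1 n) = h n"
proof -
  have "I (P n * (monom 1 n - P n)) = 0"
    by (rule P_ortho) (use P_coeffs[of n] in \<open>auto simp: le_less\<close>)
  then show ?thesis by (simp only: right_diff_distrib I_diff h_def)
qed

lemma I_P_monom_less: "k < n \<Longrightarrow> I (P n * monom 1 k) = 0"
  by (rule P_ortho_degree) (simp add: degree_monom_eq)

text \<open>In a block of size 2 the orthogonality reaches one degree further than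
  \<open>I_Q_ortho\<close>, since then \<open>Q (N j) = P (Suc (N j))\<close>. Consequently
  \<open>\<Phi> (Suc j)\<close> decays exactly like \<open>1 / z ^ N (Suc j)\<close>, which yields
  the degrees of the Schur polynomials.\<close>

lemma Q_moments:
  shows "Suc k < N (Suc j) \<Longrightarrow> I (Q (N j) * monom 1 k) = 0"
    and "I (Q (N j) * monom 1 (N (Suc j) - 1)) = g j"
proof -
  have Q: "I (Q (N j) * monom 1 k) =
      I (P (Suc (N j)) * monom 1 k) - \<tau> (N j) * I (P (N j) * monom 1 k)" for k
    by (simp only: Q_def left_diff_distrib mult_smult_left I_diff I_smult)
  show "I (Q (N j) * monom 1 k) = 0" if "Suc k < N (Suc j)"
  proof (cases "k < N j")
    case True
    then show ?thesis by (simp add: Q I_P_monom_less)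
  next
    case False
    then have "blk.two j" "k = N j" using that blk.gap[of j] by (auto simp: blk.two_def)
    then show ?thesis using \<tau>_eq_0_iff[of j] by (simp add: Q I_P_monom_less)
  qed
  show "I (Q (N j) * monom 1 (N (Suc j) - 1)) = g j"
  proof (cases "blk.two j")
    case True
    then have "N (Suc j) - 1 = Suc (N j)" by (simp add: blk.two_def)
    then show ?thesis using True \<tau>_eq_0_iff[of j] h_pos[of "N j"]
      by (simp add: Q I_P_monom g_def u0_def c_def)
  next
    case False
    then have "N (Suc j) - 1 = N j" by (simp add: blk.Suc_N[symmetric])
    then show ?thesis using False by (simp add: Q I_P_monom I_P_monom_less g_def u0_def)
  qed
qed

lemma \<Phi>fps_lead: "fps_nth (\<Phi>fps j) (N j) = - 1" and \<Phi>fps_low: "i < N j \<Longrightarrow> fps_nth (\<Phi>fps j) i = 0"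
proof -
  have "fps_nth (\<Phi>fps j) (N j) = - 1 \<and> (\<forall>i<N j. fps_nth (\<Phi>fps j) i = 0)"
  proof (cases j)
    case (Suc k)
    have "N (Suc k) > 0" using blk.gap[of k] by auto
    then show ?thesis
      using Q_moments(1)[of _ k] Q_moments(2)[of k] g_nonzero[of k] by (auto simp: Suc \<Phi>fps_def cauchy_fps_def)
  qed (simp add: \<Phi>fps_def)
  then show "fps_nth (\<Phi>fps j) (N j) = - 1" "i < N j \<Longrightarrow> fps_nth (\<Phi>fps j) i = 0" by auto
qed

lemma subdegree_\<Phi>fps: "subdegree (\<Phi>fps j) = N j"
  by (rule subdegreeI) (use \<Phi>fps_lead \<Phi>fps_low in auto)

lemma \<Phi>fps_nonzero: "\<Phi>fps j \<noteq> 0"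
  using \<Phi>fps_lead[of j] by auto

section \<open>Identification of the Schur iterates\<close>

definition ratio where "ratio j = \<Phi>fps (Suc j) / \<Phi>fps j"

lemma ratio:
  shows "expands_at_infinity (\<lambda>z. \<Phi> (Suc j) z / \<Phi> j z) (ratio j)" "real_fps (ratio j)" "ratio j \<noteq> 0"
    "fps_nth (ratio j) 0 = 0" "fps_nth (ratio j) (subdegree (ratio j)) = 1"
proof -
  have less: "N j < N (Suc j)" by simp
  have le: "subdegree (\<Phi>fps j) \<le> subdegree (\<Phi>fps (Suc j))" using less by (simp only: subdegree_\<Phi>fps less_imp_le)
  show "expands_at_infinity (\<lambda>z. \<Phi> (Suc j) z / \<Phi> j z) (ratio j)"
    unfolding ratio_def by (rule expands_divide[OF \<Phi>_expands \<Phi>_expands \<Phi>fps_nonzero le])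
  show "real_fps (ratio j)"
    unfolding ratio_def by (rule real_fps_divide[OF real_\<Phi>fps real_\<Phi>fps \<Phi>fps_nonzero le])
  have "\<Phi>fps j dvd \<Phi>fps (Suc j)" using le by (simp add: fps_dvd_iff \<Phi>fps_nonzero)
  then have m: "ratio j * \<Phi>fps j = \<Phi>fps (Suc j)" unfolding ratio_def by (rule dvd_div_mult_self)
  then show nz: "ratio j \<noteq> 0" using \<Phi>fps_nonzero[of "Suc j"] by auto
  have sd: "subdegree (ratio j) + N j = N (Suc j)"
    using subdegree_mult[OF nz \<Phi>fps_nonzero[of j]] unfolding m subdegree_\<Phi>fps by simp
  then have "subdegree (ratio j) > 0" using less by linarith
  then show "fps_nth (ratio j) 0 = 0" by (rule nth_less_subdegree_zero)
  have "fps_nth (ratio j) (subdegree (ratio j)) * fps_nth (\<Phi>fps j) (subdegree (\<Phi>fps j)) = fps_nth (\<Phi>fps (Suc j)) (N (Suc j))"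
    using nth_subdegree_mult[of "ratio j" "\<Phi>fps j"] unfolding m subdegree_\<Phi>fps sd by simp
  then show "fps_nth (ratio j) (subdegree (ratio j)) = 1" unfolding subdegree_\<Phi>fps \<Phi>fps_lead by simp
qed

lemma FF_eq_C: "FF z = cauchy [:0, 1:] z"
  by (simp add: FF_def cauchy_def t_kernel_def)

lemma Q_N_0: "Q (N 0) = [:0, 1:]"
proof -
  have "Q 0 = pCons 0 (P 0)" using b_N_0 by (simp only: Q_def P_1) (simp add: smult_minus_left)
  then show ?thesis by (simp add: one_pCons)
qed

lemma asymp_coeffs_FF: "asymp_coeffs FF = s"
proof -
  have "asymp_coeffs FF = (\<lambda>j. - Re (fps_nth (cauchy_fps [:0, 1:]) (Suc j)))"
  proof (rule asymp_coeffs_expands[OF _ real_cauchy_fps])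
    have "FF = cauchy [:0, 1:]" using FF_eq_C by auto
    then show "expands_at_infinity FF (cauchy_fps [:0, 1:])" by (simp only: cauchy_expands)
  qed (simp add: cauchy_fps_def)
  also have "\<dots> = s"
  proof
    fix j
    have "[:0, 1:] * monom 1 j = (monom 1 (Suc j) :: real poly)" by (simp add: monom_Suc)
    then show "- Re (fps_nth (cauchy_fps [:0, 1:]) (Suc j)) = s j"
      by (simp add: cauchy_fps_def s_eq del: mult_pCons_left)
  qed
  finally show ?thesis .
qed

text \<open>The functions \<open>schur_iter FF j\<close> are only determined near infinity here; all the coefficients
  extracted from them depend on nothing else.\<close>

definition near :: "nat \<Rightarrow> (complex \<Rightarrow> complex) \<Rightarrow> bool" where
  "near j f \<longleftrightarrow> eventually (\<lambda>z. f z = - of_real (sgn (g j)) * (\<Phi> (Suc j) z / \<Phi> j z)) at_infinity"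

lemma expands_ratio:
  assumes "eventually (\<lambda>z. f z = of_real a * (\<Phi> (Suc j) z / \<Phi> j z)) at_infinity" "a \<noteq> 0"
  shows "expands_at_infinity f (fps_const (of_real a) * ratio j)" "real_fps (fps_const (of_real a) * ratio j)"
    "fps_nth (fps_const (of_real a) * ratio j) 0 = 0" "fps_const (of_real a) * ratio j \<noteq> 0" "first_coeff f = - a"
proof -
  show 1: "expands_at_infinity f (fps_const (of_real a) * ratio j)"
    by (rule expands_cong[OF expands_cmult[OF ratio(1)] assms(1)])
  show 2: "real_fps (fps_const (of_real a) * ratio j)" by (rule real_fps_cmult[OF _ ratio(2)]) simp
  show 3: "fps_nth (fps_const (of_real a) * ratio j) 0 = 0" by (simp add: ratio(4))
  have c0: "fps_const (complex_of_real a) \<noteq> 0" using assms(2) by simp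
  show 4: "fps_const (of_real a) * ratio j \<noteq> 0" using c0 ratio(3) by simp
  have "subdegree (fps_const (of_real a) * ratio j) = subdegree (ratio j)"
    using subdegree_mult[OF c0 ratio(3)] by simp
  then show "first_coeff f = - a" using first_coeff_expands[OF 1 2 3 4] by (simp add: ratio(5))
qed

lemma sgn_g: "sgn (g j) \<noteq> 0" using g_nonzero by (simp add: sgn_zero_iff)

lemma near_first_coeff: "near j f \<Longrightarrow> first_coeff f = sgn (g j)"
  using expands_ratio(5)[of f "- sgn (g j)" j] sgn_g by (simp add: near_def)

text \<open>\<open>\<Phi>_rec\<close> divided by \<open>\<Phi> (Suc j)\<close>: a step of the Schur
  algorithm is a step of the continued fraction of the successive quotients. The sign is its own
  inverse.\<close>

lemma near_remainder:
  assumes "near j f"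
  shows "eventually (\<lambda>z. - 1 / f z - of_real (first_coeff f) * poly (map_poly of_real (schur_poly j)) z =
      of_real (- g (Suc j) / \<bar>g j\<bar>) * (\<Phi> (Suc (Suc j)) z / \<Phi> (Suc j) z)) at_infinity"
proof -
  have "eventually (\<lambda>z::complex. 1 < cmod z) at_infinity"
    unfolding eventually_at_infinity by (intro exI[of _ 2]) auto
  with assms[unfolded near_def] expands_eventually_nonzero[OF \<Phi>_expands \<Phi>fps_nonzero, of j]
    expands_eventually_nonzero[OF \<Phi>_expands \<Phi>fps_nonzero, of "Suc j"]
  show ?thesis
  proof eventually_elim
    case (elim z)
    define e where "e = complex_of_real (sgn (g j))"
    have ee: "e * e = 1" using g_nonzero[of j] by (auto simp: e_def sgn_if)
    then have e0: "e \<noteq> 0" by auto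
    define x where "x = \<Phi> (Suc j) z"
    have x0: "x \<noteq> 0" using elim by (simp add: x_def)
    have "1 / e = e" using ee e0 by (simp add: divide_eq_eq)
    then have "- 1 / f z = e * (\<Phi> j z / x)"
      using elim(1) e0 x0 unfolding e_def[symmetric] x_def[symmetric] by (simp add: field_simps)
    also have "\<Phi> j z / x = poly (map_poly of_real (schur_poly j)) z - of_real (g (Suc j) / g j) * (\<Phi> (Suc (Suc j)) z / x)"
      unfolding \<Phi>_rec[OF elim(4), of j] x_def[symmetric] using x0 by (simp add: diff_divide_distrib)
    finally have "- 1 / f z - e * poly (map_poly of_real (schur_poly j)) z = - (e * of_real (g (Suc j) / g j)) * (\<Phi> (Suc (Suc j)) z / x)"
      by (simp add: right_diff_distrib)
    also have "- (e * of_real (g (Suc j) / g j)) = of_real (- g (Suc j) / \<bar>g j\<bar>)"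
      using g_nonzero[of j] by (auto simp: e_def sgn_if)
    finally show ?case unfolding near_first_coeff[OF assms] e_def x_def .
  qed
qed

lemma near_step:
  assumes "near j f"
  shows "poly_part f = schur_poly j" "(schur_scale f)\<^sup>2 = \<bar>g (Suc j) / g j\<bar>" "near (Suc j) (schur_step f)"
proof -
  define a where "a = - g (Suc j) / \<bar>g j\<bar>"
  have a0: "a \<noteq> 0" using g_nonzero by (simp add: a_def)
  note rem = near_remainder[OF assms, folded a_def]
  show schur_poly: "poly_part f = schur_poly j"
  proof (rule poly_part_eq)
    show "lead_coeff (schur_poly j) = 1" by (simp add: schur_poly_def)
    show "first_coeff f \<noteq> 0" using near_first_coeff[OF assms] sgn_g by simp
    show "((\<lambda>z. - 1 / f z - of_real (first_coeff f) * poly (map_poly of_real (schur_poly j)) z) \<longlongrightarrow> 0) at_infinity"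
      by (rule expands_tendsto_0[OF expands_ratio(1,3)[OF rem a0]])
  qed
  have rem': "eventually (\<lambda>z. schur_remainder f z = of_real a * (\<Phi> (Suc (Suc j)) z / \<Phi> (Suc j) z)) at_infinity"
    using rem unfolding schur_remainder_def schur_poly .
  have "schur_scale f = sqrt \<bar>- a\<bar>"
    unfolding schur_scale_eq[OF expands_ratio(1-4)[OF rem' a0]] expands_ratio(5)[OF rem' a0] ..
  then show sc: "(schur_scale f)\<^sup>2 = \<bar>g (Suc j) / g j\<bar>" by (simp add: a_def abs_divide)
  \<comment> \<open>Division by the squared scale leaves a factor of modulus 1, with the sign that
    \<open>near (Suc j)\<close> prescribes.\<close>
  have "a / \<bar>g (Suc j) / g j\<bar> = - sgn (g (Suc j))"
    using g_nonzero[of j] g_nonzero[of "Suc j"] by (auto simp: a_def sgn_if abs_if field_simps)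
  then have key: "complex_of_real a / of_real \<bar>g (Suc j) / g j\<bar> = - of_real (sgn (g (Suc j)))"
    by (metis of_real_divide of_real_minus)
  from rem' show "near (Suc j) (schur_step f)"
    unfolding near_def schur_step_def sc
  proof eventually_elim
    case (elim z)
    show ?case by (simp only: elim key[symmetric] times_divide_eq_left)
  qed
qed

text \<open>\<open>\<Phi> 0 = - 1\<close> and \<open>Q (N 0) = x\<close>, so the first quotient is a
  multiple of \<open>FF\<close>.\<close>

lemma near_0: "near 0 (\<lambda>z. FF z / of_real \<bar>first_coeff FF\<bar>)"
proof -
  have FF: "FF z = of_real (- g 0) * (\<Phi> (Suc 0) z / \<Phi> 0 z)" for z
    using g_nonzero[of 0] Q_N_0 by (simp add: \<psi>_def FF_eq_C)
  have fc: "first_coeff FF = g 0"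
    using expands_ratio(5)[of FF "- g 0" 0, OF always_eventually] FF g_nonzero by simp
  have "- g 0 / \<bar>g 0\<bar> = - sgn (g 0)" using g_nonzero[of 0] by (auto simp: sgn_if)
  then have key: "complex_of_real (- g 0) / of_real \<bar>g 0\<bar> = - of_real (sgn (g 0))"
    by (metis of_real_divide of_real_minus)
  show ?thesis unfolding near_def fc
    by (intro always_eventually allI) (simp only: FF key[symmetric] times_divide_eq_left)
qed

lemma near_schur_iter: "near j (schur_iter FF j)"
proof (induction j)
  case 0
  show ?case using near_0 by (simp add: schur_iter_def)
next
  case (Suc j)
  have "schur_iter FF (Suc j) = schur_step (schur_iter FF j)" by (simp add: schur_iter_def)
  then show ?case using near_step(3)[OF Suc] by simp
qed

text \<open>The signs of \<open>g j\<close> and \<open>g (Suc j)\<close> restore what the absolute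
  value in the squared scale \<open>|g (Suc j) / g j|\<close> has lost.\<close>

lemma gen_jacobi_c_eq: "gen_jacobi_c FF j = l (Suc j) * u0 (Suc j)"
  unfolding gen_jacobi_c_def near_first_coeff[OF near_schur_iter] near_step(2)[OF near_schur_iter] l_u0
  using g_nonzero[of j] g_nonzero[of "Suc j"] unfolding abs_divide by (auto simp: sgn_if abs_if)

lemma gen_jacobi_UL: "gen_jacobi_matrix FF = matrix_prod (block_upper N u0 u1) (block_lower N l)"
proof -
  have "gen_jacobi_matrix FF = blk.block_tridiag (\<lambda>i. - coeff (schur_poly i) 0) (\<lambda>i. - coeff (schur_poly i) 1) (gen_jacobi_c FF)"
    unfolding gen_jacobi_matrix_def blk.block_tridiag_def asymp_coeffs_FF N_def[symmetric]
      near_step(1)[OF near_schur_iter] Let_def ..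
  also have "\<dots> = blk.block_tridiag (\<lambda>i. u0 i + l (Suc i)) u1 (\<lambda>i. l (Suc i) * u0 (Suc i))"
    by (rule blk.block_tridiag_cong) (auto simp: schur_poly_def gen_jacobi_c_eq)
  finally show ?thesis unfolding blk.UL_tridiag .
qed

text \<open>The total mass is the parameter for which \<open>U L\<close> has the factors of
  \<open>J = L U\<close>: as \<open>Q (N 0) = x\<close>, the first nonzero shifted moment is
  \<open>g 0 = u0 0 * h 0\<close>, and \<open>h 0 = mass\<close>.\<close>

lemma u0_0: "u0 0 = s (N 1 - 1) / mass"
proof -
  have "s (N 1 - 1) = I (Q (N 0) * monom 1 (N (Suc 0) - 1))"
    by (simp only: Q_N_0) (simp add: s_eq monom_Suc)
  also have "\<dots> = u0 0 * mass" unfolding Q_moments(2) by (simp add: g_def h_def mass_eq_I)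
  finally show ?thesis using h_pos[of 0] by (simp add: h_def mass_eq_I)
qed

lemma UL_bounded_iff:
  "(\<exists>L U. block_UL_factorization s mass (gen_jacobi_matrix FF) L U \<and> ell2_bounded U) \<longleftrightarrow>
   (\<exists>C. \<forall>j. \<bar>\<tau> (N j)\<bar> \<le> C)"
  unfolding upper_bounded_iff[symmetric]
proof
  assume "ell2_bounded (block_upper N u0 u1)"
  moreover have "block_UL_factorization s mass (gen_jacobi_matrix FF) (block_lower N l) (block_upper N u0 u1)"
    unfolding block_UL_factorization_def N_def[symmetric] using gen_jacobi_UL u0_0 by blast
  ultimately show "\<exists>L U. block_UL_factorization s mass (gen_jacobi_matrix FF) L U \<and> ell2_bounded U" by blast
next
  assume "\<exists>L U. block_UL_factorization s mass (gen_jacobi_matrix FF) L U \<and> ell2_bounded U"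
  then obtain l' u0' u1' where
    e: "gen_jacobi_matrix FF = matrix_prod (block_upper N u0' u1') (block_lower N l')" "u0' 0 = s (N 1 - 1) / mass"
    and bd: "ell2_bounded (block_upper N u0' u1')"
    unfolding block_UL_factorization_def N_def[symmetric] by blast
  have "block_upper N u0 u1 = block_upper N u0' u1'"
    by (rule blk.UL_unique[of _ _ l _ _ l']) (use e gen_jacobi_UL l_nonzero u0_0 in auto)
  then show "ell2_bounded (block_upper N u0 u1)" using bd by simp
qed

end

theorem theorem6p3:
  fixes \<alpha> \<beta> :: real and \<sigma> :: "real measure"
  defines "E \<equiv> {-1..\<alpha>} \<union> {\<beta>..1}"
  defines "FF \<equiv> (\<lambda>z. LINT t|\<sigma>. complex_of_real t / (complex_of_real t - z))"
  defines "s \<equiv> (\<lambda>j::nat. LINT t|\<sigma>. t ^ (j + 1))"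
  defines "s_minus1 \<equiv> (LINT t|\<sigma>. 1 :: real)"
  assumes "-1 \<le> \<alpha>" "\<alpha> \<le> 0" "0 \<le> \<beta>" "\<beta> \<le> 1"
    and "finite_measure \<sigma>" "sets \<sigma> = sets borel"
    and "emeasure \<sigma> (UNIV - E) = 0" "infinite (measure_support \<sigma>)"
    and "class_D_minus FF"
  shows
    "((\<exists>L U. block_UL_factorization s s_minus1 (gen_jacobi_matrix FF) L U \<and> ell2_bounded U) \<longleftrightarrow>
      (\<exists>L U. block_LU_factorization s (monic_jacobi_matrix \<sigma>) L U \<and> ell2_bounded U)) \<and>
     ((\<exists>L U. block_LU_factorization s (monic_jacobi_matrix \<sigma>) L U \<and> ell2_bounded U) \<longleftrightarrow>
      (\<exists>\<epsilon>\<ge>0. locally_uniform_limit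
        (- Fin ` complex_of_real ` ({-1 - \<epsilon>..\<alpha>} \<union> {\<beta>..1 + \<epsilon>}))
        (\<lambda>j. pade_approximant s (normal_index s j) (normal_index s j))
        (sphere_ext FF)))"
proof -
  interpret M: two_interval_measure \<alpha> \<beta> \<sigma>
    by (rule two_interval_measure.intro[OF assms(5-10) assms(11)[unfolded E_def] assms(12)])
  have s: "s = M.s" by (simp add: s_def M.s_def[abs_def])
  have FF: "FF = M.FF" by (simp add: FF_def M.FF_def[abs_def] t_kernel_def)
  have s_minus1: "s_minus1 = M.mass" by (simp add: s_minus1_def M.mass_def)
  show ?thesis
    unfolding s FF s_minus1 M.N_def[symmetric] M.UL_bounded_iff M.LU_bounded_iff M.pade_converges_iff
    by simp
qed

end
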